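(* Let $r\ge 1$, let $S=\mathbb{R}[z_1,\dots,z_r]/\big(\sum_{i=1}^r z_i^2-1\big)$, equipped with the action of the cyclic group $C_2$ of order $2$ given by $z_i\mapsto -z_i$, and let $R=S^{C_2}$. The quadratic étale algebra $S$ over $R$ cannot be generated, as an $R$-algebra, by fewer than $r$ elements.
   Context: Here $\mathbb{R}$ is the field of real numbers. A quadratic étale algebra over a ring $R$ is a commutative $R$-algebra that is étale (flat, separable, finitely presented) and of rank $2$ as a projective $R$-module. *)

theory Defs
  imports
    "HOL-Algebra.Algebra"
    "HOL-Algebra.Algebraic_Closure_Type"
begin

section \<open>Modules and algebras over a commutative ring\<close>

definition module_homs ::
    "('a, 'r) ring_scheme \<Rightarrow> ('a, 'b, 'm) module_scheme \<Rightarrow> ('a, 'c, 'n) module_scheme \<Rightarrow> ('b \<Rightarrow> 'c) set" where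
  "module_homs R M N =
     {f \<in> carrier M \<rightarrow> carrier N.
        (\<forall>x \<in> carrier M. \<forall>y \<in> carrier M. f (x \<oplus>\<^bsub>M\<^esub> y) = f x \<oplus>\<^bsub>N\<^esub> f y) \<and>
        (\<forall>a \<in> carrier R. \<forall>x \<in> carrier M. f (a \<odot>\<^bsub>M\<^esub> x) = a \<odot>\<^bsub>N\<^esub> f x)}"

text \<open>The ring \<open>R\<close> with scalar multiplication given by its own multiplication. It is used both for
  \<open>R\<close> as a module over itself and for \<open>R\<close> as an algebra over any of its subrings.\<close>

definition self_algebra :: "('a, 'r) ring_scheme \<Rightarrow> ('a, 'a) module" where
  "self_algebra R =
     \<lparr>carrier = carrier R, monoid.mult = monoid.mult R, one = one R, ring.zero = ring.zero R,
      add = add R, module.smult = monoid.mult R\<rparr>"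

definition generates_algebra ::
    "('a, 'r) ring_scheme \<Rightarrow> ('a, 'b, 'm) module_scheme \<Rightarrow> 'b set \<Rightarrow> bool" where
  "generates_algebra R A G \<longleftrightarrow>
     G \<subseteq> carrier A \<and>
     generate_ring A ((\<lambda>a. a \<odot>\<^bsub>A\<^esub> \<one>\<^bsub>A\<^esub>) ` carrier R \<union> G) = carrier A"

subsection \<open>Tensor products\<close>

text \<open>\<open>M \<otimes>\<^sub>R N\<close> is the free abelian group on \<open>carrier M \<times> carrier N\<close> modulo the subgroup generated by
  the bilinearity relations. It is written multiplicatively, as are the library's free abelian
  groups.\<close>

definition tensor_relations ::
    "('a, 'r) ring_scheme \<Rightarrow> ('a, 'b, 'm) module_scheme \<Rightarrow> ('a, 'c, 'n) module_scheme
      \<Rightarrow> ('b \<times> 'c \<Rightarrow>\<^sub>0 int) set" where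
  "tensor_relations R M N = generate (free_Abelian_group (carrier M \<times> carrier N))
     ({frag_of (x \<oplus>\<^bsub>M\<^esub> x', y) - frag_of (x, y) - frag_of (x', y) |x x' y.
         x \<in> carrier M \<and> x' \<in> carrier M \<and> y \<in> carrier N} \<union>
      {frag_of (x, y \<oplus>\<^bsub>N\<^esub> y') - frag_of (x, y) - frag_of (x, y') |x y y'.
         x \<in> carrier M \<and> y \<in> carrier N \<and> y' \<in> carrier N} \<union>
      {frag_of (a \<odot>\<^bsub>M\<^esub> x, y) - frag_of (x, a \<odot>\<^bsub>N\<^esub> y) |a x y.
         a \<in> carrier R \<and> x \<in> carrier M \<and> y \<in> carrier N})"

definition tensor_product ::
    "('a, 'r) ring_scheme \<Rightarrow> ('a, 'b, 'm) module_scheme \<Rightarrow> ('a, 'c, 'n) module_scheme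
      \<Rightarrow> ('b \<times> 'c \<Rightarrow>\<^sub>0 int) set monoid" where
  "tensor_product R M N =
     free_Abelian_group (carrier M \<times> carrier N) Mod tensor_relations R M N"

text \<open>The map \<open>f \<otimes> g\<close> into \<open>M' \<otimes>\<^sub>R N'\<close>, for linear \<open>f\<close> and \<open>g\<close>. On the elements of a coset the
  union is taken over one and the same coset.\<close>

definition tensor_map ::
    "('a, 'r) ring_scheme \<Rightarrow> ('a, 'b, 'm) module_scheme \<Rightarrow> ('a, 'c, 'n) module_scheme
      \<Rightarrow> ('d \<Rightarrow> 'b) \<Rightarrow> ('e \<Rightarrow> 'c) \<Rightarrow> ('d \<times> 'e \<Rightarrow>\<^sub>0 int) set \<Rightarrow> ('b \<times> 'c \<Rightarrow>\<^sub>0 int) set" where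
  "tensor_map R M' N' f g t =
     (\<Union>c\<in>t. tensor_relations R M' N' #>\<^bsub>free_Abelian_group (carrier M' \<times> carrier N')\<^esub>
              frag_extend (\<lambda>(x, y). frag_of (f x, g y)) c)"

text \<open>The map \<open>A \<otimes>\<^sub>R A \<rightarrow> A\<close>, \<open>x \<otimes> y \<mapsto> x y\<close>.\<close>

definition tensor_multiplication ::
    "('b, 'm) ring_scheme \<Rightarrow> ('b \<times> 'b \<Rightarrow>\<^sub>0 int) set \<Rightarrow> 'b" where
  "tensor_multiplication A t = the_elem
     ((\<lambda>c. \<Oplus>\<^bsub>A\<^esub>p\<in>Poly_Mapping.keys c.
            [Poly_Mapping.lookup c p] \<cdot>\<^bsub>A\<^esub> (fst p \<otimes>\<^bsub>A\<^esub> snd p)) ` t)"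

subsection \<open>Flat, projective and separable\<close>

text \<open>The type arguments are the types of the elements of the test modules. A statement in which
  these types are free ranges over test modules of all types.\<close>

definition flat_module ::
    "'m itself \<Rightarrow> 'n itself \<Rightarrow> ('a, 'r) ring_scheme \<Rightarrow> ('a, 'b, 's) module_scheme \<Rightarrow> bool" where
  "flat_module tm tn R A \<longleftrightarrow> module R A \<and>
     (\<forall>(M :: ('a, 'm) module) (N :: ('a, 'n) module) f.
        module R M \<longrightarrow> module R N \<longrightarrow> f \<in> module_homs R M N \<longrightarrow> inj_on f (carrier M) \<longrightarrow>
        inj_on (tensor_map R N A f (\<lambda>x. x)) (carrier (tensor_product R M A)))"

definition projective_module ::
    "'m itself \<Rightarrow> 'n itself \<Rightarrow> ('a, 'r) ring_scheme \<Rightarrow> ('a, 'b, 's) module_scheme \<Rightarrow> bool" where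
  "projective_module tm tn R A \<longleftrightarrow> module R A \<and>
     (\<forall>(M :: ('a, 'm) module) (N :: ('a, 'n) module) g h.
        module R M \<longrightarrow> module R N \<longrightarrow>
        g \<in> module_homs R M N \<longrightarrow> g ` carrier M = carrier N \<longrightarrow> h \<in> module_homs R A N \<longrightarrow>
        (\<exists>k \<in> module_homs R A M. \<forall>x \<in> carrier A. g (k x) = h x))"

text \<open>A commutative algebra \<open>A\<close> is separable if the multiplication \<open>A \<otimes>\<^sub>R A \<rightarrow> A\<close> has a section that
  is linear for both actions of \<open>A\<close> on \<open>A \<otimes>\<^sub>R A\<close>, i.e. that splits it over \<open>A \<otimes>\<^sub>R A\<close>.\<close>

definition separable_algebra ::
    "('a, 'r) ring_scheme \<Rightarrow> ('a, 'b, 'm) module_scheme \<Rightarrow> bool" where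
  "separable_algebra R A \<longleftrightarrow> algebra R A \<and>
     (\<exists>d \<in> carrier A \<rightarrow> carrier (tensor_product R A A).
        (\<forall>x \<in> carrier A. \<forall>y \<in> carrier A. d (x \<oplus>\<^bsub>A\<^esub> y) = d x \<otimes>\<^bsub>tensor_product R A A\<^esub> d y) \<and>
        (\<forall>s \<in> carrier A. \<forall>x \<in> carrier A.
           d (s \<otimes>\<^bsub>A\<^esub> x) = tensor_map R A A (\<lambda>y. s \<otimes>\<^bsub>A\<^esub> y) (\<lambda>y. y) (d x) \<and>
           d (x \<otimes>\<^bsub>A\<^esub> s) = tensor_map R A A (\<lambda>y. y) (\<lambda>y. y \<otimes>\<^bsub>A\<^esub> s) (d x)) \<and>
        (\<forall>x \<in> carrier A. tensor_multiplication A (d x) = x))"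

subsection \<open>Localization and rank\<close>

text \<open>The fraction \<open>m/s\<close> with numerator in the \<open>R\<close>-module \<open>M\<close> and denominator in the multiplicative
  set \<open>U\<close>, as an equivalence class of pairs. The operations below are unions over all
  representatives; the classes in such a union coincide.\<close>

definition fraction ::
    "('a, 'r) ring_scheme \<Rightarrow> 'a set \<Rightarrow> ('a, 'b, 'm) module_scheme \<Rightarrow> 'b \<Rightarrow> 'a \<Rightarrow> ('b \<times> 'a) set" where
  "fraction R U M m s =
     {(m', s'). m' \<in> carrier M \<and> s' \<in> U \<and>
        (\<exists>u\<in>U. (u \<otimes>\<^bsub>R\<^esub> s') \<odot>\<^bsub>M\<^esub> m = (u \<otimes>\<^bsub>R\<^esub> s) \<odot>\<^bsub>M\<^esub> m')}"

definition localization ::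
    "('a, 'r) ring_scheme \<Rightarrow> 'a set \<Rightarrow> ('a, 'b, 'm) module_scheme
      \<Rightarrow> (('a \<times> 'a) set, ('b \<times> 'a) set) module" where
  "localization R U M =
     \<lparr>carrier = {fraction R U M m s |m s. m \<in> carrier M \<and> s \<in> U},
      monoid.mult = (\<lambda>x y. \<Union>(m, s)\<in>x. \<Union>(n, t)\<in>y. fraction R U M (m \<otimes>\<^bsub>M\<^esub> n) (s \<otimes>\<^bsub>R\<^esub> t)),
      one = fraction R U M \<one>\<^bsub>M\<^esub> \<one>\<^bsub>R\<^esub>,
      ring.zero = fraction R U M \<zero>\<^bsub>M\<^esub> \<one>\<^bsub>R\<^esub>,
      add = (\<lambda>x y. \<Union>(m, s)\<in>x. \<Union>(n, t)\<in>y.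
               fraction R U M (t \<odot>\<^bsub>M\<^esub> m \<oplus>\<^bsub>M\<^esub> s \<odot>\<^bsub>M\<^esub> n) (s \<otimes>\<^bsub>R\<^esub> t)),
      module.smult = (\<lambda>x y. \<Union>(a, s)\<in>x. \<Union>(m, t)\<in>y. fraction R U M (a \<odot>\<^bsub>M\<^esub> m) (s \<otimes>\<^bsub>R\<^esub> t))\<rparr>"

definition free_of_rank ::
    "('a, 'r) ring_scheme \<Rightarrow> ('a, 'b, 'm) module_scheme \<Rightarrow> nat \<Rightarrow> bool" where
  "free_of_rank R M n \<longleftrightarrow>
     (\<exists>b \<in> {..<n} \<rightarrow> carrier M. \<forall>x \<in> carrier M.
        \<exists>!c. c \<in> ({..<n} \<rightarrow>\<^sub>E carrier R) \<and> x = (\<Oplus>\<^bsub>M\<^esub>i\<in>{..<n}. c i \<odot>\<^bsub>M\<^esub> b i))"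

definition has_constant_rank ::
    "('a, 'r) ring_scheme \<Rightarrow> ('a, 'b, 'm) module_scheme \<Rightarrow> nat \<Rightarrow> bool" where
  "has_constant_rank R M n \<longleftrightarrow>
     (\<forall>p. primeideal p R \<longrightarrow>
        free_of_rank (localization R (carrier R - p) (self_algebra R))
          (localization R (carrier R - p) M) n)"

subsection \<open>Polynomials in several variables and finite presentation\<close>

text \<open>The polynomial algebra over \<open>R\<close> in variables indexed by \<open>I\<close>. As in the library's theory of
  indexed polynomials, monomials are multisets of variables and a polynomial maps monomials to
  coefficients.\<close>

definition mpoly_algebra ::
    "('a, 'r) ring_scheme \<Rightarrow> 'i set \<Rightarrow> ('a, 'i multiset \<Rightarrow> 'a) module" where
  "mpoly_algebra R I =
     \<lparr>carrier = ring.indexed_pset R I (carrier R),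
      monoid.mult = (\<lambda>f g m. \<Oplus>\<^bsub>R\<^esub>k\<in>{k. k \<subseteq># m}. f k \<otimes>\<^bsub>R\<^esub> g (m - k)),
      one = ring.indexed_const R \<one>\<^bsub>R\<^esub>,
      ring.zero = ring.indexed_const R \<zero>\<^bsub>R\<^esub>,
      add = ring.indexed_padd R,
      module.smult = (\<lambda>a f m. a \<otimes>\<^bsub>R\<^esub> f m)\<rparr>"

text \<open>Evaluation in the \<open>R\<close>-algebra \<open>A\<close> of a polynomial at the family \<open>v\<close> of elements of \<open>A\<close>.\<close>

definition mpoly_eval ::
    "('a, 'r) ring_scheme \<Rightarrow> ('a, 'b, 'm) module_scheme \<Rightarrow> ('i \<Rightarrow> 'b) \<Rightarrow> ('i multiset \<Rightarrow> 'a) \<Rightarrow> 'b" where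
  "mpoly_eval R A v f =
     (\<Oplus>\<^bsub>A\<^esub>m\<in>{m. f m \<noteq> \<zero>\<^bsub>R\<^esub>}.
        f m \<odot>\<^bsub>A\<^esub> (\<Otimes>\<^bsub>A\<^esub>i\<in>set_mset m. v i [^]\<^bsub>A\<^esub> count m i))"

definition finitely_presented_algebra ::
    "('a, 'r) ring_scheme \<Rightarrow> ('a, 'b, 'm) module_scheme \<Rightarrow> bool" where
  "finitely_presented_algebra R A \<longleftrightarrow> algebra R A \<and>
     (\<exists>(n::nat) v F.
        v \<in> {..<n} \<rightarrow> carrier A \<and>
        mpoly_eval R A v ` carrier (mpoly_algebra R {..<n}) = carrier A \<and>
        finite F \<and> F \<subseteq> carrier (mpoly_algebra R {..<n}) \<and>
        a_kernel (mpoly_algebra R {..<n}) A (mpoly_eval R A v) = Idl\<^bsub>mpoly_algebra R {..<n}\<^esub> F)"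

subsection \<open>Etale and quadratic etale algebras\<close>

definition etale_algebra ::
    "'m itself \<Rightarrow> 'n itself \<Rightarrow> ('a, 'r) ring_scheme \<Rightarrow> ('a, 'b, 's) module_scheme \<Rightarrow> bool" where
  "etale_algebra tm tn R A \<longleftrightarrow>
     algebra R A \<and> flat_module tm tn R A \<and> separable_algebra R A \<and> finitely_presented_algebra R A"

definition quadratic_etale_algebra ::
    "'m itself \<Rightarrow> 'n itself \<Rightarrow> ('a, 'r) ring_scheme \<Rightarrow> ('a, 'b, 's) module_scheme \<Rightarrow> bool" where
  "quadratic_etale_algebra tm tn R A \<longleftrightarrow>
     etale_algebra tm tn R A \<and> projective_module tm tn R A \<and> has_constant_rank R A 2"


section \<open>The coordinate ring of the real sphere and its antipodal action\<close>

type_synonym real_mpoly = "nat multiset \<Rightarrow> real"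

abbreviation real_ring :: "real ring" where
  "real_ring \<equiv> ring_of_type_algebra"

abbreviation real_mpolys :: "nat \<Rightarrow> (real, real_mpoly) module" where
  "real_mpolys r \<equiv> mpoly_algebra real_ring {1..r}"

abbreviation mvar :: "nat \<Rightarrow> real_mpoly" where
  "mvar i \<equiv> ring.indexed_var real_ring i"

definition sphere_ideal :: "nat \<Rightarrow> real_mpoly set" where
  "sphere_ideal r =
     Idl\<^bsub>real_mpolys r\<^esub>
       {(\<Oplus>\<^bsub>real_mpolys r\<^esub>i\<in>{1..r}. mvar i [^]\<^bsub>real_mpolys r\<^esub> (2::nat))
          \<ominus>\<^bsub>real_mpolys r\<^esub> \<one>\<^bsub>real_mpolys r\<^esub>}"

definition sphere_ring :: "nat \<Rightarrow> real_mpoly set ring" where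
  "sphere_ring r = real_mpolys r Quot sphere_ideal r"

text \<open>The substitution \<open>z\<^sub>i \<mapsto> - z\<^sub>i\<close> preserves the ideal and permutes its cosets, so it acts on the
  quotient by taking images of cosets.\<close>

definition negate_vars :: "nat \<Rightarrow> real_mpoly \<Rightarrow> real_mpoly" where
  "negate_vars r = mpoly_eval real_ring (real_mpolys r) (\<lambda>i. \<ominus>\<^bsub>real_mpolys r\<^esub> mvar i)"

definition antipodal_action :: "nat \<Rightarrow> int \<Rightarrow> real_mpoly set \<Rightarrow> real_mpoly set" where
  "antipodal_action r g =
     (\<lambda>x \<in> carrier (sphere_ring r). if g = 0 then x else negate_vars r ` x)"

definition sphere_fixed_ring :: "nat \<Rightarrow> real_mpoly set ring" where
  "sphere_fixed_ring r = (sphere_ring r)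
     \<lparr>carrier := (\<Inter>g\<in>carrier (integer_mod_group 2).
                    invariants (carrier (sphere_ring r)) (antipodal_action r) g)\<rparr>"

end

theory Submission
  imports Defs "HOL-Analysis.Finite_Function_Topology" "Jordan_Normal_Form.Char_Poly"
begin

text \<open>Let \<open>z\<^sub>1, \<dots>, z\<^sub>r\<close> be the coordinate functions and let \<open>tr\<close> be the projection of \<open>S\<close> onto its even
  part \<open>R\<close>. With \<open>e = (z\<^sub>1, \<dots>, z\<^sub>r, 1)\<close> one has \<open>x = \<Sum>\<^sub>i tr (e\<^sub>i x) e\<^sub>i\<close> for all \<open>x\<close>, because
  \<open>\<Sum> z\<^sub>i\<^sup>2 = 1\<close>. This identity makes \<open>S\<close> projective and flat over \<open>R\<close>, gives the separability idempotent
  \<open>1/2 \<Sum> e\<^sub>i \<otimes> e\<^sub>i\<close> and a finite presentation of \<open>S\<close>. At a prime of \<open>R\<close> some \<open>z\<^sub>i\<^sup>2\<close> is a unit, and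
  then \<open>1, z\<^sub>i\<close> is a basis.

  If fewer than \<open>r\<close> elements generated \<open>S\<close>, so would their odd parts, which by the Borsuk--Ulam
  theorem vanish together at some real point \<open>x\<close> of the sphere. Then every element of \<open>S\<close> would take
  the same value at \<open>x\<close> and \<open>-x\<close>, which fails for a coordinate.

  The Borsuk--Ulam theorem for odd polynomials \<open>f\<^sub>1, \<dots>, f\<^sub>r\<^sub>-\<^sub>1\<close> has an algebraic proof. For odd \<open>d\<close>
  exceeding all degrees and \<open>n \<ge> 1\<close> consider the system \<open>x\<^sub>j\<^sup>d + n f\<^sub>j = 0\<close>, \<open>\<Sum> x\<^sub>i\<^sup>2 = 1\<close>. The even part
  of its quotient ring has the odd dimension \<open>d\<^sup>r\<^sup>-\<^sup>1\<close>, so the multiplications by the products \<open>x\<^sub>i x\<^sub>j\<close>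
  have a common real eigenvector. The eigenvalues are the products of the coordinates of a real
  solution of the system. A limit of solutions for \<open>n \<longrightarrow> \<infinity>\<close> is a common zero of the \<open>f\<^sub>j\<close>.\<close>

section \<open>Commuting operators on a space of odd dimension\<close>

text \<open>The passage to the even part is forced: the perturbed system is stable under
  \<open>x \<mapsto> -x\<close>, so its full quotient ring has the even dimension
  \<open>2 * d^(r-1)\<close>, and parity alone gives no real eigenvector there. The products
  \<open>x_i x_j\<close> generate the even part. Their eigenvalues form a matrix of rank one and
  trace 1, hence with a positive diagonal entry, and its real square root yields \<open>x\<close> up
  to sign. The powers \<open>x_j^d\<close> are added because nothing is known about the common zeros
  of the \<open>f_j\<close>; with them the leading monomials are pairwise coprime and the dimension
  is read off from exponents, whatever the \<open>f_j\<close> are. The weight \<open>n\<close> makes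
  the perturbation disappear in the limit, since \<open>x_j^d\<close> stays bounded on the sphere.
  The contradiction at the end works with values only: the classes that take equal values at
  \<open>x\<close> and \<open>-x\<close> form a subalgebra containing \<open>R\<close>, and a
  generator whose odd part vanishes at \<open>x\<close> belongs to it.\<close>

lemma odd_degree_real_root:
  fixes p :: "real poly"
  assumes "odd (degree p)"
  obtains x where "poly p x = 0"
proof -
  have pos: "\<exists>x. poly p x = 0" if p: "odd (degree p)" "lead_coeff p > 0" for p :: "real poly"
  proof -
    obtain a where a: "poly p a \<ge> lead_coeff p"
      using poly_pinfty_gt_lc[OF p(2)] by blast
    \<comment> \<open>\<open>?q\<close> is \<open>x \<mapsto> - p (- x)\<close>. For odd degree the
      two signs cancel in the leading coefficient, so a positive value of \<open>?q\<close> is a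
      negative value of \<open>p\<close>.\<close>
    let ?q = "- (p \<circ>\<^sub>p [:0, -1:])"
    have "lead_coeff ?q = lead_coeff p"
      using p(1) lead_coeff_comp[of "[:0, -1:]" p] by simp
    then obtain b where b: "poly ?q b \<ge> lead_coeff p"
      using poly_pinfty_gt_lc[of ?q] p(2) by (metis order_refl)
    have "poly p (- b) < 0" "poly p a > 0"
      using a b p(2) by (simp_all add: poly_pcompose)
    then have "- b \<noteq> a" by auto
    with \<open>poly p (- b) < 0\<close> \<open>poly p a > 0\<close> show ?thesis
      by (metis poly_IVT_pos poly_IVT_neg linorder_neqE_linordered_idom)
  qed
  show ?thesis
  proof (cases "lead_coeff p > 0")
    case True
    then show ?thesis using pos[of p] assms that by blast
  next
    case False
    moreover have "lead_coeff p \<noteq> 0" using assms leading_coeff_0_iff[of p] by fastforce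
    ultimately have "lead_coeff p < 0" by linarith
    then show ?thesis using pos[of "- p"] assms that by auto
  qed
qed

text \<open>The characteristic polynomial of the matrix of \<open>T\<close> on \<open>span B\<close>
  is real of odd degree, hence has a root. Finiteness concerns \<open>span B\<close> only: the
  ambient space will be the space of all polynomials.\<close>

lemma odd_dim_eigenvector:
  fixes T :: "'a::real_vector \<Rightarrow> 'a"
  assumes T: "linear T" and B: "independent B" "finite B" "odd (card B)" and TB: "T ` B \<subseteq> span B"
  obtains c v where "v \<in> span B" "v \<noteq> 0" "T v = c *\<^sub>R v"
proof -
  define n where "n = card B"
  obtain b where b: "bij_betw b {0..<n} B"
    using ex_bij_betw_nat_finite[OF B(2)] n_def by blast
  define A where "A = mat n n (\<lambda>(i, j). representation B (T (b j)) (b i))"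
  have A: "A \<in> carrier_mat n n" by (simp add: A_def)
  have "degree (char_poly A) = n" using degree_monic_char_poly[OF A] by simp
  then obtain c where "poly (char_poly A) c = 0"
    using odd_degree_real_root B(3) n_def by metis
  then have "eigenvalue A c" using eigenvalue_root_char_poly[OF A] by simp
  then obtain w where w: "w \<in> carrier_vec n" "w \<noteq> 0\<^sub>v n" "A *\<^sub>v w = c \<cdot>\<^sub>v w"
    using A unfolding eigenvalue_def eigenvector_def by auto
  define v where "v = (\<Sum>j<n. w $ j *\<^sub>R b j)"
  have bB: "b j \<in> B" if "j < n" for j using b that by (auto simp: bij_betw_def)
  have sumB: "(\<Sum>i<n. f (b i)) = sum f B" for f :: "'a \<Rightarrow> 'a"
    using sum.reindex_bij_betw[OF b, of f] by (simp add: lessThan_atLeast0)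
  have Tb: "T (b j) = (\<Sum>i<n. A $$ (i, j) *\<^sub>R b i)" if "j < n" for j
  proof -
    have "T (b j) = (\<Sum>i<n. representation B (T (b j)) (b i) *\<^sub>R b i)"
      unfolding sumB[of "\<lambda>x. representation B (T (b j)) x *\<^sub>R x"]
      using real_vector.sum_representation_eq[OF B(1) _ B(2) order_refl] TB bB[OF that] by fastforce
    then show ?thesis using that by (simp add: A_def)
  qed
  have Aw: "(\<Sum>j<n. A $$ (i, j) * w $ j) = c * w $ i" if "i < n" for i
  proof -
    have "(A *\<^sub>v w) $ i = (\<Sum>j<n. A $$ (i, j) * w $ j)"
      using A w(1) that by (simp add: scalar_prod_def lessThan_atLeast0 row_def)
    then show ?thesis using w(1,3) that by simp
  qed
  show thesis
  proof
    show "v \<in> span B"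
      unfolding v_def using bB by (intro span_sum span_scale span_base) auto
    show "v \<noteq> 0"
    proof
      assume "v = 0"
      \<comment> \<open>The eigenvector is indexed by numbers, independence by the elements of
        \<open>B\<close>; \<open>?u\<close> transports the entries of \<open>w\<close> along
        \<open>b\<close>.\<close>
      let ?u = "\<lambda>x. w $ (the_inv_into {0..<n} b x)"
      have u: "?u (b j) = w $ j" if "j < n" for j
        using b that by (simp add: bij_betw_def the_inv_into_f_f)
      have "(\<Sum>x\<in>B. ?u x *\<^sub>R x) = v"
        unfolding v_def sumB[symmetric] using u by simp
      then have "?u x = 0" if "x \<in> B" for x
        using \<open>v = 0\<close> real_vector.independentD[OF B(1) B(2) order_refl _ that, of ?u] by simp
      then have "w $ j = 0" if "j < n" for j using u that bB by metis
      then show False using w(1,2) by (metis eq_vecI carrier_vecD index_zero_vec)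
    qed
    have "T v = (\<Sum>j<n. w $ j *\<^sub>R T (b j))"
      unfolding v_def by (simp add: linear_sum[OF T] linear_cmul[OF T])
    also have "\<dots> = (\<Sum>j<n. \<Sum>i<n. (A $$ (i, j) * w $ j) *\<^sub>R b i)"
      by (rule sum.cong) (auto simp: Tb scaleR_sum_right mult.commute)
    also have "\<dots> = (\<Sum>i<n. (\<Sum>j<n. A $$ (i, j) * w $ j) *\<^sub>R b i)"
      by (subst sum.swap) (simp add: scaleR_sum_left)
    also have "\<dots> = c *\<^sub>R v"
      unfolding v_def by (simp add: scaleR_sum_right Aw)
    finally show "T v = c *\<^sub>R v" .
  qed
qed

text \<open>A basis of the kernel in \<open>V\<close> is extended to a basis of \<open>V\<close>,
  and the added vectors map to a basis of the image. The set \<open>F\<close> bounds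
  \<open>V\<close>, as the ambient type may be infinite-dimensional.\<close>

lemma rank_nullity:
  fixes S :: "'a::real_vector \<Rightarrow> 'a"
  assumes S: "linear S" and V: "subspace V" and F: "finite F" "V \<subseteq> span F"
  shows "dim V = dim {x\<in>V. S x = 0} + dim (S ` V)"
proof -
  define K where "K = {x\<in>V. S x = 0}"
  have K: "subspace K"
    unfolding K_def using V by (auto simp: subspace_def linear_add[OF S] linear_cmul[OF S] linear_0[OF S])
  obtain BK where BK: "BK \<subseteq> K" "independent BK" "K \<subseteq> span BK" "card BK = dim K"
    using basis_exists by blast
  have "BK \<subseteq> V" using BK(1) K_def by auto
  then obtain B where B: "BK \<subseteq> B" "B \<subseteq> V" "independent B" "V \<subseteq> span B"
    using maximal_independent_subset_extend[OF _ BK(2)] by blast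
  have finB: "finite B" using independent_span_bound[OF F(1) B(3)] B(2) F(2) by auto
  define C where "C = B - BK"
  have finC: "finite C" using finB C_def by simp
  have BC: "B = BK \<union> C" using B(1) C_def by auto
  have C: "C \<subseteq> V" "independent C"
    using B(2) independent_mono[OF B(3), of C] C_def by auto
  \<comment> \<open>Such an \<open>x\<close> lies in the spans of the two disjoint parts
    \<open>BK\<close> and \<open>C\<close> of one independent set, so all its coordinates
    vanish.\<close>
  have zero: "x = 0" if x: "x \<in> span C" "S x = 0" for x
  proof -
    have "x \<in> V" using x(1) C(1) span_minimal[OF C(1) V] by auto
    then have "x \<in> span BK" using x(2) BK(3) K_def by auto
    moreover have "BK \<inter> C = {}" using C_def by auto
    ultimately have "representation B x b = 0" for b
      using x(1) B(3) BC
      by (metis (no_types, lifting) disjoint_iff real_vector.representation_extend real_vector.representation_ne_zero inf_sup_ord(3) inf_sup_ord(4))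
    then show "x = 0"
      using real_vector.sum_representation_eq[OF B(3) _ finB order_refl, of x] \<open>x \<in> V\<close> B(4) by auto
  qed
  have inj: "inj_on S (span C)"
    using linear_injective_on_subspace_0[OF S subspace_span] zero by blast
  have "independent (S ` C)"
    using linear_independent_injective_image[OF S C(2) inj] .
  moreover have "S ` V \<subseteq> span (S ` C)"
  proof -
    have "S ` V \<subseteq> span (S ` B)"
      using linear_span_image[OF S, of B] B(4) by blast
    also have "\<dots> \<subseteq> span (S ` C)"
    proof (rule span_minimal[OF _ subspace_span])
      show "S ` B \<subseteq> span (S ` C)"
        unfolding BC using BK(1) K_def by (auto intro: span_base simp: span_zero)
    qed
    finally show ?thesis .
  qed
  moreover have "S ` C \<subseteq> S ` V" using C(1) by blast
  ultimately have "dim (S ` V) = card (S ` C)"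
    by (metis basis_card_eq_dim)
  also have "\<dots> = card C"
    using inj span_superset by (intro card_image) (blast intro: inj_on_subset)
  finally have "dim (S ` V) = card C" .
  moreover have "dim V = card B" using B basis_card_eq_dim by metis
  moreover have "card B = card BK + card C"
    unfolding C_def using finB B(1) by (simp add: card_Diff_subset finite_subset card_mono)
  ultimately show ?thesis using BK(4) K_def by simp
qed

text \<open>Strong induction on the dimension of \<open>V\<close>, with oddness as the invariant.
  Commutation is assumed on \<open>V\<close> only: the operators used below are multiplications
  followed by a projection, and their commutation is established only for normal forms.\<close>

lemma commuting_odd_dim_eigenvector:
  fixes T :: "'i \<Rightarrow> 'a::real_vector \<Rightarrow> 'a"
  assumes lin: "\<And>i. i \<in> I \<Longrightarrow> linear (T i)" and F: "finite F"
    and "subspace V" "V \<subseteq> span F" "odd (dim V)"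
    and "\<And>i. i \<in> I \<Longrightarrow> T i ` V \<subseteq> V"
    and "\<And>i j v. i \<in> I \<Longrightarrow> j \<in> I \<Longrightarrow> v \<in> V \<Longrightarrow> T i (T j v) = T j (T i v)"
  obtains v where "v \<in> V" "v \<noteq> 0" "\<forall>i\<in>I. \<exists>c. T i v = c *\<^sub>R v"
proof -
  have "\<exists>v\<in>V. v \<noteq> 0 \<and> (\<forall>i\<in>I. \<exists>c. T i v = c *\<^sub>R v)" using assms(3-)
  proof (induction "dim V" arbitrary: V rule: less_induct)
    case less
    note V = less.prems(1,2) and stable = less.prems(4) and comm = less.prems(5)
    have stab: "T i x \<in> V" if "i \<in> I" "x \<in> V" for i x using stable that by blast
    obtain B where B: "B \<subseteq> V" "independent B" "V \<subseteq> span B" "card B = dim V"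
      using basis_exists by blast
    have VB: "span B = V" using B V(1) by (simp add: span_minimal subset_antisym)
    have finB: "finite B" using independent_span_bound[OF F B(2)] B(1) V(2) by auto
    \<comment> \<open>\<open>dim\<close> is the cardinality of a basis, so it is 0 also for a space
      with an infinite basis; the bound by \<open>F\<close> rules this out.\<close>
    have zero_dim: "U \<subseteq> {0}" if "subspace U" "U \<subseteq> V" "dim U = 0" for U
    proof -
      obtain C where C: "C \<subseteq> U" "independent C" "U \<subseteq> span C" "card C = dim U"
        using basis_exists by blast
      have "finite C" using independent_span_bound[OF F C(2)] C(1) that(2) V(2) by auto
      then show ?thesis using C that(3) by simp
    qed
    show ?case
    proof (cases "\<forall>i\<in>I. \<exists>c. \<forall>v\<in>V. T i v = c *\<^sub>R v")
      case True
      \<comment> \<open>Every operator is a scalar on \<open>V\<close>, so any basis vector will do;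
        the dimension is odd, hence not 0.\<close>
      have "B \<noteq> {}" using B(4) less.prems(3) by auto
      then obtain v where "v \<in> B" by blast
      moreover have "v \<noteq> 0" using \<open>v \<in> B\<close> B(2) dependent_zero by blast
      ultimately show ?thesis using True B(1) by (meson subset_iff)
    next
      case False
      then obtain k where k: "k \<in> I" "\<And>c. \<exists>v\<in>V. T k v \<noteq> c *\<^sub>R v" by blast
      have "T k ` B \<subseteq> span B" using stable[OF k(1)] B(1) VB by blast
      then obtain c u where u: "u \<in> V" "u \<noteq> 0" "T k u = c *\<^sub>R u"
        using odd_dim_eigenvector[OF lin[OF k(1)] B(2) finB] B(4) less.prems(3) VB by metis
      \<comment> \<open>The dimensions of the kernel and of the image of \<open>S\<close> add up to an odd number, so one of them is odd;
        both subspaces are proper and invariant under the family.\<close>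
      define S where "S = (\<lambda>x. T k x - c *\<^sub>R x)"
      have S: "linear S"
        unfolding S_def
        by (rule linearI) (simp_all add: linear_add[OF lin[OF k(1)]] linear_cmul[OF lin[OF k(1)]] algebra_simps)
      have SV: "S x \<in> V" if "x \<in> V" for x
        unfolding S_def using stab[OF k(1) that] that V(1) by (simp add: subspace_diff subspace_scale)
      have comS: "S (T i x) = T i (S x)" if "i \<in> I" "x \<in> V" for i x
        unfolding S_def
        by (simp add: comm[OF k(1) that] linear_diff[OF lin[OF that(1)]] linear_cmul[OF lin[OF that(1)]])
      let ?K = "{x\<in>V. S x = 0}" and ?M = "S ` V"
      have K: "subspace ?K"
        using V(1) by (auto simp: subspace_def linear_add[OF S] linear_cmul[OF S] linear_0[OF S])
      have M: "subspace ?M" using linear_subspace_image[OF S V(1)] .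
      have MV: "?M \<subseteq> V" using SV by blast
      have rn: "dim V = dim ?K + dim ?M" by (rule rank_nullity[OF S V(1) F V(2)])
      have "dim ?K \<noteq> 0"
      proof
        assume "dim ?K = 0"
        then have "?K \<subseteq> {0}" using zero_dim[OF K] by blast
        moreover have "u \<in> ?K" using u by (simp add: S_def)
        ultimately show False using u(2) by blast
      qed
      moreover have "dim ?M \<noteq> 0"
      proof
        assume "dim ?M = 0"
        then have "?M \<subseteq> {0}" using zero_dim[OF M MV] by blast
        then have "\<forall>x\<in>V. T k x = c *\<^sub>R x" unfolding S_def by auto
        then show False using k(2)[of c] by blast
      qed
      moreover have "odd (dim ?K) \<or> odd (dim ?M)" using rn less.prems(3) by auto
      ultimately consider "odd (dim ?K)" "dim ?K < dim V" | "odd (dim ?M)" "dim ?M < dim V"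
        using rn by linarith
      then show ?thesis
      proof cases
        case 1
        have "\<exists>v\<in>?K. v \<noteq> 0 \<and> (\<forall>i\<in>I. \<exists>c. T i v = c *\<^sub>R v)"
        proof (rule less.hyps[OF 1(2) K _ 1(1)])
          show "?K \<subseteq> span F" using V(2) by blast
          show "T i ` ?K \<subseteq> ?K" if "i \<in> I" for i
            using stab[OF that] comS[OF that] linear_0[OF lin[OF that]] by auto
        qed (use comm in blast)
        then show ?thesis by blast
      next
        case 2
        have "\<exists>v\<in>?M. v \<noteq> 0 \<and> (\<forall>i\<in>I. \<exists>c. T i v = c *\<^sub>R v)"
        proof (rule less.hyps[OF 2(2) M _ 2(1)])
          show "?M \<subseteq> span F" using MV V(2) by blast
          show "T i ` ?M \<subseteq> ?M" if "i \<in> I" for i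
          proof
            fix y assume "y \<in> T i ` ?M"
            then obtain x where x: "x \<in> V" "y = T i (S x)" by blast
            then show "y \<in> ?M" using stab[OF that x(1)] comS[OF that x(1)] by (intro image_eqI[of _ _ "T i x"]) simp_all
          qed
        qed (use comm MV in blast)
        then show ?thesis using MV by blast
      qed
    qed
  qed
  then show thesis using that by blast
qed

section \<open>Real polynomials\<close>

text \<open>The same polynomials as \<open>real_mpoly\<close>, but as a type of finitely supported
  functions, which carries the ring and vector space structure for the linear algebra below. The
  last section passes between the two representations through the coefficient function.\<close>

type_synonym mpol = "nat multiset \<Rightarrow>\<^sub>0 real"

abbreviation mon :: "nat multiset \<Rightarrow> mpol" where
  "mon m \<equiv> Poly_Mapping.single m 1"

section \<open>The monomials as a basis of the polynomials\<close>

lemma lookup_scaleR: "Poly_Mapping.lookup (c *\<^sub>R p) m = c * Poly_Mapping.lookup p m" for p :: "'a \<Rightarrow>\<^sub>0 real"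
proof -
  have "finite {i. c * Poly_Mapping.lookup p i \<noteq> 0}"
    by (rule finite_subset[OF _ finite_lookup[of p]]) auto
  then show ?thesis by (simp add: scaleR_poly_mapping_def)
qed

lemma scaleR_eq_mult: "c *\<^sub>R p = Poly_Mapping.single 0 c * p" for p :: mpol
  by (rule poly_mapping_eqI)
    (simp add: lookup_scaleR mult_map_scale_conv_mult[symmetric] Poly_Mapping.map.rep_eq when_def)

lemma mult_scaleR: "p * (c *\<^sub>R q) = c *\<^sub>R (p * q)" "(c *\<^sub>R p) * q = c *\<^sub>R (p * q)" for p q :: mpol
  by (simp_all add: scaleR_eq_mult algebra_simps)

lemma linear_mult: "linear (\<lambda>q. p * q)" for p :: mpol
  by (rule linearI) (simp_all add: mult_scaleR algebra_simps)

lemma mon_add: "mon (m + n) = mon m * mon n"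
  by (simp add: mult_single)

lemma mpol_expand: "p = (\<Sum>m\<in>Poly_Mapping.keys p. Poly_Mapping.lookup p m *\<^sub>R mon m)" for p :: mpol
  by (rule poly_mapping_eqI)
    (simp add: lookup_sum lookup_scaleR lookup_single when_def in_keys_iff sum.delta if_distrib cong: if_cong)

lemma mpol_in_span: "Poly_Mapping.keys p \<subseteq> M \<Longrightarrow> p \<in> span (mon ` M)" for p :: mpol
  by (subst mpol_expand[of p]) (intro span_sum span_scale span_base, auto)

lemma span_mon_keys: "p \<in> span (mon ` M) \<Longrightarrow> Poly_Mapping.keys p \<subseteq> M" for p :: mpol
proof (induction rule: span_induct_alt)
  case (step c x y)
  then show ?case
    by (auto simp: in_keys_iff lookup_add lookup_scaleR lookup_single when_def split: if_splits)
qed simp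

lemma inj_mon: "inj mon"
  by (rule injI) (metis keys_single singleton_inject zero_neq_one)

lemma independent_mon: "independent (mon ` M)"
  unfolding dependent_def
proof
  assume "\<exists>a\<in>mon ` M. a \<in> span (mon ` M - {a})"
  then obtain m where m: "m \<in> M" "mon m \<in> span (mon ` M - {mon m})" by blast
  moreover have "mon ` M - {mon m} \<subseteq> mon ` (M - {m})" by auto
  ultimately have "mon m \<in> span (mon ` (M - {m}))" using span_mono by blast
  from span_mon_keys[OF this] show False by simp
qed

section \<open>Evaluation at real points\<close>

definition peval :: "(nat \<Rightarrow> real) \<Rightarrow> mpol \<Rightarrow> real" where
  "peval x p = (\<Sum>m\<in>Poly_Mapping.keys p. Poly_Mapping.lookup p m * prod_mset (image_mset x m))"

lemma peval_superset:
  assumes "finite M" "Poly_Mapping.keys p \<subseteq> M"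
  shows "peval x p = (\<Sum>m\<in>M. Poly_Mapping.lookup p m * prod_mset (image_mset x m))"
  unfolding peval_def using assms by (intro sum.mono_neutral_left) (auto simp: in_keys_iff)

lemma peval_add: "peval x (p + q) = peval x p + peval x q"
  using peval_superset[of "Poly_Mapping.keys p \<union> Poly_Mapping.keys q"] keys_add[of p q]
  by (simp add: lookup_add sum.distrib distrib_right)

lemma peval_scaleR: "peval x (c *\<^sub>R p) = c * peval x p"
proof -
  have "Poly_Mapping.keys (c *\<^sub>R p) \<subseteq> Poly_Mapping.keys p" by (auto simp: in_keys_iff lookup_scaleR)
  then show ?thesis
    using peval_superset[of "Poly_Mapping.keys p" "c *\<^sub>R p" x]
    by (simp add: lookup_scaleR peval_def sum_distrib_left mult.assoc)
qed

lemma linear_peval: "linear (peval x)"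
  by (rule linearI) (simp_all add: peval_add peval_scaleR)

lemma peval_mon: "peval x (mon m) = prod_mset (image_mset x m)"
  by (simp add: peval_def)

text \<open>Serves to recover the value of an odd equation from its products with the coordinates,
  which are even.\<close>

lemma peval_mult_mon: "peval x (p * mon n) = peval x p * prod_mset (image_mset x n)"
proof -
  have "p * mon n = (\<Sum>m\<in>Poly_Mapping.keys p. Poly_Mapping.lookup p m *\<^sub>R mon (m + n))"
    by (subst mpol_expand[of p]) (simp add: sum_distrib_right mult_scaleR mon_add)
  then have "peval x (p * mon n)
      = (\<Sum>m\<in>Poly_Mapping.keys p. Poly_Mapping.lookup p m * prod_mset (image_mset x (m + n)))"
    by (simp only: linear_sum[OF linear_peval] peval_scaleR peval_mon)
  then show ?thesis
    by (simp add: peval_def[of x p] sum_distrib_right mult.assoc)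
qed

lemma tendsto_peval:
  assumes "\<And>m i. m \<in> Poly_Mapping.keys p \<Longrightarrow> i \<in># m \<Longrightarrow> (\<lambda>n. x n i) \<longlonglongrightarrow> y i"
  shows "(\<lambda>n. peval (x n) p) \<longlonglongrightarrow> peval y p"
proof -
  have "(\<lambda>n. prod_mset (image_mset (x n) m)) \<longlonglongrightarrow> prod_mset (image_mset y m)"
    if "\<And>i. i \<in># m \<Longrightarrow> (\<lambda>n. x n i) \<longlonglongrightarrow> y i" for m
    using that by (induction m) (auto intro!: tendsto_mult)
  then show ?thesis
    unfolding peval_def using assms by (intro tendsto_sum tendsto_mult tendsto_const) blast
qed

section \<open>A Borsuk--Ulam theorem for odd polynomials\<close>

text \<open>The system \<open>x\<^sub>j\<^sup>e + h\<^sub>j(x) = 0\<close> for \<open>1 \<le> j < r\<close>, \<open>\<Sum> x\<^sub>i\<^sup>2 = 1\<close>, with \<open>h\<^sub>j\<close> odd of degree less than \<open>e\<close>.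
  The leading monomials \<open>x\<^sub>j\<^sup>e\<close> and \<open>x\<^sub>r\<^sup>2\<close> are pairwise coprime, so the monomials not divisible by them
  form a basis of the quotient ring.\<close>

locale odd_system =
  fixes r e :: nat and h :: "nat \<Rightarrow> mpol"
  assumes r: "r \<ge> 1" and e: "odd e"
    and h: "\<And>j m. j \<in> {1..<r} \<Longrightarrow> m \<in> Poly_Mapping.keys (h j) \<Longrightarrow> set_mset m \<subseteq> {1..r} \<and> odd (size m) \<and> size m < e"
begin

section \<open>Leading powers and the basis adapted to them\<close>

definition Mon :: "nat multiset set" where "Mon = {b. set_mset b \<subseteq> {1..r}}"

text \<open>The exponent of the pure power that leads the \<open>i\<close>-th equation
  \<open>g i\<close>, whose remaining terms are \<open>H i\<close>. Index \<open>r\<close> belongs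
  to the sphere equation, read as \<open>x_r^2\<close> plus the other squares minus 1.\<close>

definition E :: "nat \<Rightarrow> nat" where "E i = (if i = r then 2 else e)"

definition H :: "nat \<Rightarrow> mpol" where
  "H i = (if i = r then (\<Sum>k\<in>{1..<r}. mon {#k, k#}) - 1 else h i)"

definition g :: "nat \<Rightarrow> mpol" where "g i = mon (replicate_mset (E i) i) + H i"

definition rem :: "nat multiset \<Rightarrow> nat multiset" where
  "rem b = (\<Sum>i\<in>{1..r}. replicate_mset (count b i mod E i) i)"

text \<open>The monomial \<open>b\<close> with each full block \<open>x_i^(E i)\<close> replaced by
  \<open>g i\<close>, as in an expansion to base \<open>g\<close>. This basis is adapted to the
  ideal of the system: reduced indices give plain monomials, all others give multiples of some
  \<open>g i\<close>.\<close>

definition Phi :: "nat multiset \<Rightarrow> mpol" where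
  "Phi b = (\<Prod>i\<in>{1..r}. g i ^ (count b i div E i)) * mon (rem b)"

definition reduced :: "nat multiset \<Rightarrow> bool" where "reduced b \<longleftrightarrow> (\<forall>i. count b i < E i)"

text \<open>Parity is recorded besides the degree because the change between monomials and
  \<open>Phi\<close> has to respect the splitting into even and odd polynomials.\<close>

definition Low :: "nat multiset \<Rightarrow> nat multiset set" where
  "Low b = {b' \<in> Mon. size b' \<le> size b \<and> (even (size b') \<longleftrightarrow> even (size b))}"

text \<open>The degree alone does not decrease when \<open>x_r^2\<close> is rewritten by the sphere
  equation, whose other squares have the same degree. Those terms are free of \<open>x_r\<close>, so
  the exponent of \<open>x_r\<close> breaks the tie.\<close>

definition lexrel :: "(nat multiset \<times> nat multiset) set" where
  "lexrel = inv_image (less_than <*lex*> less_than) (\<lambda>b. (size b, count b r))"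

lemma E_pos: "E i > 0" using e by (auto simp: E_def odd_pos)

lemma count_rem: "count (rem b) i = (if i \<in> {1..r} then count b i mod E i else 0)"
proof -
  have "count (rem b) i = (\<Sum>k\<in>{1..r}. if k = i then count b k mod E k else 0)"
    unfolding rem_def by (simp add: count_sum)
  then show ?thesis by simp
qed

lemma Phi_reduced: assumes "b \<in> Mon" "reduced b" shows "Phi b = mon b"
proof -
  have "rem b = b"
    using assms by (intro multiset_eqI) (auto simp: count_rem reduced_def Mon_def not_in_iff[symmetric])
  moreover have "count b i div E i = 0" for i using assms(2) by (simp add: reduced_def)
  ultimately show ?thesis by (simp add: Phi_def)
qed

text \<open>Adding \<open>E i\<close> to an exponent raises its quotient by one and leaves its
  residue unchanged.\<close>

lemma Phi_step: assumes "i \<in> {1..r}" shows "Phi (b + replicate_mset (E i) i) = g i * Phi b"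
proof -
  have "rem (b + replicate_mset (E i) i) = rem b"
    by (rule multiset_eqI) (simp add: count_rem)
  moreover have "(\<Prod>k\<in>{1..r}. g k ^ (count (b + replicate_mset (E i) i) k div E k))
      = (\<Prod>k\<in>{1..r}. (if k = i then g i else 1) * g k ^ (count b k div E k))"
    using E_pos[of i] by (intro prod.cong) auto
  ultimately show ?thesis
    using assms unfolding Phi_def by (simp add: prod.distrib mult.assoc)
qed

lemma not_reduced_split:
  assumes "b \<in> Mon" "\<not> reduced b"
  obtains i b' where "i \<in> {1..r}" "b' \<in> Mon" "b = b' + replicate_mset (E i) i"
proof -
  obtain i where i: "E i \<le> count b i" using assms(2) by (auto simp: reduced_def not_less)
  then have "replicate_mset (E i) i \<subseteq># b" by (simp add: count_le_replicate_mset_subset_eq)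
  then have "b = (b - replicate_mset (E i) i) + replicate_mset (E i) i" by simp
  moreover have "0 < count b i" using i E_pos[of i] by linarith
  then have "i \<in># b" by (simp only: count_greater_zero_iff)
  then have "i \<in> {1..r}" using assms(1) by (auto simp: Mon_def)
  moreover have "b - replicate_mset (E i) i \<in> Mon"
    using assms(1) by (auto simp: Mon_def dest: in_diffD)
  ultimately show thesis using that by blast
qed

text \<open>The last alternative isolates the squares in the sphere equation, the only lower terms
  that reach the degree of the leading power; it is what makes \<open>lexrel\<close>
  decrease.\<close>

lemma keys_H:
  assumes "i \<in> {1..r}" "m \<in> Poly_Mapping.keys (H i)"
  shows "m \<in> Mon" "even (size m) \<longleftrightarrow> even (E i)" "size m \<le> E i" "size m < E i \<or> r \<notin># m \<and> i = r"
proof -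
  have "m \<in> Mon \<and> (even (size m) \<longleftrightarrow> even (E i)) \<and> size m \<le> E i \<and> (size m < E i \<or> r \<notin># m \<and> i = r)"
  proof (cases "i = r")
    case True
    then have "m \<in> Poly_Mapping.keys (\<Sum>k\<in>{1..<r}. mon {#k, k#}) \<union> Poly_Mapping.keys (1 :: mpol)"
      using assms(2) keys_diff[of "\<Sum>k\<in>{1..<r}. mon {#k, k#}" 1] by (auto simp: H_def)
    then consider "m = {#}" | k where "k \<in> {1..<r}" "m = {#k, k#}"
      using keys_sum[of "\<lambda>k. mon {#k, k#}" "{1..<r}"] by auto
    then show ?thesis using True by cases (auto simp: Mon_def E_def)
  next
    case False
    then have "i \<in> {1..<r}" using assms(1) by auto
    then show ?thesis using h[of i m] assms(2) False e by (auto simp: H_def E_def Mon_def)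
  qed
  then show "m \<in> Mon" "even (size m) \<longleftrightarrow> even (E i)" "size m \<le> E i" "size m < E i \<or> r \<notin># m \<and> i = r"
    by auto
qed

lemma keys_g:
  assumes "i \<in> {1..r}" "m \<in> Poly_Mapping.keys (g i)"
  shows "m \<in> Mon" "even (size m) \<longleftrightarrow> even (E i)" "size m \<le> E i"
proof -
  have "m = replicate_mset (E i) i \<or> m \<in> Poly_Mapping.keys (H i)"
    using assms(2) keys_add[of "mon (replicate_mset (E i) i)" "H i"] by (auto simp: g_def)
  then show "m \<in> Mon" "even (size m) \<longleftrightarrow> even (E i)" "size m \<le> E i"
    using keys_H[OF assms(1), of m] assms(1) by (auto simp: Mon_def split: if_splits)
qed

text \<open>One factor \<open>g i\<close> is split off at a time: it raises the degree by at most
  \<open>E i\<close> and shifts the parity by that of \<open>E i\<close>.\<close>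

lemma keys_Phi: "b \<in> Mon \<Longrightarrow> Poly_Mapping.keys (Phi b) \<subseteq> Low b"
proof (induction "size b" arbitrary: b rule: less_induct)
  case less
  show ?case
  proof (cases "reduced b")
    case True
    then show ?thesis using Phi_reduced less.prems by (auto simp: Low_def)
  next
    case False
    then obtain i b' where b': "i \<in> {1..r}" "b' \<in> Mon" "b = b' + replicate_mset (E i) i"
      using not_reduced_split less.prems by blast
    have IH: "Poly_Mapping.keys (Phi b') \<subseteq> Low b'"
      using less.hyps[OF _ b'(2)] b'(3) E_pos[of i] by simp
    have "Phi b = g i * Phi b'" using Phi_step b' by simp
    then show ?thesis
    proof (intro subsetI)
      fix m assume "m \<in> Poly_Mapping.keys (Phi b)"
      then obtain u v where uv: "m = u + v" "u \<in> Poly_Mapping.keys (g i)" "v \<in> Poly_Mapping.keys (Phi b')"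
        using keys_mult[of "g i" "Phi b'"] \<open>Phi b = g i * Phi b'\<close> by auto
      then show "m \<in> Low b"
        using keys_g[OF b'(1) uv(2)] IH b'(3) by (auto simp: Low_def Mon_def)
    qed
  qed
qed

lemma wf_lexrel: "wf lexrel" by (auto simp: lexrel_def)

text \<open>Division with remainder. A block \<open>x_i^(E i)\<close> in \<open>b\<close> is
  replaced by \<open>g i - H i\<close>; the part with \<open>g i\<close> follows from the smaller
  cofactor and \<open>Phi_step\<close>, and the terms coming from \<open>H i\<close> precede
  \<open>b\<close> in \<open>lexrel\<close>.\<close>

lemma mon_in_span_Phi: "b \<in> Mon \<Longrightarrow> mon b \<in> span (Phi ` Low b)"
proof (induction b rule: wf_induct_rule[OF wf_lexrel])
  case (1 b)
  show ?case
  proof (cases "reduced b")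
    case True
    then have "mon b = Phi b" using Phi_reduced 1 by simp
    moreover have "b \<in> Low b" using 1(2) by (simp add: Low_def)
    ultimately show ?thesis by (auto intro: span_base)
  next
    case False
    then obtain i b' where b': "i \<in> {1..r}" "b' \<in> Mon" "b = b' + replicate_mset (E i) i"
      using not_reduced_split 1(2) by blast
    have "mon b' \<in> span (Phi ` Low b')"
      using 1(1)[OF _ b'(2)] b'(3) E_pos[of i] by (simp add: lexrel_def)
    then have "g i * mon b' \<in> span ((\<lambda>q. g i * q) ` Phi ` Low b')"
      using linear_span_image[OF linear_mult, of "g i"] by blast
    moreover have "(\<lambda>q. g i * q) ` Phi ` Low b' \<subseteq> Phi ` Low b"
    proof
      fix p assume "p \<in> (\<lambda>q. g i * q) ` Phi ` Low b'"
      then obtain c where c: "c \<in> Low b'" "p = g i * Phi c" by blast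
      then have "p = Phi (c + replicate_mset (E i) i)" using Phi_step b'(1) by simp
      moreover have "c + replicate_mset (E i) i \<in> Low b"
        using c(1) b' by (auto simp: Low_def Mon_def)
      ultimately show "p \<in> Phi ` Low b" by blast
    qed
    ultimately have lead: "g i * mon b' \<in> span (Phi ` Low b)" using span_mono by blast
    have "H i * mon b' = (\<Sum>m\<in>Poly_Mapping.keys (H i). Poly_Mapping.lookup (H i) m *\<^sub>R mon (m + b'))"
      by (subst mpol_expand[of "H i"]) (simp add: sum_distrib_right mult_scaleR mon_add)
    moreover have "mon (m + b') \<in> span (Phi ` Low b)" if m: "m \<in> Poly_Mapping.keys (H i)" for m
    proof -
      note k = keys_H[OF b'(1) m]
      have "m + b' \<in> Mon" using k(1) b'(2) by (simp add: Mon_def)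
      moreover have "(m + b', b) \<in> lexrel"
      proof (cases "size m < E i")
        case True
        then show ?thesis using b'(3) by (simp add: lexrel_def)
      next
        case False
        then have "count m r = 0" "i = r" using k(4) by (auto simp: not_in_iff)
        then show ?thesis using k(3) False b'(3) E_pos[of i] by (simp add: lexrel_def)
      qed
      ultimately have "mon (m + b') \<in> span (Phi ` Low (m + b'))" using 1(1) by blast
      moreover have "Low (m + b') \<subseteq> Low b" using k b'(3) by (auto simp: Low_def)
      ultimately show ?thesis using span_mono[of "Phi ` Low (m + b')" "Phi ` Low b"] by blast
    qed
    ultimately have "H i * mon b' \<in> span (Phi ` Low b)" by (auto intro!: span_sum span_scale)
    moreover have "mon b = g i * mon b' - H i * mon b'"
      using b'(3) by (simp add: g_def mon_add algebra_simps)
    ultimately show ?thesis using lead span_diff by simp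
  qed
qed

lemma Phi_basis: "inj_on Phi Mon" "independent (Phi ` Mon)"
proof -
  define N where "N D = {b \<in> Mon. size b \<le> D}" for D
  have fin: "finite (N D)" for D
  proof -
    have "N D \<subseteq> (\<Union>n\<le>D. multisets_of_size {1..r} n)" by (auto simp: N_def Mon_def multisets_of_size_def)
    then show ?thesis by (rule finite_subset) auto
  qed
  \<comment> \<open>The polynomials \<open>Phi b\<close> of degree at most \<open>D\<close> are no more than the monomials and span them.\<close>
  have bas: "card (Phi ` N D) = card (N D) \<and> independent (Phi ` N D)" for D
  proof -
    have "mon ` N D \<subseteq> span (Phi ` N D)"
    proof
      fix p assume "p \<in> mon ` N D"
      then obtain b where b: "b \<in> N D" "p = mon b" by blast
      then have "p \<in> span (Phi ` Low b)" using mon_in_span_Phi by (simp add: N_def)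
      moreover have "Low b \<subseteq> N D" using b(1) by (auto simp: Low_def N_def)
      ultimately show "p \<in> span (Phi ` N D)" using span_mono[of "Phi ` Low b" "Phi ` N D"] by blast
    qed
    moreover obtain B where B: "B \<subseteq> Phi ` N D" "independent B" "Phi ` N D \<subseteq> span B"
      using maximal_independent_subset by blast
    ultimately have "mon ` N D \<subseteq> span B" using span_minimal[OF B(3) subspace_span] by blast
    moreover have finB: "finite B" using B(1) fin finite_subset by blast
    ultimately have "card (mon ` N D) \<le> card B"
      using independent_span_bound[OF _ independent_mon] by blast
    moreover have "card (mon ` N D) = card (N D)"
      using inj_mon by (intro card_image) (auto simp: inj_on_def)
    moreover have "card (Phi ` N D) \<le> card (N D)" using card_image_le[OF fin] .
    moreover have "card B \<le> card (Phi ` N D)" using B(1) fin by (simp add: card_mono)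
    ultimately have "card B = card (Phi ` N D)" "card (Phi ` N D) = card (N D)" by simp_all
    then show ?thesis using B(1,2) fin card_subset_eq by (metis finite_imageI)
  qed
  have injN: "inj_on Phi (N D)" for D using bas fin eq_card_imp_inj_on by blast
  show "inj_on Phi Mon"
  proof (rule inj_onI)
    fix b c assume "b \<in> Mon" "c \<in> Mon" "Phi b = Phi c"
    \<comment> \<open>Both indices have size at most this sum, so injectivity on a single
      degree-bounded piece is enough.\<close>
    then show "b = c" using inj_onD[OF injN[of "size b + size c"]] by (simp add: N_def)
  qed
  have "Phi ` Mon = \<Union> (range (\<lambda>D. Phi ` N D))" by (auto simp: N_def)
  moreover have "independent (\<Union> (range (\<lambda>D. Phi ` N D)))"
  proof (rule independent_Union_directed)
    fix c d assume "c \<in> range (\<lambda>D. Phi ` N D)" "d \<in> range (\<lambda>D. Phi ` N D)"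
    then obtain C D where "c = Phi ` N C" "d = Phi ` N D" by blast
    moreover have "N C \<subseteq> N D \<or> N D \<subseteq> N C" by (auto simp: N_def)
    ultimately show "c \<subseteq> d \<or> d \<subseteq> c" by blast
  qed (use bas in auto)
  ultimately show "independent (Phi ` Mon)" by simp
qed

text \<open>\<open>k\<close> selects a parity class: 0 gives the even part, and
  \<open>k = E i\<close> gives the cofactors whose product with \<open>g i\<close> is even. Both
  changes of basis stay inside a class because \<open>Low\<close> preserves parity.\<close>

lemma span_Phi_eq: "span (Phi ` {b \<in> Mon. even (size b + k)}) = span (mon ` {b \<in> Mon. even (size b + k)})"
proof (rule subset_antisym; rule span_minimal[OF _ subspace_span]; rule image_subsetI)
  fix b assume b: "b \<in> {b \<in> Mon. even (size b + k)}"
  show "Phi b \<in> span (mon ` {b \<in> Mon. even (size b + k)})"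
    using keys_Phi[of b] b by (intro mpol_in_span) (auto simp: Low_def)
  have "Low b \<subseteq> {b \<in> Mon. even (size b + k)}" using b by (auto simp: Low_def)
  then show "mon b \<in> span (Phi ` {b \<in> Mon. even (size b + k)})"
    using mon_in_span_Phi[of b] b span_mono[of "Phi ` Low b"] by blast
qed

section \<open>The even part of the quotient ring and its dimension\<close>

definition Red :: "nat multiset set" where "Red = {b \<in> Mon. even (size b) \<and> reduced b}"

text \<open>The even part of the ideal generated by the \<open>g i\<close>, described by a basis
  instead of generators. In this form a projection along it can be prescribed on basis vectors; the
  absorption properties are then proved separately.\<close>

definition Ideal0 :: "mpol set" where
  "Ideal0 = span (Phi ` {b \<in> Mon. even (size b) \<and> \<not> reduced b})"

text \<open>In the basis \<open>Phi\<close>, multiplication by \<open>g i\<close> is a shift of the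
  index by \<open>E i\<close>, and a shifted index is never reduced.\<close>

lemma g_mult_Ideal0:
  assumes i: "i \<in> {1..r}" and p: "\<And>b. b \<in> Poly_Mapping.keys p \<Longrightarrow> b \<in> Mon \<and> even (size b + E i)"
  shows "g i * p \<in> Ideal0"
proof -
  have "p \<in> span (Phi ` {b \<in> Mon. even (size b + E i)})"
    unfolding span_Phi_eq using p by (intro mpol_in_span) auto
  then have "g i * p \<in> span ((\<lambda>q. g i * q) ` Phi ` {b \<in> Mon. even (size b + E i)})"
    using linear_span_image[OF linear_mult, of "g i"] by blast
  moreover have "(\<lambda>q. g i * q) ` Phi ` {b \<in> Mon. even (size b + E i)} \<subseteq> Phi ` {b \<in> Mon. even (size b) \<and> \<not> reduced b}"
  proof
    fix q assume "q \<in> (\<lambda>q. g i * q) ` Phi ` {b \<in> Mon. even (size b + E i)}"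
    then obtain b where b: "b \<in> Mon" "even (size b + E i)" "q = g i * Phi b" by blast
    then have "q = Phi (b + replicate_mset (E i) i)" using Phi_step i by simp
    moreover have "\<not> reduced (b + replicate_mset (E i) i)"
      unfolding reduced_def by (auto intro!: exI[of _ i] simp: not_less)
    ultimately show "q \<in> Phi ` {b \<in> Mon. even (size b) \<and> \<not> reduced b}"
      using b(1,2) i by (auto simp: Mon_def)
  qed
  ultimately show ?thesis unfolding Ideal0_def using span_mono by blast
qed

text \<open>A basis vector of \<open>Ideal0\<close> contains some factor \<open>g i\<close>; the
  monomial is moved into the cofactor, whose parity remains that of \<open>E i\<close>.\<close>

lemma mon_mult_Ideal0:
  assumes m: "m \<in> Mon" "even (size m)" and p: "p \<in> Ideal0"
  shows "mon m * p \<in> Ideal0"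
proof -
  have "mon m * p \<in> span ((\<lambda>q. mon m * q) ` Phi ` {b \<in> Mon. even (size b) \<and> \<not> reduced b})"
    using p linear_span_image[OF linear_mult, of "mon m"] unfolding Ideal0_def by blast
  moreover have "(\<lambda>q. mon m * q) ` Phi ` {b \<in> Mon. even (size b) \<and> \<not> reduced b} \<subseteq> Ideal0"
  proof
    fix q assume "q \<in> (\<lambda>q. mon m * q) ` Phi ` {b \<in> Mon. even (size b) \<and> \<not> reduced b}"
    then obtain b where b: "b \<in> Mon" "even (size b)" "\<not> reduced b" "q = mon m * Phi b" by blast
    then obtain i b' where b': "i \<in> {1..r}" "b' \<in> Mon" "b = b' + replicate_mset (E i) i"
      using not_reduced_split by blast
    then have "q = g i * (mon m * Phi b')" using Phi_step b(4) by (simp add: algebra_simps)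
    moreover have "g i * (mon m * Phi b') \<in> Ideal0"
    proof (rule g_mult_Ideal0[OF b'(1)])
      fix c assume "c \<in> Poly_Mapping.keys (mon m * Phi b')"
      then obtain d where "c = m + d" "d \<in> Poly_Mapping.keys (Phi b')"
        using keys_mult[of "mon m" "Phi b'"] by auto
      then show "c \<in> Mon \<and> even (size c + E i)"
        using keys_Phi[OF b'(2)] m b(2) b'(3) by (auto simp: Low_def Mon_def)
    qed
    ultimately show "q \<in> Ideal0" by simp
  qed
  ultimately show ?thesis unfolding Ideal0_def using span_minimal[OF _ subspace_span] by blast
qed

lemma card_Red: "finite Red" "odd (card Red)"
proof -
  \<comment> \<open>The exponent of \<open>x\<^sub>r\<close> is 0 or 1 and is determined by the others, as the total degree is even.\<close>
  let ?F = "{1..<r} \<rightarrow>\<^sub>E {..<e}"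
  have Er: "E r = 2" and Ej: "\<And>j. j \<in> {1..<r} \<Longrightarrow> E j = e" by (auto simp: E_def)
  have cnt: "count b i = 0" if "b \<in> Red" "i \<notin> {1..r}" for b i
    using that by (auto simp: Red_def Mon_def not_in_iff[symmetric])
  have size: "size b = count b r + (\<Sum>j\<in>{1..<r}. count b j)" if "b \<in> Red" for b
  proof -
    have "size b = (\<Sum>j\<in>{1..r}. count b j)"
      unfolding size_multiset_overloaded_eq using cnt[OF that]
      by (intro sum.mono_neutral_left) (use that in \<open>auto simp: Red_def Mon_def not_in_iff\<close>)
    also have "{1..r} = insert r {1..<r}" using r by auto
    finally show ?thesis by simp
  qed
  have "bij_betw (\<lambda>b. restrict (count b) {1..<r}) Red ?F"
  proof (rule bij_betw_imageI)
    show "inj_on (\<lambda>b. restrict (count b) {1..<r}) Red"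
    proof (rule inj_onI)
      fix b c assume bc: "b \<in> Red" "c \<in> Red" and eq: "restrict (count b) {1..<r} = restrict (count c) {1..<r}"
      have j: "count b j = count c j" if "j \<in> {1..<r}" for j using fun_cong[OF eq, of j] that by simp
      have "count b r < 2" "count c r < 2" using bc Er unfolding Red_def reduced_def by (metis (lifting) mem_Collect_eq)+
      moreover have "even (count b r) \<longleftrightarrow> even (count c r)"
      proof -
        have "(\<Sum>j\<in>{1..<r}. count b j) = (\<Sum>j\<in>{1..<r}. count c j)" using j by simp
        moreover have "even (size b)" "even (size c)" using bc by (auto simp: Red_def)
        ultimately show ?thesis using size[OF bc(1)] size[OF bc(2)] by auto
      qed
      ultimately have "count b r = count c r" by (auto simp: less_2_cases_iff)
      then show "b = c" using j cnt[OF bc(1)] cnt[OF bc(2)]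
        by (intro multiset_eqI) (metis atLeastAtMost_iff atLeastLessThan_iff le_neq_implies_less)
    qed
    show "(\<lambda>b. restrict (count b) {1..<r}) ` Red = ?F"
    proof (rule subset_antisym)
      show "(\<lambda>b. restrict (count b) {1..<r}) ` Red \<subseteq> ?F"
      proof (rule image_subsetI)
        fix b assume "b \<in> Red"
        then have "count b i < E i" for i by (simp add: Red_def reduced_def)
        then have "count b j < e" if "j \<in> {1..<r}" for j using Ej[OF that] by metis
        then show "restrict (count b) {1..<r} \<in> ?F" by simp
      qed
      show "?F \<subseteq> (\<lambda>b. restrict (count b) {1..<r}) ` Red"
      proof
        fix f assume f: "f \<in> ?F"
        define b where "b = (\<Sum>j\<in>{1..<r}. replicate_mset (f j) j) + replicate_mset (sum f {1..<r} mod 2) r"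
        have cb: "count b i = (if i \<in> {1..<r} then f i else if i = r then sum f {1..<r} mod 2 else 0)" for i
        proof -
          have "count b i = (\<Sum>j\<in>{1..<r}. if j = i then f j else 0) + (if i = r then sum f {1..<r} mod 2 else 0)"
            unfolding b_def by (simp add: count_sum)
          then show ?thesis by auto
        qed
        have bM: "b \<in> Mon"
        proof -
          have "i \<in> {1..r}" if "i \<in># b" for i
          proof -
            have "0 < count b i" using that by (simp only: count_greater_zero_iff)
            then show ?thesis unfolding cb[of i] using r by (auto split: if_splits)
          qed
          then show ?thesis by (auto simp: Mon_def)
        qed
        have sb: "size b = sum f {1..<r} + sum f {1..<r} mod 2"
        proof -
          have "size (\<Sum>j\<in>A. replicate_mset (f j) j) = sum f A" if "finite A" for A
            using that by induction auto
          then show ?thesis by (simp add: b_def)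
        qed
        have "even (k + k mod 2)" for k :: nat by presburger
        then have "even (size b)" by (simp only: sb)
        moreover have "reduced b"
          unfolding reduced_def using cb f Er Ej E_pos by (auto simp: PiE_iff)
        ultimately have "b \<in> Red" using bM by (simp add: Red_def)
        moreover have "restrict (count b) {1..<r} = f"
          using f cb by (auto simp: fun_eq_iff PiE_iff extensional_def restrict_def)
        ultimately show "f \<in> (\<lambda>b. restrict (count b) {1..<r}) ` Red" by (intro image_eqI) auto
      qed
    qed
  qed
  moreover have "card ?F = e ^ (r - 1)" by (simp add: card_PiE)
  moreover have "finite ?F" by (simp add: finite_PiE)
  ultimately show "finite Red" "odd (card Red)"
    using e by (simp_all add: bij_betw_finite bij_betw_same_card)
qed

end

section \<open>The real solution as a common eigenvector\<close>

context odd_system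
begin

text \<open>\<open>V\<close> is the space of normal forms, a model of the even part of the quotient
  ring. On a common eigenvector \<open>v\<close>, every even polynomial acts modulo
  \<open>Ideal0\<close> as a scalar, and this scalar is its value at the point sought.\<close>

lemma real_solution:
  obtains x where "(\<Sum>i\<in>{1..r}. (x i)\<^sup>2) = 1" "\<And>j. j \<in> {1..<r} \<Longrightarrow> x j ^ e + peval x (h j) = 0"
proof -
  define V where "V = span (mon ` Red)"
  have monPhi: "mon ` Red = Phi ` Red"
    using Phi_reduced by (force simp: Red_def)
  have VPhi: "V = span (Phi ` Red)" by (simp add: V_def monPhi)
  \<comment> \<open>Prescribed on the independent family \<open>Phi\<close>: the identity on reduced
    indices and zero on the others. On even polynomials \<open>P\<close> therefore computes the
    normal form modulo \<open>Ideal0\<close>.\<close>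
  obtain P where P: "linear P" "\<forall>p \<in> Phi ` Mon. P p = (if p \<in> Phi ` Red then p else 0)"
    using linear_independent_extend[OF Phi_basis(2), of "\<lambda>p. if p \<in> Phi ` Red then p else 0"] by blast
  have RedMon: "Red \<subseteq> Mon" by (auto simp: Red_def)
  have P_Red: "P (Phi b) = Phi b" if "b \<in> Red" for b
    using P(2) that RedMon by auto
  have P_nonRed: "P (Phi b) = 0" if "b \<in> Mon" "b \<notin> Red" for b
    using P(2) that RedMon inj_onD[OF Phi_basis(1)] by (auto simp: image_iff)
  have P_V: "P v = v" if "v \<in> V" for v
    using that unfolding VPhi
  proof (induction rule: span_induct_alt)
    case (step c x y)
    then show ?case using P_Red by (auto simp: linear_add[OF P(1)] linear_cmul[OF P(1)])
  qed (simp add: linear_0[OF P(1)])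
  have P_I: "P p = 0" if "p \<in> Ideal0" for p
    using that unfolding Ideal0_def
  proof (induction rule: span_induct_alt)
    case (step c x y)
    then show ?case using P_nonRed by (auto simp: linear_add[OF P(1)] linear_cmul[OF P(1)] Red_def)
  qed (simp add: linear_0[OF P(1)])
  have subI: "subspace Ideal0" by (simp add: Ideal0_def)
  let ?P0 = "span (mon ` {b \<in> Mon. even (size b)})"
  have P0_eq: "?P0 = span (Phi ` {b \<in> Mon. even (size b)})"
    using span_Phi_eq[of 0] by simp
  have proj: "P p \<in> V \<and> p - P p \<in> Ideal0" if "p \<in> ?P0" for p
    using that unfolding P0_eq
  proof (induction rule: span_induct_alt)
    case base
    then show ?case by (simp add: linear_0[OF P(1)] V_def span_zero subspace_0[OF subI])
  next
    case (step c x y)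
    then obtain b where b: "b \<in> Mon" "even (size b)" "x = Phi b" by blast
    have x: "P x \<in> V \<and> x - P x \<in> Ideal0"
    proof (cases "b \<in> Red")
      case True
      then show ?thesis
        using P_Red b(3) subspace_0[OF subI] by (auto simp: VPhi intro: span_base)
    next
      case False
      moreover have "Phi b \<in> Ideal0"
        unfolding Ideal0_def using b False by (intro span_base) (auto simp: Red_def)
      ultimately show ?thesis using P_nonRed b by (simp add: V_def span_zero)
    qed
    have "c *\<^sub>R x + y - P (c *\<^sub>R x + y) = c *\<^sub>R (x - P x) + (y - P y)"
      by (simp add: linear_add[OF P(1)] linear_cmul[OF P(1)] algebra_simps)
    moreover have "c *\<^sub>R (x - P x) + (y - P y) \<in> Ideal0"
      using x step.IH subI by (simp add: subspace_add subspace_scale)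
    moreover have "P (c *\<^sub>R x + y) = c *\<^sub>R P x + P y"
      by (simp add: linear_add[OF P(1)] linear_cmul[OF P(1)])
    moreover have "c *\<^sub>R P x + P y \<in> V"
      using x step.IH unfolding V_def by (simp add: span_add span_scale)
    ultimately show ?case by (simp only:)
  qed
  have V_P0: "V \<subseteq> ?P0" unfolding V_def by (intro span_mono image_mono) (auto simp: Red_def)
  have mult_P0: "mon m * p \<in> ?P0" if "m \<in> Mon" "even (size m)" "p \<in> ?P0" for m p
  proof -
    have "Poly_Mapping.keys p \<subseteq> {b \<in> Mon. even (size b)}" using span_mon_keys[OF that(3)] .
    then show ?thesis
      using keys_mult[of "mon m" p] that(1,2) by (intro mpol_in_span) (fastforce simp: Mon_def)
  qed
  \<comment> \<open>Multiplication by \<open>x_k x_l\<close> on normal forms. Single coordinates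
    would leave the even part, so pairs are used.\<close>
  define T where "T = (\<lambda>(k, l) v. P (mon {#k, l#} * v))"
  let ?I = "{1..r} \<times> {1..r}"
  have pair: "{#k, l#} \<in> Mon" "even (size {#k, l#})" if "k \<in> {1..r}" "l \<in> {1..r}" for k l
    using that by (auto simp: Mon_def)
  have TV: "T i v \<in> V \<and> mon {#fst i, snd i#} * v - T i v \<in> Ideal0" if "i \<in> ?I" "v \<in> V" for i v
    using that proj mult_P0 pair V_P0 by (auto simp: T_def)
  have linT: "linear (T i)" for i
    unfolding T_def using linear_compose[OF linear_mult P(1)] by (simp add: case_prod_unfold o_def)
  \<comment> \<open>The error made by the inner reduction lies in \<open>Ideal0\<close>; it stays
    there after multiplication and is killed by \<open>P\<close>. A composite is thus the normal
    form of a product, which makes the operators commute.\<close>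
  have TT: "T i (T j v) = P (mon {#fst i, snd i#} * (mon {#fst j, snd j#} * v))"
    if "i \<in> ?I" "j \<in> ?I" "v \<in> V" for i j v
  proof -
    have "mon {#fst i, snd i#} * (mon {#fst j, snd j#} * v - T j v) \<in> Ideal0"
      using mon_mult_Ideal0 pair that TV by auto
    from P_I[OF this] show ?thesis
      by (simp add: T_def case_prod_unfold right_diff_distrib linear_diff[OF P(1)])
  qed
  have "inj_on mon Red" using inj_mon by (rule inj_on_subset) simp
  then have "odd (card (mon ` Red))" using card_Red by (simp add: card_image)
  then have oddV: "odd (dim V)"
    unfolding V_def using dim_span_eq_card_independent[OF independent_mon, of Red] by simp
  have "finite (mon ` Red)" using card_Red(1) by simp
  obtain v where v: "v \<in> V" "v \<noteq> 0" "\<forall>i\<in>?I. \<exists>c. T i v = c *\<^sub>R v"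
  proof (rule commuting_odd_dim_eigenvector[where T = T and I = ?I and V = V and F = "mon ` Red"])
    show "subspace V" "V \<subseteq> span (mon ` Red)" by (simp_all add: V_def)
    show "T i ` V \<subseteq> V" if "i \<in> ?I" for i using TV[OF that] by blast
    show "T i (T j v) = T j (T i v)" if "i \<in> ?I" "j \<in> ?I" "v \<in> V" for i j v
      using TT that by (simp add: mult.left_commute)
  qed (use linT oddV \<open>finite (mon ` Red)\<close> in auto)
  have "\<forall>i. \<exists>c. i \<in> ?I \<longrightarrow> T i v = c *\<^sub>R v" using v(3) by blast
  then obtain \<mu> where \<mu>: "\<And>k l. k \<in> {1..r} \<Longrightarrow> l \<in> {1..r} \<Longrightarrow> T (k, l) v = \<mu> (k, l) *\<^sub>R v"
    by (metis SigmaI)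
  \<comment> \<open>\<open>P\<close> is the identity on \<open>V\<close> and zero on
    \<open>Ideal0\<close>, so the two meet only in 0. Congruences between multiples of
    \<open>v\<close> become equations between scalars.\<close>
  have v_notin: "c = 0" if "c *\<^sub>R v \<in> Ideal0" for c
    using P_I[OF that] P_V[OF v(1)] v(2) by (simp add: linear_cmul[OF P(1)])
  have v_mult: "mon {#k, l#} * v - \<mu> (k, l) *\<^sub>R v \<in> Ideal0" if "k \<in> {1..r}" "l \<in> {1..r}" for k l
    using TV[of "(k, l)" v] \<mu> that v(1) by simp
  have sym: "\<mu> (k, l) = \<mu> (l, k)" if "k \<in> {1..r}" "l \<in> {1..r}" for k l
  proof -
    have "T (k, l) v = T (l, k) v" by (simp add: T_def add_mset_commute)
    then show ?thesis using \<mu> that v(2) by simp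
  qed
  \<comment> \<open>The monomial \<open>x_k x_l x_i x_j\<close> can be grouped into pairs in two
    ways. The identity says that the matrix \<open>\<mu>\<close> has vanishing two-by-two
    minors.\<close>
  have prod: "\<mu> (k, l) * \<mu> (i, j) = \<mu> (k, i) * \<mu> (l, j)"
    if "k \<in> {1..r}" "l \<in> {1..r}" "i \<in> {1..r}" "j \<in> {1..r}" for k l i j
  proof -
    have TTv: "T (a, b) (T (c, d) v) = (\<mu> (a, b) * \<mu> (c, d)) *\<^sub>R v"
      if "a \<in> {1..r}" "b \<in> {1..r}" "c \<in> {1..r}" "d \<in> {1..r}" for a b c d
      using that by (simp add: \<mu> linear_cmul[OF linT])
    have "mon {#k, l#} * (mon {#i, j#} * v) = mon {#k, i#} * (mon {#l, j#} * v)"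
      by (simp add: mult.assoc[symmetric] mult_single add_mset_commute)
    then have "T (k, l) (T (i, j) v) = T (k, i) (T (l, j) v)"
      using TT[of "(k, l)" "(i, j)" v] TT[of "(k, i)" "(l, j)" v] that v(1) by simp
    then show ?thesis using TTv that v(2) by simp
  qed
  \<comment> \<open>\<open>g r\<close> is the sphere equation and is even, so it multiplies
    \<open>v\<close> into \<open>Ideal0\<close>.\<close>
  have sum1: "(\<Sum>k\<in>{1..r}. \<mu> (k, k)) = 1"
  proof -
    have gr: "g r = (\<Sum>k\<in>{1..r}. mon {#k, k#}) - 1"
    proof -
      have "{1..r} = insert r {1..<r}" using r by auto
      then show ?thesis by (simp add: g_def H_def E_def numeral_2_eq_2)
    qed
    have "g r * v \<in> Ideal0"
      using r span_mon_keys[of v Red] v(1)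
      by (intro g_mult_Ideal0) (auto simp: V_def Red_def E_def)
    moreover have "(\<Sum>k\<in>{1..r}. mon {#k, k#} * v - \<mu> (k, k) *\<^sub>R v) \<in> Ideal0"
      using v_mult by (intro subspace_sum[OF subI]) auto
    moreover have "((\<Sum>k\<in>{1..r}. \<mu> (k, k)) - 1) *\<^sub>R v
        = g r * v - (\<Sum>k\<in>{1..r}. mon {#k, k#} * v - \<mu> (k, k) *\<^sub>R v)"
      unfolding gr by (simp add: sum_subtractf sum_distrib_right sum_distrib_left scaleR_sum_left algebra_simps)
    ultimately have "((\<Sum>k\<in>{1..r}. \<mu> (k, k)) - 1) *\<^sub>R v \<in> Ideal0"
      using subspace_diff[OF subI] by simp
    then show ?thesis using v_notin by force
  qed
  obtain k where k: "k \<in> {1..r}" "\<mu> (k, k) > 0"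
  proof -
    have "\<exists>k\<in>{1..r}. \<mu> (k, k) > 0"
    proof (rule ccontr)
      assume "\<not> ?thesis"
      then have "(\<Sum>k\<in>{1..r}. \<mu> (k, k)) \<le> 0" by (intro sum_nonpos) (auto simp: not_less)
      then show False using sum1 by simp
    qed
    then show ?thesis using that by blast
  qed
  \<comment> \<open>A column of the rank-one matrix \<open>\<mu>\<close>, normalized by a positive
    diagonal entry; such an entry exists because the trace is 1. The choice of the square root is
    the choice between \<open>x\<close> and \<open>-x\<close>.\<close>
  define x where "x i = \<mu> (i, k) / sqrt (\<mu> (k, k))" for i
  have xx: "x i * x j = \<mu> (i, j)" if "i \<in> {1..r}" "j \<in> {1..r}" for i j
  proof -
    have "x i * x j = \<mu> (i, k) * \<mu> (j, k) / \<mu> (k, k)"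
      using k(2) by (simp add: x_def)
    also have "\<mu> (i, k) * \<mu> (j, k) = \<mu> (i, j) * \<mu> (k, k)"
      using prod[of i j k k] that k(1) by simp
    finally show ?thesis using k(2) by simp
  qed
  \<comment> \<open>Two variables are removed at a time, which keeps the rest an even monomial; each
    pair acts on \<open>v\<close> by \<open>\<mu> (i, j) = x i * x j\<close>.\<close>
  have mon_v: "mon b * v - prod_mset (image_mset x b) *\<^sub>R v \<in> Ideal0" if "b \<in> Mon" "even (size b)" for b
    using that
  proof (induction "size b" arbitrary: b rule: less_induct)
    case less
    show ?case
    proof (cases "b = {#}")
      case True
      then show ?thesis using subspace_0[OF subI] by simp
    next
      case False
      then obtain i b1 where b1: "b = add_mset i b1" by (meson multiset_cases)
      then obtain j c where "b1 = add_mset j c" using less.prems(2) by (cases b1) auto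
      then have b: "b = {#i, j#} + c" using b1 by simp
      have ij: "i \<in> {1..r}" "j \<in> {1..r}" and c: "c \<in> Mon" "even (size c)"
        using less.prems b by (auto simp: Mon_def)
      have IH: "mon c * v - prod_mset (image_mset x c) *\<^sub>R v \<in> Ideal0"
        using less.hyps[OF _ c] b by simp
      have "mon {#i, j#} * (mon c * v - prod_mset (image_mset x c) *\<^sub>R v) \<in> Ideal0"
        using mon_mult_Ideal0[OF pair[OF ij] IH] .
      moreover have "prod_mset (image_mset x c) *\<^sub>R (mon {#i, j#} * v - \<mu> (i, j) *\<^sub>R v) \<in> Ideal0"
        using v_mult[OF ij] subspace_scale[OF subI] by blast
      ultimately have "mon {#i, j#} * (mon c * v - prod_mset (image_mset x c) *\<^sub>R v)
          + prod_mset (image_mset x c) *\<^sub>R (mon {#i, j#} * v - \<mu> (i, j) *\<^sub>R v) \<in> Ideal0"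
        by (rule subspace_add[OF subI])
      moreover have "prod_mset (image_mset x b) = prod_mset (image_mset x c) * \<mu> (i, j)"
        using xx[OF ij] b by simp
      moreover have "mon b = mon {#i, j#} * mon c" unfolding b by (rule mon_add)
      ultimately show ?thesis
        by (simp add: algebra_simps mult_scaleR)
    qed
  qed
  have eval: "peval x p = 0"
    if p: "\<And>b. b \<in> Poly_Mapping.keys p \<Longrightarrow> b \<in> Mon \<and> even (size b)" and pv: "p * v \<in> Ideal0" for p
  proof -
    have "(\<Sum>b\<in>Poly_Mapping.keys p. Poly_Mapping.lookup p b *\<^sub>R (mon b * v - prod_mset (image_mset x b) *\<^sub>R v)) \<in> Ideal0"
      using p mon_v by (intro subspace_sum[OF subI] subspace_scale[OF subI]) blast
    moreover have "p * v = (\<Sum>b\<in>Poly_Mapping.keys p. Poly_Mapping.lookup p b *\<^sub>R (mon b * v))"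
      by (subst mpol_expand[of p]) (simp add: sum_distrib_right mult_scaleR)
    ultimately have "p * v - peval x p *\<^sub>R v \<in> Ideal0"
      by (simp add: peval_def scaleR_sum_left scaleR_diff_right sum_subtractf)
    then have "peval x p *\<^sub>R v \<in> Ideal0"
      using pv subspace_diff[OF subI pv] by fastforce
    then show ?thesis by (rule v_notin)
  qed
  show thesis
  proof
    show sq: "(\<Sum>i\<in>{1..r}. (x i)\<^sup>2) = 1"
      using sum1 xx by (simp add: power2_eq_square)
    fix j assume j: "j \<in> {1..<r}"
    then have jr: "j \<in> {1..r}" and Ej: "E j = e" and Hj: "H j = h j" by (auto simp: E_def H_def)
    \<comment> \<open>The equation \<open>g j\<close> is odd and does not act on the even part. Its
      product with a coordinate is even and yields this identity; since \<open>x\<close> lies on the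
      sphere, some coordinate can be cancelled.\<close>
    have "(x j ^ e + peval x (h j)) * x i = 0" if i: "i \<in> {1..r}" for i
    proof -
      have "g j * (mon {#i#} * v) \<in> Ideal0"
      proof (rule g_mult_Ideal0[OF jr])
        fix b assume "b \<in> Poly_Mapping.keys (mon {#i#} * v)"
        then obtain c where c: "b = add_mset i c" "c \<in> Poly_Mapping.keys v"
          using keys_mult[of "mon {#i#}" v] by auto
        moreover have "c \<in> Red" using c(2) span_mon_keys[of v Red] v(1) by (auto simp: V_def)
        ultimately show "b \<in> Mon \<and> even (size b + E j)"
          using i e by (auto simp: Ej Red_def Mon_def)
      qed
      then have "peval x (g j * mon {#i#}) = 0"
      proof (intro eval)
        fix b assume "b \<in> Poly_Mapping.keys (g j * mon {#i#})"
        then obtain m where "m \<in> Poly_Mapping.keys (g j)" "b = add_mset i m"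
          using keys_mult[of "g j" "mon {#i#}"] by auto
        then show "b \<in> Mon \<and> even (size b)"
          using keys_g[OF jr, of m] i e by (auto simp: Ej Mon_def)
      qed (simp add: mult.assoc)
      then show ?thesis
        by (simp add: peval_mult_mon g_def peval_add peval_mon Ej Hj)
    qed
    then have "x j ^ e + peval x (h j) = 0 \<or> (\<forall>i\<in>{1..r}. x i = 0)" by auto
    then show "x j ^ e + peval x (h j) = 0" using sq by auto
  qed
qed

end

text \<open>Bolzano-Weierstrass, one coordinate at a time: a bounded sequence has a monotone, hence
  convergent, subsequence, and the coordinates treated before keep converging along it.\<close>

lemma convergent_coordinates_subseq:
  fixes x :: "nat \<Rightarrow> 'i \<Rightarrow> real"
  assumes "finite I" "\<And>n i. i \<in> I \<Longrightarrow> \<bar>x n i\<bar> \<le> C"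
  obtains s y where "strict_mono s" "\<And>i. i \<in> I \<Longrightarrow> (\<lambda>n. x (s n) i) \<longlonglongrightarrow> y i"
proof -
  have "\<exists>s. strict_mono s \<and> (\<forall>i\<in>I. convergent (\<lambda>n. x (s n) i))"
    using assms
  proof (induction I)
    case empty
    then show ?case by (auto intro!: exI[of _ id] strict_mono_id)
  next
    case (insert k I)
    then obtain s where s: "strict_mono s" "\<forall>i\<in>I. convergent (\<lambda>n. x (s n) i)" by auto
    obtain t where t: "strict_mono t" "monoseq (\<lambda>n. x (s (t n)) k)"
      using seq_monosub[of "\<lambda>n. x (s n) k"] by auto
    moreover have "Bseq (\<lambda>n. x (s (t n)) k)"
      using insert.prems by (intro BseqI'[of _ C]) auto
    ultimately have "convergent (\<lambda>n. x (s (t n)) k)" by (simp add: Bseq_monoseq_convergent)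
    moreover have "convergent (\<lambda>n. x (s (t n)) i)" if "i \<in> I" for i
      using convergent_subseq_convergent[OF bspec[OF s(2) that] t(1)] by (simp add: o_def)
    ultimately show ?case
      using strict_mono_o[OF s(1) t(1)] by (intro exI[of _ "s \<circ> t"]) (auto simp: o_def)
  qed
  then obtain s where "strict_mono s" "\<forall>i\<in>I. convergent (\<lambda>n. x (s n) i)" by blast
  then show thesis
    using that[of s "\<lambda>i. lim (\<lambda>n. x (s n) i)"] by (simp add: convergent_LIMSEQ_iff)
qed

theorem borsuk_ulam_odd_polynomials:
  fixes f :: "nat \<Rightarrow> mpol"
  assumes r: "r \<ge> 1"
    and f: "\<And>j m. j \<in> {1..<r} \<Longrightarrow> m \<in> Poly_Mapping.keys (f j) \<Longrightarrow> set_mset m \<subseteq> {1..r} \<and> odd (size m)"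
  obtains x where "(\<Sum>i\<in>{1..r}. (x i)\<^sup>2) = 1" "\<And>j. j \<in> {1..<r} \<Longrightarrow> peval x (f j) = 0"
proof -
  define M where "M = (\<Union>j\<in>{1..<r}. Poly_Mapping.keys (f j))"
  have "finite M" by (simp add: M_def)
  \<comment> \<open>Odd, and larger than the degree of every monomial that occurs.\<close>
  define e where "e = 2 * (\<Sum>m\<in>M. size m) + 1"
  have deg: "size m < e" if "j \<in> {1..<r}" "m \<in> Poly_Mapping.keys (f j)" for j m
    using member_le_sum[of m M size] \<open>finite M\<close> that by (fastforce simp: e_def M_def)
  have "\<exists>x. (\<Sum>i\<in>{1..r}. (x i)\<^sup>2) = 1 \<and> (\<forall>j\<in>{1..<r}. x j ^ e + real (Suc n) * peval x (f j) = 0)" for n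
  proof -
    have keys: "Poly_Mapping.keys (real (Suc n) *\<^sub>R f j) \<subseteq> Poly_Mapping.keys (f j)" for j
      by (auto simp: in_keys_iff lookup_scaleR)
    interpret odd_system r e "\<lambda>j. real (Suc n) *\<^sub>R f j"
    proof
      show "odd e" by (simp add: e_def)
      show "set_mset m \<subseteq> {1..r} \<and> odd (size m) \<and> size m < e"
        if "j \<in> {1..<r}" "m \<in> Poly_Mapping.keys (real (Suc n) *\<^sub>R f j)" for j m
        using f[of j m] deg[of j m] that keys by blast
    qed (rule r)
    show ?thesis using real_solution peval_scaleR by metis
  qed
  then obtain x where x1: "\<And>n. (\<Sum>i\<in>{1..r}. (x n i)\<^sup>2) = 1"
    and x2: "\<And>n j. j \<in> {1..<r} \<Longrightarrow> x n j ^ e + real (Suc n) * peval (x n) (f j) = 0"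
    by metis
  have bound: "\<bar>x n i\<bar> \<le> 1" if "i \<in> {1..r}" for n i
  proof -
    have "(x n i)\<^sup>2 \<le> (\<Sum>i\<in>{1..r}. (x n i)\<^sup>2)" using that by (intro member_le_sum) auto
    then show ?thesis using x1 by (simp add: abs_square_le_1)
  qed
  obtain s y where s: "strict_mono s" and lim: "\<And>i. i \<in> {1..r} \<Longrightarrow> (\<lambda>n. x (s n) i) \<longlonglongrightarrow> y i"
    using convergent_coordinates_subseq[of "{1..r}" x 1] bound by auto
  show thesis
  proof
    have "(\<lambda>n. \<Sum>i\<in>{1..r}. (x (s n) i)\<^sup>2) \<longlonglongrightarrow> (\<Sum>i\<in>{1..r}. (y i)\<^sup>2)"
      by (intro tendsto_sum tendsto_power lim)
    then have "(\<lambda>n. 1) \<longlonglongrightarrow> (\<Sum>i\<in>{1..r}. (y i)\<^sup>2)" by (simp only: x1)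
    then show "(\<Sum>i\<in>{1..r}. (y i)\<^sup>2) = 1" by (simp add: LIMSEQ_const_iff)
    fix j assume j: "j \<in> {1..<r}"
    have "(\<lambda>n. peval (x (s n)) (f j)) \<longlonglongrightarrow> peval y (f j)"
      using f[OF j] lim by (intro tendsto_peval) blast
    moreover have "(\<lambda>n. peval (x (s n)) (f j)) \<longlonglongrightarrow> 0"
    proof (rule LIMSEQ_subseq_LIMSEQ[OF _ s, of "\<lambda>n. peval (x n) (f j)" 0, unfolded o_def])
      \<comment> \<open>On the sphere \<open>x_j^e\<close> has absolute value at most 1, so the
        weight \<open>Suc n\<close> forces the value of \<open>f j\<close> to be at most its
        reciprocal.\<close>
      have "\<bar>peval (x n) (f j)\<bar> \<le> inverse (real (Suc n))" for n
      proof -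
        have "real (Suc n) * \<bar>peval (x n) (f j)\<bar> = \<bar>x n j\<bar> ^ e"
        proof -
          have "real (Suc n) * peval (x n) (f j) = - (x n j ^ e)"
            using x2[OF j, of n] by linarith
          from arg_cong[OF this, of abs] show ?thesis
            by (simp only: abs_mult abs_minus_cancel power_abs abs_of_nat)
        qed
        also have "\<dots> \<le> 1" using bound[of j n] j by (intro power_le_one) auto
        finally show ?thesis by (simp add: field_simps)
      qed
      then show "(\<lambda>n. peval (x n) (f j)) \<longlonglongrightarrow> 0"
        by (intro tendsto_rabs_zero_cancel[OF tendsto_sandwich[OF _ _ tendsto_const LIMSEQ_inverse_real_of_nat]])
          auto
    qed
    ultimately show "peval y (f j) = 0" using LIMSEQ_unique by blast
  qed
qed

section \<open>Polynomial algebras over a commutative ring\<close>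

context ring
begin

text \<open>Translates the inductive generation by constants, sums and products with a variable into
  properties of the coefficient function; most computations below are done coefficientwise.\<close>

lemma indexed_psetD:
  assumes "P \<in> indexed_pset I (carrier R)"
  shows "P m \<in> carrier R" "finite {m. P m \<noteq> \<zero>}" "P m \<noteq> \<zero> \<Longrightarrow> set_mset m \<subseteq> I"
proof -
  have "(\<forall>m. P m \<in> carrier R) \<and> finite {m. P m \<noteq> \<zero>} \<and> (\<forall>m. P m \<noteq> \<zero> \<longrightarrow> set_mset m \<subseteq> I)"
    using assms
  proof induction
    case (indexed_const k)
    have "{m. indexed_const k m \<noteq> \<zero>} \<subseteq> {{#}}" by (auto simp: indexed_const_def)
    then have "finite {m. indexed_const k m \<noteq> \<zero>}" using finite_subset by blast
    then show ?case using indexed_const by (auto simp: indexed_const_def)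
  next
    case (indexed_padd P Q)
    have "{m. indexed_padd P Q m \<noteq> \<zero>} \<subseteq> {m. P m \<noteq> \<zero>} \<union> {m. Q m \<noteq> \<zero>}"
      by (auto simp: indexed_padd_def)
    moreover have "finite ({m. P m \<noteq> \<zero>} \<union> {m. Q m \<noteq> \<zero>})" using indexed_padd by simp
    ultimately have "finite {m. indexed_padd P Q m \<noteq> \<zero>}" by (rule finite_subset)
    moreover have "set_mset m \<subseteq> I" if "indexed_padd P Q m \<noteq> \<zero>" for m
      using that indexed_padd by (cases "P m = \<zero>") (auto simp: indexed_padd_def)
    ultimately show ?case using indexed_padd by (simp add: indexed_padd_def)
  next
    case (indexed_pmult P i)
    have "{m. indexed_pmult P i m \<noteq> \<zero>} \<subseteq> add_mset i ` {m. P m \<noteq> \<zero>}"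
    proof
      fix m assume "m \<in> {m. indexed_pmult P i m \<noteq> \<zero>}"
      then have "i \<in># m" "P (m - {#i#}) \<noteq> \<zero>" by (auto simp: indexed_pmult_def split: if_splits)
      then show "m \<in> add_mset i ` {m. P m \<noteq> \<zero>}" by (intro image_eqI[of _ _ "m - {#i#}"]) auto
    qed
    moreover have "finite (add_mset i ` {m. P m \<noteq> \<zero>})" using indexed_pmult by simp
    ultimately have "finite {m. indexed_pmult P i m \<noteq> \<zero>}" by (rule finite_subset)
    moreover have "set_mset m \<subseteq> I" if "indexed_pmult P i m \<noteq> \<zero>" for m
    proof -
      have "i \<in># m" "P (m - {#i#}) \<noteq> \<zero>" using that by (auto simp: indexed_pmult_def split: if_splits)
      then have "set_mset (m - {#i#}) \<subseteq> I" using indexed_pmult by blast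
      then have "set_mset (add_mset i (m - {#i#})) \<subseteq> I" using indexed_pmult by simp
      then show ?thesis using \<open>i \<in># m\<close> by simp
    qed
    ultimately show ?case using indexed_pmult by (simp add: indexed_pmult_def)
  qed
  then show "P m \<in> carrier R" "finite {m. P m \<noteq> \<zero>}" "P m \<noteq> \<zero> \<Longrightarrow> set_mset m \<subseteq> I" by blast+
qed

text \<open>The convolution product of \<open>mpoly_algebra\<close>, detached from the record so
  that its laws can be stated over any ring.\<close>

definition mp_mult :: "('i multiset \<Rightarrow> 'a) \<Rightarrow> ('i multiset \<Rightarrow> 'a) \<Rightarrow> 'i multiset \<Rightarrow> 'a" where
  "mp_mult f g = (\<lambda>m. \<Oplus>k\<in>{k. k \<subseteq># m}. f k \<otimes> g (m - k))"

lemma finite_submultisets: "finite {k. k \<subseteq># m}"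
proof -
  have "{k. k \<subseteq># m} \<subseteq> (\<Union>n\<le>size m. multisets_of_size (set_mset m) n)"
    by (auto simp: multisets_of_size_def size_mset_mono dest: mset_subset_eqD)
  then show ?thesis by (rule finite_subset) auto
qed

text \<open>This and the next two facts describe how the right factor enters a product, one for each
  constructor of \<open>indexed_pset\<close>. Closure, associativity and the homomorphism property
  of evaluation are inductions on the right factor that use exactly these three.\<close>

lemma mp_mult_add:
  assumes "\<And>m. f m \<in> carrier R" "\<And>m. g m \<in> carrier R" "\<And>m. h m \<in> carrier R"
  shows "mp_mult f (indexed_padd g h) = indexed_padd (mp_mult f g) (mp_mult f h)"
  using assms by (intro ext) (simp add: mp_mult_def indexed_padd_def r_distr finsum_addf Pi_def)

lemma mp_mult_const:
  assumes "\<And>m. f m \<in> carrier R" "k \<in> carrier R"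
  shows "mp_mult f (indexed_const k) = (\<lambda>m. f m \<otimes> k)"
proof
  fix m
  have "mp_mult f (indexed_const k) m = (\<Oplus>l\<in>{l. l \<subseteq># m}. if m = l then f l \<otimes> k else \<zero>)"
    unfolding mp_mult_def using assms by (intro finsum_cong') (auto simp: indexed_const_def Diff_eq_empty_iff_mset subset_mset.antisym)
  also have "\<dots> = f m \<otimes> k"
    using assms finsum_singleton[of m "{l. l \<subseteq># m}" "\<lambda>l. f l \<otimes> k"] by (simp add: finite_submultisets)
  finally show "mp_mult f (indexed_const k) m = f m \<otimes> k" .
qed

lemma mp_mult_pmult:
  assumes "\<And>m. f m \<in> carrier R" "\<And>m. g m \<in> carrier R"
  shows "mp_mult f (indexed_pmult g i) = indexed_pmult (mp_mult f g) i"
proof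
  fix m
  show "mp_mult f (indexed_pmult g i) m = indexed_pmult (mp_mult f g) i m"
  proof (cases "i \<in># m")
    case True
    \<comment> \<open>The terms that survive in the convolution are those where the right part
      \<open>m - k\<close> still contains \<open>i\<close>; they correspond to the submultisets of
      \<open>m\<close> with one \<open>i\<close> removed.\<close>
    have sub: "k \<subseteq># m - {#i#} \<longleftrightarrow> k \<subseteq># m \<and> i \<in># m - k" for k
    proof
      assume k: "k \<subseteq># m - {#i#}"
      have "count k i \<le> count m i - 1" using mset_subset_eq_count[OF k, of i] by simp
      moreover have "0 < count m i" using True by simp
      ultimately have "i \<in># m - k" unfolding in_diff_count by linarith
      then show "k \<subseteq># m \<and> i \<in># m - k" using k subset_mset.order_trans diff_subset_eq_self by blast
    next
      assume k: "k \<subseteq># m \<and> i \<in># m - k"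
      then have "count k i < count m i" by (simp only: in_diff_count)
      moreover have "count k a \<le> count m a" for a using k by (simp add: mset_subset_eq_count)
      ultimately show "k \<subseteq># m - {#i#}" unfolding subseteq_mset_def by auto
    qed
    have "(\<Oplus>k\<in>{k. k \<subseteq># m - {#i#}}. f k \<otimes> g (m - {#i#} - k)) = mp_mult f (indexed_pmult g i) m"
      unfolding mp_mult_def
    proof (rule add.finprod_mono_neutral_cong_left)
      show "{k. k \<subseteq># m - {#i#}} \<subseteq> {k. k \<subseteq># m}" using sub by auto
      show "f k \<otimes> indexed_pmult g i (m - k) = \<zero>" if "k \<in> {k. k \<subseteq># m} - {k. k \<subseteq># m - {#i#}}" for k
        using that assms by (auto simp: sub indexed_pmult_def)
      show "f k \<otimes> g (m - {#i#} - k) = f k \<otimes> indexed_pmult g i (m - k)" if "k \<in> {k. k \<subseteq># m - {#i#}}" for k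
        using that by (simp add: sub indexed_pmult_def diff_diff_add_mset union_commute)
    qed (use assms finite_submultisets in \<open>auto simp: indexed_pmult_def\<close>)
    then show ?thesis using True by (simp add: indexed_pmult_def mp_mult_def)
  next
    case False
    then have "indexed_pmult g i (m - k) = \<zero>" for k by (auto simp: indexed_pmult_def dest: in_diffD)
    then have "mp_mult f (indexed_pmult g i) m = \<zero>"
      using assms by (simp add: mp_mult_def add.finprod_one_eqI)
    then show ?thesis using False by (simp add: indexed_pmult_def)
  qed
qed

lemma pset_closed_smult:
  fixes f :: "'i multiset \<Rightarrow> 'a"
  assumes "f \<in> indexed_pset I (carrier R)" "c \<in> carrier R"
  shows "(\<lambda>m. f m \<otimes> c) \<in> indexed_pset I (carrier R)"
  using assms(1)
proof induction
  case (indexed_const k)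
  have "(\<lambda>m::'i multiset. indexed_const k m \<otimes> c) = indexed_const (k \<otimes> c)"
    using assms(2) by (auto simp: indexed_const_def)
  moreover have "indexed_const (k \<otimes> c) \<in> indexed_pset I (carrier R)"
    by (rule indexed_pset.indexed_const) (use indexed_const assms(2) in simp)
  ultimately show ?case by (simp only:)
next
  case (indexed_padd P Q)
  have "(\<lambda>m. indexed_padd P Q m \<otimes> c) = indexed_padd (\<lambda>m. P m \<otimes> c) (\<lambda>m. Q m \<otimes> c)"
    using assms(2)
    by (intro ext) (simp add: indexed_padd_def l_distr indexed_psetD(1)[OF indexed_padd(1)] indexed_psetD(1)[OF indexed_padd(2)])
  then show ?case using indexed_pset.indexed_padd[OF indexed_padd(3,4)] by (simp only:)
next
  case (indexed_pmult P i)
  have "(\<lambda>m. indexed_pmult P i m \<otimes> c) = indexed_pmult (\<lambda>m. P m \<otimes> c) i"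
    using assms(2) by (intro ext) (simp add: indexed_pmult_def)
  then show ?case using indexed_pset.indexed_pmult[OF indexed_pmult(3,2)] by (simp only:)
qed

lemma pset_closed_mult:
  assumes f: "f \<in> indexed_pset I (carrier R)" and g: "g \<in> indexed_pset I (carrier R)"
  shows "mp_mult f g \<in> indexed_pset I (carrier R)"
  using g
proof induction
  case (indexed_const k)
  then show ?case
    using mp_mult_const[of f k] indexed_psetD(1)[OF f] pset_closed_smult[OF f] by simp
next
  case (indexed_padd P Q)
  then show ?case
    using mp_mult_add[of f P Q] indexed_psetD(1)[OF f] indexed_psetD(1)[OF indexed_padd(1)]
      indexed_psetD(1)[OF indexed_padd(2)] indexed_pset.indexed_padd by simp
next
  case (indexed_pmult P i)
  then show ?case
    using mp_mult_pmult[of f P i] indexed_psetD(1)[OF f] indexed_psetD(1)[OF indexed_pmult(1)]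
      indexed_pset.indexed_pmult by simp
qed

text \<open>Induction on the last factor reduces associativity to the case of a constant, where it
  is associativity of the coefficients.\<close>

lemma mp_mult_assoc:
  assumes f: "f \<in> indexed_pset I (carrier R)" and g: "g \<in> indexed_pset I (carrier R)"
    and h: "h \<in> indexed_pset I (carrier R)"
  shows "mp_mult (mp_mult f g) h = mp_mult f (mp_mult g h)"
proof -
  note F = indexed_psetD(1)[OF f] and G = indexed_psetD(1)[OF g]
  note FG = indexed_psetD(1)[OF pset_closed_mult[OF f g]]
  show ?thesis
    using h
  proof induction
    case (indexed_const k)
    have "mp_mult f g m \<otimes> k = mp_mult f (\<lambda>m. g m \<otimes> k) m" for m
      using F G indexed_const
      by (simp add: mp_mult_def finsum_ldistr finite_submultisets m_assoc Pi_def)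
    then show ?case
      using mp_mult_const[of "mp_mult f g" k] mp_mult_const[of g k] FG G indexed_const by simp
  next
    case (indexed_padd P Q)
    note PQ = indexed_psetD(1)[OF indexed_padd(1)] indexed_psetD(1)[OF indexed_padd(2)]
    note GP = indexed_psetD(1)[OF pset_closed_mult[OF g indexed_padd(1)]]
      indexed_psetD(1)[OF pset_closed_mult[OF g indexed_padd(2)]]
    show ?case
      using mp_mult_add[of "mp_mult f g" P Q] mp_mult_add[of g P Q]
        mp_mult_add[of f "mp_mult g P" "mp_mult g Q"] FG F G PQ GP indexed_padd by simp
  next
    case (indexed_pmult P i)
    note P = indexed_psetD(1)[OF indexed_pmult(1)]
    note GP = indexed_psetD(1)[OF pset_closed_mult[OF g indexed_pmult(1)]]
    show ?case
      using mp_mult_pmult[of "mp_mult f g" P i] mp_mult_pmult[of g P i]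
        mp_mult_pmult[of f "mp_mult g P" i] FG F G P GP indexed_pmult by simp
  qed
qed

end

text \<open>Complementation \<open>k \<mapsto> m - k\<close> is an involution on the submultisets of
  \<open>m\<close> and exchanges the two factors of each term.\<close>

lemma (in cring) mp_mult_comm:
  fixes f g :: "'i multiset \<Rightarrow> 'a"
  assumes "\<And>m. f m \<in> carrier R" "\<And>m. g m \<in> carrier R"
  shows "mp_mult f g = mp_mult g f"
proof
  fix m :: "'i multiset"
  have dd: "m - (m - k) = k" if "k \<subseteq># m" for k
    using that by (simp add: multiset_eq_iff subseteq_mset_def)
  have "inj_on (\<lambda>k. m - k) {k. k \<subseteq># m}"
    by (rule inj_on_inverseI[where g = "\<lambda>k. m - k"]) (simp add: dd)
  moreover have "(\<lambda>k. m - k) ` {k. k \<subseteq># m} = {k. k \<subseteq># m}"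
  proof
    show "{k. k \<subseteq># m} \<subseteq> (\<lambda>k. m - k) ` {k. k \<subseteq># m}"
    proof
      fix k assume "k \<in> {k. k \<subseteq># m}"
      then have "k = m - (m - k)" by (simp add: dd)
      then show "k \<in> (\<lambda>k. m - k) ` {k. k \<subseteq># m}" by (intro image_eqI[of _ _ "m - k"]) auto
    qed
  qed auto
  ultimately have "(\<Oplus>k\<in>{k. k \<subseteq># m}. f k \<otimes> g (m - k)) = (\<Oplus>k\<in>{k. k \<subseteq># m}. f (m - k) \<otimes> g (m - (m - k)))"
    using finsum_reindex[of "\<lambda>k. f k \<otimes> g (m - k)" "\<lambda>k. m - k" "{k. k \<subseteq># m}"] assms by auto
  also have "\<dots> = (\<Oplus>k\<in>{k. k \<subseteq># m}. g k \<otimes> f (m - k))"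
  proof (rule finsum_cong')
    fix k assume "k \<in> {k. k \<subseteq># m}"
    then have "m - (m - k) = k" by (simp add: dd)
    then show "f (m - k) \<otimes> g (m - (m - k)) = g k \<otimes> f (m - k)" using assms by (simp add: m_comm)
  qed (use assms in auto)
  finally show "mp_mult f g m = mp_mult g f m" by (simp add: mp_mult_def)
qed

context cring
begin

lemma mpoly_algebra_simps:
  "carrier (mpoly_algebra R I) = indexed_pset I (carrier R)"
  "f \<otimes>\<^bsub>mpoly_algebra R I\<^esub> g = mp_mult f g"
  "f \<oplus>\<^bsub>mpoly_algebra R I\<^esub> g = indexed_padd f g"
  "\<one>\<^bsub>mpoly_algebra R I\<^esub> = indexed_const \<one>"
  "\<zero>\<^bsub>mpoly_algebra R I\<^esub> = indexed_const \<zero>"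
  "a \<odot>\<^bsub>mpoly_algebra R I\<^esub> f = (\<lambda>m. a \<otimes> f m)"
  by (simp_all add: mpoly_algebra_def mp_mult_def)

lemma cring_mpoly_algebra:
  fixes I :: "'i set"
  shows "cring (mpoly_algebra R I)"
proof (rule cringI)
  show "abelian_group (mpoly_algebra R I)"
  proof (rule abelian_groupI; simp only: mpoly_algebra_simps)
    fix f assume f: "f \<in> indexed_pset I (carrier R)"
    \<comment> \<open>The additive inverse is written as multiplication by minus one, for which
      membership in \<open>indexed_pset\<close> has been shown.\<close>
    have "(\<lambda>m. f m \<otimes> (\<ominus> \<one>)) \<in> indexed_pset I (carrier R)"
      by (rule pset_closed_smult[OF f]) simp
    moreover have "indexed_padd (\<lambda>m. f m \<otimes> (\<ominus> \<one>)) f = indexed_const \<zero>"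
      using indexed_psetD(1)[OF f] by (auto simp: indexed_padd_def indexed_const_def r_minus l_neg)
    ultimately show "\<exists>g\<in>indexed_pset I (carrier R). indexed_padd g f = indexed_const \<zero>" by blast
  next
    fix f g assume fg: "f \<in> indexed_pset I (carrier R)" "g \<in> indexed_pset I (carrier R)"
    show "indexed_padd f g \<in> indexed_pset I (carrier R)" using fg by (rule indexed_pset.indexed_padd)
    note F = indexed_psetD(1)[OF fg(1)] and G = indexed_psetD(1)[OF fg(2)]
    show "indexed_padd f g = indexed_padd g f"
      by (intro ext) (simp add: indexed_padd_def a_comm F G)
    fix h :: "'i multiset \<Rightarrow> 'a" assume "h \<in> indexed_pset I (carrier R)"
    note H = indexed_psetD(1)[OF this]
    show "indexed_padd (indexed_padd f g) h = indexed_padd f (indexed_padd g h)"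
      by (intro ext) (simp add: indexed_padd_def a_assoc F G H)
  next
    show "indexed_const \<zero> \<in> indexed_pset I (carrier R)" by (rule indexed_pset.indexed_const) simp
    fix f assume "f \<in> indexed_pset I (carrier R)"
    note F = indexed_psetD(1)[OF this]
    show "indexed_padd (indexed_const \<zero>) f = f"
      by (intro ext) (simp add: indexed_padd_def indexed_const_def F)
  qed
  show "comm_monoid (mpoly_algebra R I)"
  proof (rule comm_monoidI; simp only: mpoly_algebra_simps)
    fix f g assume fg: "f \<in> indexed_pset I (carrier R)" "g \<in> indexed_pset I (carrier R)"
    show "mp_mult f g \<in> indexed_pset I (carrier R)" by (rule pset_closed_mult[OF fg])
    show "mp_mult f g = mp_mult g f" by (rule mp_mult_comm) (use fg indexed_psetD(1) in blast)+
  next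
    fix f assume f: "f \<in> indexed_pset I (carrier R)"
    have "mp_mult (indexed_const \<one>) f = mp_mult f (indexed_const \<one>)"
      by (rule mp_mult_comm) (use f indexed_psetD(1) in \<open>auto simp: indexed_const_def\<close>)
    also have "\<dots> = (\<lambda>m. f m \<otimes> \<one>)"
      by (rule mp_mult_const) (use f indexed_psetD(1) in auto)
    finally show "mp_mult (indexed_const \<one>) f = f"
      using f indexed_psetD(1) by fastforce
  qed (auto intro: mp_mult_assoc indexed_pset.indexed_const)
  fix f g h
  assume "f \<in> carrier (mpoly_algebra R I)" "g \<in> carrier (mpoly_algebra R I)" "h \<in> carrier (mpoly_algebra R I)"
  then have fgh: "f \<in> indexed_pset I (carrier R)" "g \<in> indexed_pset I (carrier R)" "h \<in> indexed_pset I (carrier R)"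
    by (simp_all only: mpoly_algebra_simps)
  note c = indexed_psetD(1)[OF fgh(1)] indexed_psetD(1)[OF fgh(2)] indexed_psetD(1)[OF fgh(3)]
  have "mp_mult (indexed_padd f g) h = mp_mult h (indexed_padd f g)"
    by (rule mp_mult_comm) (use c in \<open>auto simp: indexed_padd_def\<close>)
  also have "\<dots> = indexed_padd (mp_mult h f) (mp_mult h g)"
    by (rule mp_mult_add) (use c in auto)
  also have "mp_mult h f = mp_mult f h" by (rule mp_mult_comm) (use c in auto)
  also have "mp_mult h g = mp_mult g h" by (rule mp_mult_comm) (use c in auto)
  finally show "(f \<oplus>\<^bsub>mpoly_algebra R I\<^esub> g) \<otimes>\<^bsub>mpoly_algebra R I\<^esub> h =
      f \<otimes>\<^bsub>mpoly_algebra R I\<^esub> h \<oplus>\<^bsub>mpoly_algebra R I\<^esub> g \<otimes>\<^bsub>mpoly_algebra R I\<^esub> h"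
    by (simp only: mpoly_algebra_simps)
qed

end

section \<open>Evaluation of polynomials in an algebra\<close>

locale algebra_family = R: cring R + A: cring A + alg: algebra R A
  for R :: "('a, 'r) ring_scheme" and A :: "('a, 'b, 'm) module_scheme" (structure) +
  fixes I :: "'i set" and v :: "'i \<Rightarrow> 'b"
  assumes v: "i \<in> I \<Longrightarrow> v i \<in> carrier A"
begin

definition mval :: "'i multiset \<Rightarrow> 'b" where
  "mval m = (\<Otimes>i\<in>set_mset m. v i [^] count m i)"

lemma mval_closed: "set_mset m \<subseteq> I \<Longrightarrow> mval m \<in> carrier A"
  unfolding mval_def using v by (intro A.finprod_closed) auto

text \<open>The product runs over the distinct elements of the multiset, so a further
  \<open>i\<close> either raises an exponent or contributes a new factor. Splitting off the index
  \<open>i\<close> treats both cases alike, with exponent 0 if \<open>i\<close> was absent.\<close>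

lemma mval_add_mset:
  assumes "set_mset m \<subseteq> I" "i \<in> I"
  shows "mval (add_mset i m) = mval m \<otimes> v i"
proof -
  let ?P = "\<lambda>S. \<Otimes>j\<in>S. v j [^] count m j"
  have fin: "finite (set_mset m - {i})" by simp
  have cl: "(\<lambda>j. v j [^] count m j) \<in> S \<rightarrow> carrier A" if "S \<subseteq> I" for S using that v by auto
  have "mval (add_mset i m) = (\<Otimes>j\<in>insert i (set_mset m - {i}). v j [^] count (add_mset i m) j)"
    by (simp add: mval_def)
  also have "\<dots> = v i [^] Suc (count m i) \<otimes> (\<Otimes>j\<in>set_mset m - {i}. v j [^] count (add_mset i m) j)"
    using assms v by (subst A.finprod_insert) auto
  also have "(\<Otimes>j\<in>set_mset m - {i}. v j [^] count (add_mset i m) j) = ?P (set_mset m - {i})"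
    using assms v by (intro A.finprod_cong') auto
  also have "v i [^] Suc (count m i) \<otimes> ?P (set_mset m - {i})
      = (v i [^] count m i \<otimes> ?P (set_mset m - {i})) \<otimes> v i"
    using assms v cl[of "set_mset m - {i}"] A.finprod_closed[OF cl[of "set_mset m - {i}"]]
    by (simp add: A.m_ac subset_iff)
  also have "v i [^] count m i \<otimes> ?P (set_mset m - {i}) = ?P (insert i (set_mset m - {i}))"
    using assms v by (subst A.finprod_insert) auto
  also have "?P (insert i (set_mset m - {i})) = mval m"
  proof (cases "i \<in># m")
    case True
    then show ?thesis by (simp add: mval_def insert_absorb)
  next
    case False
    then have "count m i = 0" by (simp add: not_in_iff)
    have "?P (insert i (set_mset m - {i})) = v i [^] count m i \<otimes> ?P (set_mset m - {i})"
      using assms v by (subst A.finprod_insert) auto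
    then show ?thesis
      using False \<open>count m i = 0\<close> A.finprod_closed[OF cl[of "set_mset m"]] assms by (simp add: mval_def)
  qed
  finally show ?thesis .
qed

abbreviation ev :: "('i multiset \<Rightarrow> 'a) \<Rightarrow> 'b" where "ev \<equiv> mpoly_eval R A v"
abbreviation PR :: "('i multiset \<Rightarrow> 'a) set" where "PR \<equiv> ring.indexed_pset R I (carrier R)"

text \<open>Allows polynomials with different supports to be summed over one common set of
  monomials.\<close>

lemma ev_superset:
  assumes f: "\<And>m. f m \<in> carrier R" and M: "finite M" "{m. f m \<noteq> \<zero>\<^bsub>R\<^esub>} \<subseteq> M" "\<And>m. m \<in> M \<Longrightarrow> set_mset m \<subseteq> I"
  shows "ev f = (\<Oplus>m\<in>M. f m \<odot> mval m)"
  unfolding mpoly_eval_def mval_def[symmetric]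
  by (rule A.add.finprod_mono_neutral_cong_left[OF M(1,2)])
    (use M f mval_closed in \<open>auto simp: alg.smult_l_null\<close>)

lemma support: "f \<in> PR \<Longrightarrow> finite {m. f m \<noteq> \<zero>\<^bsub>R\<^esub>}" "f \<in> PR \<Longrightarrow> f m \<noteq> \<zero>\<^bsub>R\<^esub> \<Longrightarrow> set_mset m \<subseteq> I"
    "f \<in> PR \<Longrightarrow> f m \<in> carrier R"
  using R.indexed_psetD by blast+

lemma ev_closed: "f \<in> PR \<Longrightarrow> ev f \<in> carrier A"
  unfolding mpoly_eval_def mval_def[symmetric]
  by (intro A.finsum_closed) (use support mval_closed in \<open>auto intro!: alg.smult_closed\<close>)

lemma ev_const: assumes "k \<in> carrier R" shows "ev (R.indexed_const k) = k \<odot> \<one>"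
proof -
  have "ev (R.indexed_const k) = (\<Oplus>m\<in>{{#}}. R.indexed_const k m \<odot> mval m)"
    by (rule ev_superset) (use assms in \<open>auto simp: R.indexed_const_def\<close>)
  also have "\<dots> = k \<odot> \<one>"
    using assms by (simp add: R.indexed_const_def mval_def)
  finally show ?thesis .
qed

lemma ev_add: assumes "f \<in> PR" "g \<in> PR" shows "ev (R.indexed_padd f g) = ev f \<oplus> ev g"
proof -
  let ?M = "{m. f m \<noteq> \<zero>\<^bsub>R\<^esub>} \<union> {m. g m \<noteq> \<zero>\<^bsub>R\<^esub>}"
  have M: "finite ?M" "\<And>m. m \<in> ?M \<Longrightarrow> set_mset m \<subseteq> I" using support assms by auto
  have c: "f m \<in> carrier R" "g m \<in> carrier R" for m using support assms by auto
  have "ev (R.indexed_padd f g) = (\<Oplus>m\<in>?M. R.indexed_padd f g m \<odot> mval m)"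
    by (rule ev_superset) (use M c in \<open>auto simp: R.indexed_padd_def\<close>)
  also have "\<dots> = (\<Oplus>m\<in>?M. f m \<odot> mval m \<oplus> g m \<odot> mval m)"
    by (rule A.finsum_cong') (use M c mval_closed in \<open>auto simp: R.indexed_padd_def alg.smult_l_distr\<close>)
  also have "\<dots> = (\<Oplus>m\<in>?M. f m \<odot> mval m) \<oplus> (\<Oplus>m\<in>?M. g m \<odot> mval m)"
    by (rule A.finsum_addf) (use M c mval_closed in auto)
  also have "(\<Oplus>m\<in>?M. f m \<odot> mval m) = ev f"
    by (rule ev_superset[symmetric]) (use M c in auto)
  also have "(\<Oplus>m\<in>?M. g m \<odot> mval m) = ev g"
    by (rule ev_superset[symmetric]) (use M c in auto)
  finally show ?thesis .
qed

lemma ev_pmult: assumes "f \<in> PR" "i \<in> I" shows "ev (R.indexed_pmult f i) = ev f \<otimes> v i"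
proof -
  let ?M = "{m. f m \<noteq> \<zero>\<^bsub>R\<^esub>}"
  have M: "finite ?M" "\<And>m. m \<in> ?M \<Longrightarrow> set_mset m \<subseteq> I" using support assms by auto
  have c: "f m \<in> carrier R" for m using support assms by auto
  have shift: "set_mset m \<subseteq> I" if m: "m \<in> add_mset i ` ?M" for m
  proof -
    obtain l where "l \<in> ?M" "m = add_mset i l" using m by blast
    then show ?thesis using M(2)[of l] assms(2) by simp
  qed
  have "ev (R.indexed_pmult f i) = (\<Oplus>m\<in>add_mset i ` ?M. R.indexed_pmult f i m \<odot> mval m)"
  proof (rule ev_superset)
    show "{m. R.indexed_pmult f i m \<noteq> \<zero>\<^bsub>R\<^esub>} \<subseteq> add_mset i ` ?M"
    proof
      fix m assume "m \<in> {m. R.indexed_pmult f i m \<noteq> \<zero>\<^bsub>R\<^esub>}"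
      then have "i \<in># m" "f (m - {#i#}) \<noteq> \<zero>\<^bsub>R\<^esub>" by (auto simp: R.indexed_pmult_def split: if_splits)
      then show "m \<in> add_mset i ` ?M" by (intro image_eqI[of _ _ "m - {#i#}"]) auto
    qed
    show "set_mset m \<subseteq> I" if "m \<in> add_mset i ` ?M" for m using shift[OF that] .
  qed (use M c assms in \<open>auto simp: R.indexed_pmult_def\<close>)
  also have "\<dots> = (\<Oplus>m\<in>?M. R.indexed_pmult f i (add_mset i m) \<odot> mval (add_mset i m))"
  proof (rule A.finsum_reindex)
    show "(\<lambda>m. R.indexed_pmult f i m \<odot> mval m) \<in> add_mset i ` ?M \<rightarrow> carrier A"
    proof (rule Pi_I)
      fix m assume "m \<in> add_mset i ` ?M"
      then have "set_mset m \<subseteq> I" by (rule shift)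
      then show "R.indexed_pmult f i m \<odot> mval m \<in> carrier A"
        using c mval_closed by (auto simp: R.indexed_pmult_def)
    qed
  qed (simp add: inj_on_def)
  also have "\<dots> = (\<Oplus>m\<in>?M. (f m \<odot> mval m) \<otimes> v i)"
  proof (rule A.finsum_cong')
    fix m assume "m \<in> ?M"
    then have "set_mset m \<subseteq> I" using M by blast
    then show "R.indexed_pmult f i (add_mset i m) \<odot> mval (add_mset i m) = (f m \<odot> mval m) \<otimes> v i"
      using c mval_closed v assms(2) by (simp add: R.indexed_pmult_def mval_add_mset alg.smult_assoc2)
  qed (use M c mval_closed v assms(2) in auto)
  also have "\<dots> = (\<Oplus>m\<in>?M. f m \<odot> mval m) \<otimes> v i"
    by (rule A.finsum_ldistr[symmetric]) (use M c mval_closed v assms(2) in auto)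
  also have "(\<Oplus>m\<in>?M. f m \<odot> mval m) = ev f"
    by (rule ev_superset[symmetric]) (use M c in auto)
  finally show ?thesis .
qed

lemma ev_smult: assumes "f \<in> PR" "k \<in> carrier R" shows "ev (\<lambda>m. f m \<otimes>\<^bsub>R\<^esub> k) = ev f \<otimes> (k \<odot> \<one>)"
proof -
  let ?M = "{m. f m \<noteq> \<zero>\<^bsub>R\<^esub>}"
  have M: "finite ?M" "\<And>m. m \<in> ?M \<Longrightarrow> set_mset m \<subseteq> I" using support assms by auto
  have c: "f m \<in> carrier R" for m using support assms by auto
  have "ev (\<lambda>m. f m \<otimes>\<^bsub>R\<^esub> k) = (\<Oplus>m\<in>?M. (f m \<otimes>\<^bsub>R\<^esub> k) \<odot> mval m)"
    by (rule ev_superset) (use M c assms in auto)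
  also have "\<dots> = (\<Oplus>m\<in>?M. (f m \<odot> mval m) \<otimes> (k \<odot> \<one>))"
  proof (rule A.finsum_cong')
    fix m assume "m \<in> ?M"
    then have m: "mval m \<in> carrier A" using M mval_closed by blast
    have "(f m \<odot> mval m) \<otimes> (k \<odot> \<one>) = f m \<odot> (k \<odot> (mval m \<otimes> \<one>))"
      using m c assms(2) by (simp add: alg.smult_assoc2 A.m_comm[of "mval m"])
    then show "(f m \<otimes>\<^bsub>R\<^esub> k) \<odot> mval m = (f m \<odot> mval m) \<otimes> (k \<odot> \<one>)"
      using m c assms(2) by (simp add: alg.smult_assoc1)
  qed (use M c mval_closed assms(2) in auto)
  also have "\<dots> = (\<Oplus>m\<in>?M. f m \<odot> mval m) \<otimes> (k \<odot> \<one>)"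
    by (rule A.finsum_ldistr[symmetric]) (use M c mval_closed v assms(2) in auto)
  also have "(\<Oplus>m\<in>?M. f m \<odot> mval m) = ev f"
    by (rule ev_superset[symmetric]) (use M c in auto)
  finally show ?thesis .
qed

text \<open>Induction on the right factor: a constant acts as a scalar, a variable as multiplication
  by its value.\<close>

lemma ev_mult: assumes f: "f \<in> PR" and g: "g \<in> PR" shows "ev (R.mp_mult f g) = ev f \<otimes> ev g"
  using g
proof (induction rule: R.indexed_pset.induct)
  case (indexed_const k)
  have "R.mp_mult f (R.indexed_const k) = (\<lambda>m. f m \<otimes>\<^bsub>R\<^esub> k)"
    by (rule R.mp_mult_const) (use support[OF f] indexed_const in auto)
  then show ?case using ev_smult[OF f indexed_const] ev_const[OF indexed_const] by (simp only:)
next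
  case (indexed_padd P Q)
  have "R.mp_mult f (R.indexed_padd P Q) = R.indexed_padd (R.mp_mult f P) (R.mp_mult f Q)"
    by (rule R.mp_mult_add) (use support(3) f indexed_padd in blast)+
  then show ?case
    using indexed_padd ev_add ev_closed R.pset_closed_mult[OF f] f by (simp add: A.r_distr)
next
  case (indexed_pmult P i)
  have "R.mp_mult f (R.indexed_pmult P i) = R.indexed_pmult (R.mp_mult f P) i"
    by (rule R.mp_mult_pmult) (use support(3) f indexed_pmult in blast)+
  then show ?case
    using indexed_pmult ev_pmult ev_closed R.pset_closed_mult[OF f] f v by (simp add: A.m_assoc)
qed

lemma ring_hom_mpoly_eval: "ring_hom_cring (mpoly_algebra R I) A ev"
proof (intro ring_hom_cring.intro ring_hom_cring_axioms.intro R.cring_mpoly_algebra A.is_cring ring_hom_memI)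
qed (auto simp: R.mpoly_algebra_simps ev_closed ev_add ev_mult ev_const)

lemma ev_var: "i \<in> I \<Longrightarrow> ev (R.indexed_var i) = v i"
  unfolding R.indexed_var_def
  using ev_pmult[of "R.indexed_const \<one>\<^bsub>R\<^esub>" i] ev_const[of "\<one>\<^bsub>R\<^esub>"] R.indexed_pset.indexed_const[of "\<one>\<^bsub>R\<^esub>" "carrier R" I] v
  by simp

end

section \<open>Tensor products\<close>

text \<open>The homomorphism on the free abelian group that extends \<open>w\<close>, with values in
  the additive group of \<open>G\<close>. The expression inside \<open>tensor_multiplication\<close>
  is the instance where \<open>w\<close> multiplies the two components.\<close>

definition frag_eval :: "('g, 'h) ring_scheme \<Rightarrow> ('p \<Rightarrow> 'g) \<Rightarrow> ('p \<Rightarrow>\<^sub>0 int) \<Rightarrow> 'g" where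
  "frag_eval G w c = (\<Oplus>\<^bsub>G\<^esub>p\<in>Poly_Mapping.keys c. [Poly_Mapping.lookup c p] \<cdot>\<^bsub>G\<^esub> w p)"

context abelian_group
begin

lemma add_pow_int_0: "[(0::int)] \<cdot> x = \<zero>"
  by (simp add: add_pow_def)

lemma add_pow_int_add: "x \<in> carrier G \<Longrightarrow> [(i + j :: int)] \<cdot> x = [i] \<cdot> x \<oplus> [j] \<cdot> x"
  using group.int_pow_mult[OF a_group, of x i j] by (simp add: add_pow_def)

text \<open>The set \<open>S\<close> on which \<open>w\<close> has values in the carrier is kept
  explicit because \<open>w\<close> is a total function with arbitrary values elsewhere.\<close>

lemma frag_eval_superset:
  assumes "w \<in> S \<rightarrow> carrier G" "finite S" "Poly_Mapping.keys c \<subseteq> S"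
  shows "frag_eval G w c = (\<Oplus>p\<in>S. [Poly_Mapping.lookup c p] \<cdot> w p)"
  unfolding frag_eval_def
proof (rule add.finprod_mono_neutral_cong_left[OF assms(2,3)])
  show "[Poly_Mapping.lookup c p] \<cdot> w p = \<zero>" if "p \<in> S - Poly_Mapping.keys c" for p
    using that by (simp add: in_keys_iff add_pow_int_0)
qed (use assms in auto)

lemma frag_eval_closed:
  assumes "w \<in> S \<rightarrow> carrier G" "Poly_Mapping.keys c \<subseteq> S"
  shows "frag_eval G w c \<in> carrier G"
  unfolding frag_eval_def using assms by (intro finsum_closed) auto

lemma frag_eval_of: "w p \<in> carrier G \<Longrightarrow> frag_eval G w (frag_of p) = w p"
  by (simp add: frag_eval_def)

lemma frag_eval_zero: "frag_eval G w 0 = \<zero>"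
  by (simp add: frag_eval_def)

lemma frag_eval_add:
  assumes w: "w \<in> S \<rightarrow> carrier G" and "Poly_Mapping.keys a \<subseteq> S" "Poly_Mapping.keys b \<subseteq> S"
  shows "frag_eval G w (a + b) = frag_eval G w a \<oplus> frag_eval G w b"
proof -
  let ?S = "Poly_Mapping.keys a \<union> Poly_Mapping.keys b"
  have S: "w \<in> ?S \<rightarrow> carrier G" "finite ?S" using assms by auto
  have "frag_eval G w (a + b) = (\<Oplus>p\<in>?S. [Poly_Mapping.lookup (a + b) p] \<cdot> w p)"
    by (rule frag_eval_superset[OF S]) (rule keys_add)
  also have "\<dots> = (\<Oplus>p\<in>?S. [Poly_Mapping.lookup a p] \<cdot> w p \<oplus> [Poly_Mapping.lookup b p] \<cdot> w p)"
    using S by (intro finsum_cong') (auto simp: lookup_add intro!: add_pow_int_add)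
  also have "\<dots> = (\<Oplus>p\<in>?S. [Poly_Mapping.lookup a p] \<cdot> w p) \<oplus> (\<Oplus>p\<in>?S. [Poly_Mapping.lookup b p] \<cdot> w p)"
    using S by (intro finsum_addf) auto
  finally show ?thesis using frag_eval_superset[OF S] by simp
qed

lemma frag_eval_diff:
  assumes w: "w \<in> S \<rightarrow> carrier G" and a: "Poly_Mapping.keys a \<subseteq> S" and b: "Poly_Mapping.keys b \<subseteq> S"
  shows "frag_eval G w (a - b) = frag_eval G w a \<ominus> frag_eval G w b"
proof -
  have "Poly_Mapping.keys (a - b) \<subseteq> S" using keys_diff[of a b] a b by blast
  then have "frag_eval G w a = frag_eval G w (a - b) \<oplus> frag_eval G w b"
    using frag_eval_add[OF w _ b, of "a - b"] by simp
  then show ?thesis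
    using frag_eval_closed[OF w] a b \<open>Poly_Mapping.keys (a - b) \<subseteq> S\<close>
    by (simp add: a_minus_def a_assoc r_neg)
qed

end

lemma module_homsD:
  assumes "f \<in> module_homs R M N"
  shows "x \<in> carrier M \<Longrightarrow> f x \<in> carrier N"
    "x \<in> carrier M \<Longrightarrow> y \<in> carrier M \<Longrightarrow> f (x \<oplus>\<^bsub>M\<^esub> y) = f x \<oplus>\<^bsub>N\<^esub> f y"
    "a \<in> carrier R \<Longrightarrow> x \<in> carrier M \<Longrightarrow> f (a \<odot>\<^bsub>M\<^esub> x) = a \<odot>\<^bsub>N\<^esub> f x"
  using assms by (auto simp: module_homs_def)

section \<open>Calculation modulo the bilinearity relations\<close>

locale two_modules = M: module R M + N: module R N
  for R :: "('a, 'r) ring_scheme" and M :: "('a, 'b, 'm) module_scheme" and N :: "('a, 'c, 'n) module_scheme"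
begin

abbreviation "F \<equiv> free_Abelian_group (carrier M \<times> carrier N)"
abbreviation "rel \<equiv> tensor_relations R M N"
abbreviation (input) "gens \<equiv>
     {frag_of (x \<oplus>\<^bsub>M\<^esub> x', y) - frag_of (x, y) - frag_of (x', y) |x x' y.
         x \<in> carrier M \<and> x' \<in> carrier M \<and> y \<in> carrier N} \<union>
      {frag_of (x, y \<oplus>\<^bsub>N\<^esub> y') - frag_of (x, y) - frag_of (x, y') |x y y'.
         x \<in> carrier M \<and> y \<in> carrier N \<and> y' \<in> carrier N} \<union>
      {frag_of (a \<odot>\<^bsub>M\<^esub> x, y) - frag_of (x, a \<odot>\<^bsub>N\<^esub> y) |a x y.
         a \<in> carrier R \<and> x \<in> carrier M \<and> y \<in> carrier N}"

lemma rel_subgroup: "subgroup rel F"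
  unfolding tensor_relations_def
proof (rule group.generate_is_subgroup[OF group_free_Abelian_group])
  have *: "Poly_Mapping.keys (frag_of p - frag_of q) \<subseteq> S"
    if "p \<in> S" "q \<in> S" for p q :: "'b \<times> 'c" and S
    using that keys_diff[of "frag_of p" "frag_of q"] by auto
  have **: "Poly_Mapping.keys (frag_of p - frag_of q - frag_of q') \<subseteq> S"
    if "p \<in> S" "q \<in> S" "q' \<in> S" for p q q' :: "'b \<times> 'c" and S
    using that keys_diff[of "frag_of p - frag_of q" "frag_of q'"] keys_diff[of "frag_of p" "frag_of q"] by auto
  show "gens \<subseteq> carrier F"
    by (intro Un_least subsetI; elim CollectE exE conjE; hypsubst; unfold carrier_free_Abelian_group_iff;
        (rule ** | rule *); simp)
qed

lemma rel_keys: "r \<in> rel \<Longrightarrow> Poly_Mapping.keys r \<subseteq> carrier M \<times> carrier N"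
  using subgroup.subset[OF rel_subgroup] by fastforce

lemma rel_zero: "0 \<in> rel"
  using subgroup.one_closed[OF rel_subgroup] by simp

lemma rel_add: "a \<in> rel \<Longrightarrow> b \<in> rel \<Longrightarrow> a + b \<in> rel"
  using subgroup.m_closed[OF rel_subgroup] by simp

lemma rel_uminus: "a \<in> rel \<Longrightarrow> - a \<in> rel"
  using subgroup.m_inv_closed[OF rel_subgroup] rel_keys by fastforce

lemma rel_diff: "a \<in> rel \<Longrightarrow> b \<in> rel \<Longrightarrow> a - b \<in> rel"
  using rel_add[OF _ rel_uminus, of a b] by simp

text \<open>Membership of a difference in \<open>rel\<close> is treated as a congruence between
  representatives; identities in the tensor product are proved as chains of such
  congruences.\<close>

lemma rel_trans: "a - b \<in> rel \<Longrightarrow> b - c \<in> rel \<Longrightarrow> a - c \<in> rel"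
  using rel_add[of "a - b" "b - c"] by simp

lemma rel_sym: "a - b \<in> rel \<Longrightarrow> b - a \<in> rel"
  using rel_uminus[of "a - b"] by simp

lemma rel_sum: "(\<And>i. i \<in> I \<Longrightarrow> f i \<in> rel) \<Longrightarrow> sum f I \<in> rel"
  by (induction I rule: infinite_finite_induct) (auto intro: rel_zero rel_add)

lemma rel_sum_diff: "(\<And>i. i \<in> I \<Longrightarrow> f i - g i \<in> rel) \<Longrightarrow> sum f I - sum g I \<in> rel"
  unfolding sum_subtractf[symmetric] by (rule rel_sum)

lemma rel_left: "x \<in> carrier M \<Longrightarrow> x' \<in> carrier M \<Longrightarrow> y \<in> carrier N \<Longrightarrow>
    frag_of (x \<oplus>\<^bsub>M\<^esub> x', y) - (frag_of (x, y) + frag_of (x', y)) \<in> rel"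
  unfolding tensor_relations_def diff_diff_eq[symmetric] by (rule generate.incl) blast

lemma rel_right: "x \<in> carrier M \<Longrightarrow> y \<in> carrier N \<Longrightarrow> y' \<in> carrier N \<Longrightarrow>
    frag_of (x, y \<oplus>\<^bsub>N\<^esub> y') - (frag_of (x, y) + frag_of (x, y')) \<in> rel"
  unfolding tensor_relations_def diff_diff_eq[symmetric] by (rule generate.incl) blast

lemma rel_smult: "a \<in> carrier R \<Longrightarrow> x \<in> carrier M \<Longrightarrow> y \<in> carrier N \<Longrightarrow>
    frag_of (a \<odot>\<^bsub>M\<^esub> x, y) - frag_of (x, a \<odot>\<^bsub>N\<^esub> y) \<in> rel"
  unfolding tensor_relations_def by (rule generate.incl) blast

text \<open>Additivity applied to zero plus zero leaves minus the pure tensor.\<close>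

lemma rel_zero_left: "y \<in> carrier N \<Longrightarrow> frag_of (\<zero>\<^bsub>M\<^esub>, y) \<in> rel"
  using rel_uminus[OF rel_left[of "\<zero>\<^bsub>M\<^esub>" "\<zero>\<^bsub>M\<^esub>" y]] by simp

lemma rel_zero_right: "x \<in> carrier M \<Longrightarrow> frag_of (x, \<zero>\<^bsub>N\<^esub>) \<in> rel"
  using rel_uminus[OF rel_right[of x "\<zero>\<^bsub>N\<^esub>" "\<zero>\<^bsub>N\<^esub>"]] by simp

lemma rel_finsum_left:
  assumes "finite I" "\<And>i. i \<in> I \<Longrightarrow> f i \<in> carrier M" "y \<in> carrier N"
  shows "frag_of (\<Oplus>\<^bsub>M\<^esub>i\<in>I. f i, y) - (\<Sum>i\<in>I. frag_of (f i, y)) \<in> rel"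
  using assms(1,2)
proof (induction I)
  case empty
  then show ?case using rel_zero_left assms(3) by simp
next
  case (insert i I)
  then have cl: "f i \<in> carrier M" "(\<Oplus>\<^bsub>M\<^esub>i\<in>I. f i) \<in> carrier M"
    by (auto intro: M.M.finsum_closed)
  then have "(\<Oplus>\<^bsub>M\<^esub>i\<in>insert i I. f i) = f i \<oplus>\<^bsub>M\<^esub> (\<Oplus>\<^bsub>M\<^esub>i\<in>I. f i)"
    using insert by (intro M.M.finsum_insert) auto
  moreover have "frag_of (f i \<oplus>\<^bsub>M\<^esub> (\<Oplus>\<^bsub>M\<^esub>i\<in>I. f i), y) - (frag_of (f i, y) + frag_of (\<Oplus>\<^bsub>M\<^esub>i\<in>I. f i, y)) \<in> rel"
    using rel_left cl assms(3) by blast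
  moreover have "frag_of (\<Oplus>\<^bsub>M\<^esub>i\<in>I. f i, y) - (\<Sum>i\<in>I. frag_of (f i, y)) \<in> rel" using insert by auto
  ultimately show ?case
    using insert rel_add by (fastforce simp: algebra_simps)
qed

lemma rel_finsum_right:
  assumes "finite I" "\<And>i. i \<in> I \<Longrightarrow> f i \<in> carrier N" "x \<in> carrier M"
  shows "frag_of (x, \<Oplus>\<^bsub>N\<^esub>i\<in>I. f i) - (\<Sum>i\<in>I. frag_of (x, f i)) \<in> rel"
  using assms(1,2)
proof (induction I)
  case empty
  then show ?case using rel_zero_right assms(3) by simp
next
  case (insert i I)
  then have cl: "f i \<in> carrier N" "(\<Oplus>\<^bsub>N\<^esub>i\<in>I. f i) \<in> carrier N"
    by (auto intro: N.M.finsum_closed)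
  then have "(\<Oplus>\<^bsub>N\<^esub>i\<in>insert i I. f i) = f i \<oplus>\<^bsub>N\<^esub> (\<Oplus>\<^bsub>N\<^esub>i\<in>I. f i)"
    using insert by (intro N.M.finsum_insert) auto
  moreover have "frag_of (x, f i \<oplus>\<^bsub>N\<^esub> (\<Oplus>\<^bsub>N\<^esub>i\<in>I. f i)) - (frag_of (x, f i) + frag_of (x, \<Oplus>\<^bsub>N\<^esub>i\<in>I. f i)) \<in> rel"
    using rel_right cl assms(3) by blast
  moreover have "frag_of (x, \<Oplus>\<^bsub>N\<^esub>i\<in>I. f i) - (\<Sum>i\<in>I. frag_of (x, f i)) \<in> rel" using insert by auto
  ultimately show ?case
    using insert rel_add by (fastforce simp: algebra_simps)
qed

lemma coset_iff: "b \<in> rel #>\<^bsub>F\<^esub> a \<longleftrightarrow> b - a \<in> rel"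
  by (auto simp: r_coset_def intro: bexI[of _ "b - a"])

lemma coset_eq_iff: "rel #>\<^bsub>F\<^esub> a = rel #>\<^bsub>F\<^esub> b \<longleftrightarrow> a - b \<in> rel"
proof
  assume "rel #>\<^bsub>F\<^esub> a = rel #>\<^bsub>F\<^esub> b"
  then show "a - b \<in> rel" using coset_iff[of a a] coset_iff[of a b] rel_zero by simp
next
  assume "a - b \<in> rel"
  then show "rel #>\<^bsub>F\<^esub> a = rel #>\<^bsub>F\<^esub> b"
    using rel_trans[of _ a b] rel_trans[of _ b a] rel_sym[of a b] by (auto simp: coset_iff)
qed

lemma carrier_tensor_product: "carrier (tensor_product R M N) = {rel #>\<^bsub>F\<^esub> c |c. c \<in> carrier F}"
  by (auto simp: tensor_product_def FactGroup_def RCOSETS_def)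

lemma mult_tensor_product:
  assumes "a \<in> carrier F" "b \<in> carrier F"
  shows "(rel #>\<^bsub>F\<^esub> a) \<otimes>\<^bsub>tensor_product R M N\<^esub> (rel #>\<^bsub>F\<^esub> b) = rel #>\<^bsub>F\<^esub> (a + b)"
proof -
  have "normal rel F"
    using comm_group.normal_iff_subgroup[OF abelian_free_Abelian_group] rel_subgroup by blast
  from normal.rcos_sum[OF this assms] show ?thesis
    by (simp add: tensor_product_def FactGroup_def)
qed

text \<open>The universal property in the form used below: a biadditive map that lets scalars pass
  from one argument to the other kills every generating relation, so its extension is constant on
  cosets. The target is any abelian group, which covers both the coordinate maps and the
  multiplication of \<open>A\<close>.\<close>

lemma bilinear_eval_rel:
  fixes G :: "('g, 'h) ring_scheme"
  assumes G: "abelian_group G"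
    and w: "\<And>x y. x \<in> carrier M \<Longrightarrow> y \<in> carrier N \<Longrightarrow> w (x, y) \<in> carrier G"
    and wl: "\<And>x x' y. x \<in> carrier M \<Longrightarrow> x' \<in> carrier M \<Longrightarrow> y \<in> carrier N \<Longrightarrow>
      w (x \<oplus>\<^bsub>M\<^esub> x', y) = w (x, y) \<oplus>\<^bsub>G\<^esub> w (x', y)"
    and wr: "\<And>x y y'. x \<in> carrier M \<Longrightarrow> y \<in> carrier N \<Longrightarrow> y' \<in> carrier N \<Longrightarrow>
      w (x, y \<oplus>\<^bsub>N\<^esub> y') = w (x, y) \<oplus>\<^bsub>G\<^esub> w (x, y')"
    and ws: "\<And>a x y. a \<in> carrier R \<Longrightarrow> x \<in> carrier M \<Longrightarrow> y \<in> carrier N \<Longrightarrow>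
      w (a \<odot>\<^bsub>M\<^esub> x, y) = w (x, a \<odot>\<^bsub>N\<^esub> y)"
    and r: "r \<in> rel"
  shows "frag_eval G w r = \<zero>\<^bsub>G\<^esub>"
proof -
  interpret G: abelian_group G by (rule G)
  have W: "w \<in> carrier M \<times> carrier N \<rightarrow> carrier G" using w by auto
  have diff: "frag_eval G w (frag_of p - c) = w p \<ominus>\<^bsub>G\<^esub> frag_eval G w c"
    if "p \<in> carrier M \<times> carrier N" "Poly_Mapping.keys c \<subseteq> carrier M \<times> carrier N" for p c
    using G.frag_eval_diff[OF W, of "frag_of p" c] that w by (auto simp: G.frag_eval_of)
  have add: "frag_eval G w (frag_of p + frag_of q) = w p \<oplus>\<^bsub>G\<^esub> w q"
    if "p \<in> carrier M \<times> carrier N" "q \<in> carrier M \<times> carrier N" for p q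
    using G.frag_eval_add[OF W, of "frag_of p" "frag_of q"] that w by (auto simp: G.frag_eval_of)
  have kadd: "Poly_Mapping.keys (frag_of p + frag_of q) \<subseteq> carrier M \<times> carrier N"
    if "p \<in> carrier M \<times> carrier N" "q \<in> carrier M \<times> carrier N" for p q
    using that keys_add[of "frag_of p" "frag_of q"] by auto
  have eval_gens: "frag_eval G w c = \<zero>\<^bsub>G\<^esub>" if "c \<in> gens" for c
    using that
  proof (elim UnE CollectE exE conjE; hypsubst)
    fix x x' y assume *: "x \<in> carrier M" "x' \<in> carrier M" "y \<in> carrier N"
    then show "frag_eval G w (frag_of (x \<oplus>\<^bsub>M\<^esub> x', y) - frag_of (x, y) - frag_of (x', y)) = \<zero>\<^bsub>G\<^esub>"
      unfolding diff_diff_eq by (subst diff) (auto simp: kadd add wl w G.r_neg a_minus_def)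
  next
    fix x y y' assume *: "x \<in> carrier M" "y \<in> carrier N" "y' \<in> carrier N"
    then show "frag_eval G w (frag_of (x, y \<oplus>\<^bsub>N\<^esub> y') - frag_of (x, y) - frag_of (x, y')) = \<zero>\<^bsub>G\<^esub>"
      unfolding diff_diff_eq by (subst diff) (auto simp: kadd add wr w G.r_neg a_minus_def)
  next
    fix a x y assume *: "a \<in> carrier R" "x \<in> carrier M" "y \<in> carrier N"
    then show "frag_eval G w (frag_of (a \<odot>\<^bsub>M\<^esub> x, y) - frag_of (x, a \<odot>\<^bsub>N\<^esub> y)) = \<zero>\<^bsub>G\<^esub>"
      by (subst diff) (auto simp: ws w G.frag_eval_of G.r_neg a_minus_def)
  qed
  have keys: "Poly_Mapping.keys c \<subseteq> carrier M \<times> carrier N" if "c \<in> gens" for c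
  proof -
    have "c \<in> rel" using that unfolding tensor_relations_def by (rule generate.incl)
    then show ?thesis by (rule rel_keys)
  qed
  have "Poly_Mapping.keys r \<subseteq> carrier M \<times> carrier N \<and> frag_eval G w r = \<zero>\<^bsub>G\<^esub>"
    using r unfolding tensor_relations_def
  proof (induction rule: generate.induct)
    case one
    then show ?case by (simp add: G.frag_eval_zero)
  next
    case (incl c)
    show ?case using keys[OF incl] eval_gens[OF incl] by simp
  next
    case (inv c)
    have "frag_eval G w (0 - c) = \<zero>\<^bsub>G\<^esub>"
      using G.frag_eval_diff[OF W, of 0 c] keys[OF inv] eval_gens[OF inv] by (simp add: G.frag_eval_zero a_minus_def)
    then show ?case using keys[OF inv] by simp
  next
    case (eng a b)
    then show ?case
      using G.frag_eval_add[OF W, of a b] keys_add[of a b] by auto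
  qed
  then show ?thesis by simp
qed

end

section \<open>Algebras with a dual basis for a trace\<close>

lemma module_homs_zero:
  assumes "module R M" "module R N" and f: "f \<in> module_homs R M N"
  shows "f \<zero>\<^bsub>M\<^esub> = \<zero>\<^bsub>N\<^esub>"
proof -
  interpret M: module R M by fact
  interpret N: module R N by fact
  show ?thesis
    using module_homsD(2)[OF f, of "\<zero>\<^bsub>M\<^esub>" "\<zero>\<^bsub>M\<^esub>"] module_homsD(1)[OF f, of "\<zero>\<^bsub>M\<^esub>"] N.M.add.r_cancel_one'
    by force
qed

lemma module_homs_finsum:
  assumes "module R M" "module R N" and f: "f \<in> module_homs R M N"
    and "finite I" "\<And>i. i \<in> I \<Longrightarrow> g i \<in> carrier M"
  shows "f (\<Oplus>\<^bsub>M\<^esub>i\<in>I. g i) = (\<Oplus>\<^bsub>N\<^esub>i\<in>I. f (g i))"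
proof -
  interpret M: module R M by fact
  interpret N: module R N by fact
  note z = module_homs_zero[OF assms(1-3)]
  show ?thesis
    using assms(4,5)
  proof (induction I)
    case (insert i I)
    have "f (\<Oplus>\<^bsub>M\<^esub>j\<in>insert i I. g j) = f (g i \<oplus>\<^bsub>M\<^esub> (\<Oplus>\<^bsub>M\<^esub>j\<in>I. g j))"
      using insert by (subst M.M.finsum_insert) auto
    also have "\<dots> = f (g i) \<oplus>\<^bsub>N\<^esub> f (\<Oplus>\<^bsub>M\<^esub>j\<in>I. g j)"
      using insert by (intro module_homsD(2)[OF f] M.M.finsum_closed) auto
    also have "\<dots> = (\<Oplus>\<^bsub>N\<^esub>j\<in>insert i I. f (g j))"
      using insert module_homsD(1)[OF f] by (subst N.M.finsum_insert) auto
    finally show ?case .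
  qed (simp add: z)
qed

text \<open>The extension \<open>ext\<close> sends generating relations to relations, so
  representatives of one coset have images in one coset, and the union in the definition of
  \<open>tensor_map\<close> collapses to it.\<close>

lemma tensor_map_coset:
  fixes R :: "('a, 'r) ring_scheme"
  assumes M: "module R M" and N: "module R N" and M': "module R M'" and N': "module R N'"
    and f: "f \<in> module_homs R M M'" and g: "g \<in> module_homs R N N'"
    and c: "c \<in> carrier (free_Abelian_group (carrier M \<times> carrier N))"
  defines "ext \<equiv> frag_extend (\<lambda>(x, y). frag_of (f x, g y))"
  shows "tensor_map R M' N' f g (tensor_relations R M N #>\<^bsub>free_Abelian_group (carrier M \<times> carrier N)\<^esub> c)
      = tensor_relations R M' N' #>\<^bsub>free_Abelian_group (carrier M' \<times> carrier N')\<^esub> ext c"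
    and "Poly_Mapping.keys (ext c) \<subseteq> carrier M' \<times> carrier N'"
proof -
  interpret S: two_modules R M N using M N by (rule two_modules.intro)
  interpret T: two_modules R M' N' using M' N' by (rule two_modules.intro)
  note F = module_homsD[OF f] and G = module_homsD[OF g]
  have ext_keys: "Poly_Mapping.keys (ext c) \<subseteq> carrier M' \<times> carrier N'"
    if "Poly_Mapping.keys c \<subseteq> carrier M \<times> carrier N" for c
  proof -
    have "Poly_Mapping.keys (ext c) \<subseteq> (\<Union>x\<in>Poly_Mapping.keys c. Poly_Mapping.keys (case x of (x, y) \<Rightarrow> frag_of (f x, g y)))"
      unfolding ext_def by (rule keys_frag_extend)
    also have "\<dots> \<subseteq> carrier M' \<times> carrier N'" using that F(1) G(1) by auto
    finally show ?thesis .
  qed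
  show "Poly_Mapping.keys (ext c) \<subseteq> carrier M' \<times> carrier N'" using c by (intro ext_keys) simp
  have ext_gens: "ext c \<in> T.rel" if "c \<in> S.gens" for c
    using that
  proof (elim UnE CollectE exE conjE; hypsubst)
    fix x x' y assume "x \<in> carrier M" "x' \<in> carrier M" "y \<in> carrier N"
    then show "ext (frag_of (x \<oplus>\<^bsub>M\<^esub> x', y) - frag_of (x, y) - frag_of (x', y)) \<in> T.rel"
      using T.rel_left F G by (simp add: ext_def frag_extend_diff frag_extend_add diff_diff_eq)
  next
    fix x y y' assume "x \<in> carrier M" "y \<in> carrier N" "y' \<in> carrier N"
    then show "ext (frag_of (x, y \<oplus>\<^bsub>N\<^esub> y') - frag_of (x, y) - frag_of (x, y')) \<in> T.rel"
      using T.rel_right F G by (simp add: ext_def frag_extend_diff frag_extend_add diff_diff_eq)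
  next
    fix a x y assume "a \<in> carrier R" "x \<in> carrier M" "y \<in> carrier N"
    then show "ext (frag_of (a \<odot>\<^bsub>M\<^esub> x, y) - frag_of (x, a \<odot>\<^bsub>N\<^esub> y)) \<in> T.rel"
      using T.rel_smult F G by (simp add: ext_def frag_extend_diff)
  qed
  have ext_rel: "ext r \<in> T.rel" if "r \<in> S.rel" for r
    using that unfolding tensor_relations_def[of R M N]
  proof (induction rule: generate.induct)
    case one then show ?case by (simp add: ext_def T.rel_zero)
  next
    case (incl c)
    then show ?case by (rule ext_gens)
  next
    case (inv c)
    have "c \<in> S.rel" unfolding tensor_relations_def using inv by (rule generate.incl)
    then have "Poly_Mapping.keys c \<subseteq> carrier M \<times> carrier N" by (rule S.rel_keys)
    then show ?case
      using T.rel_uminus[OF ext_gens[OF inv]] by (simp add: ext_def frag_extend_minus)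
  next
    case (eng a b)
    then show ?case by (simp add: ext_def frag_extend_add T.rel_add)
  qed
  have "T.rel #>\<^bsub>T.F\<^esub> ext d = T.rel #>\<^bsub>T.F\<^esub> ext c" if "d \<in> S.rel #>\<^bsub>S.F\<^esub> c" for d
  proof -
    have "ext (d - c) \<in> T.rel" using that S.coset_iff ext_rel by blast
    then show ?thesis unfolding T.coset_eq_iff by (simp add: ext_def frag_extend_diff)
  qed
  moreover have "c \<in> S.rel #>\<^bsub>S.F\<^esub> c" by (simp add: S.coset_iff S.rel_zero)
  ultimately show "tensor_map R M' N' f g (S.rel #>\<^bsub>S.F\<^esub> c) = T.rel #>\<^bsub>T.F\<^esub> ext c"
    unfolding tensor_map_def ext_def[symmetric] by blast
qed

text \<open>The functionals \<open>x \<mapsto> tr (e i * x)\<close> and the elements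
  \<open>e i\<close> form a dual basis of a finitely generated projective module; the
  \<open>e i\<close> themselves may be linearly dependent. The same elements occur on both sides,
  and this symmetry is what the separability idempotent exploits.\<close>

locale trace_form = R: cring R + A: cring A + alg: algebra R A
  for R :: "('a, 'r) ring_scheme" and A :: "('a, 'b, 's) module_scheme" (structure) +
  fixes n :: nat and e :: "nat \<Rightarrow> 'b" and tr :: "'b \<Rightarrow> 'a"
  assumes e: "i < n \<Longrightarrow> e i \<in> carrier A"
    and tr_closed: "x \<in> carrier A \<Longrightarrow> tr x \<in> carrier R"
    and tr_add: "x \<in> carrier A \<Longrightarrow> y \<in> carrier A \<Longrightarrow> tr (x \<oplus> y) = tr x \<oplus>\<^bsub>R\<^esub> tr y"
    and tr_smult: "a \<in> carrier R \<Longrightarrow> x \<in> carrier A \<Longrightarrow> tr (a \<odot> x) = a \<otimes>\<^bsub>R\<^esub> tr x"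
    and expand: "x \<in> carrier A \<Longrightarrow> (\<Oplus>i\<in>{..<n}. tr (e i \<otimes> x) \<odot> e i) = x"
begin

lemma module_A: "module R A" by (rule alg.module)

definition \<phi> :: "nat \<Rightarrow> 'b \<Rightarrow> 'a" where "\<phi> i x = tr (e i \<otimes> x)"

lemma \<phi>_closed: "i < n \<Longrightarrow> x \<in> carrier A \<Longrightarrow> \<phi> i x \<in> carrier R"
  by (simp add: \<phi>_def tr_closed e)

lemma \<phi>_add: "i < n \<Longrightarrow> x \<in> carrier A \<Longrightarrow> y \<in> carrier A \<Longrightarrow> \<phi> i (x \<oplus> y) = \<phi> i x \<oplus>\<^bsub>R\<^esub> \<phi> i y"
  by (simp add: \<phi>_def A.r_distr tr_add e)

lemma smult_comm:
  assumes "a \<in> carrier R" "x \<in> carrier A" "y \<in> carrier A"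
  shows "x \<otimes> (a \<odot> y) = a \<odot> (x \<otimes> y)"
  using assms alg.smult_assoc2[of a y x] by (simp add: A.m_comm)

lemma \<phi>_smult: "i < n \<Longrightarrow> a \<in> carrier R \<Longrightarrow> x \<in> carrier A \<Longrightarrow> \<phi> i (a \<odot> x) = a \<otimes>\<^bsub>R\<^esub> \<phi> i x"
  by (simp add: \<phi>_def smult_comm tr_smult e)

lemma \<phi>_expand: "x \<in> carrier A \<Longrightarrow> (\<Oplus>i\<in>{..<n}. \<phi> i x \<odot> e i) = x"
  by (simp add: \<phi>_def expand)

text \<open>The images \<open>h (e i)\<close> are lifted through \<open>g\<close> to elements
  \<open>m i\<close>, and the lift of \<open>h\<close> is \<open>\<Sum> \<phi> i x m i\<close>. It
  is well defined even if the \<open>e i\<close> are dependent, since the coefficients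
  \<open>\<phi> i x\<close> are functions of \<open>x\<close>.\<close>

lemma projective: "projective_module tm tn R A"
  unfolding projective_module_def
proof (intro conjI allI impI module_A)
  fix M :: "('a, 'c) module" and N :: "('a, 'd) module" and g h
  assume M: "module R M" and N: "module R N" and g: "g \<in> module_homs R M N"
    and surj: "g ` carrier M = carrier N" and h: "h \<in> module_homs R A N"
  interpret M: module R M by fact
  interpret N: module R N by fact
  have "\<exists>m. m \<in> carrier M \<and> g m = h (e i)" if "i < n" for i
    using module_homsD(1)[OF h e[OF that]] surj by (metis imageE)
  then obtain m where m: "\<And>i. i < n \<Longrightarrow> m i \<in> carrier M" "\<And>i. i < n \<Longrightarrow> g (m i) = h (e i)" by metis
  define k where "k x = (\<Oplus>\<^bsub>M\<^esub>i\<in>{..<n}. \<phi> i x \<odot>\<^bsub>M\<^esub> m i)" for x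
  have cl: "(\<lambda>i. \<phi> i x \<odot>\<^bsub>M\<^esub> m i) \<in> {..<n} \<rightarrow> carrier M" if "x \<in> carrier A" for x
    using m \<phi>_closed that by auto
  have "k \<in> module_homs R A M"
    unfolding module_homs_def
  proof (intro CollectI conjI ballI Pi_I)
    show "k x \<in> carrier M" if "x \<in> carrier A" for x
      unfolding k_def using cl[OF that] by (rule M.M.finsum_closed)
    show "k (x \<oplus> y) = k x \<oplus>\<^bsub>M\<^esub> k y" if x: "x \<in> carrier A" and y: "y \<in> carrier A" for x y
    proof -
      have "k (x \<oplus> y) = (\<Oplus>\<^bsub>M\<^esub>i\<in>{..<n}. \<phi> i x \<odot>\<^bsub>M\<^esub> m i \<oplus>\<^bsub>M\<^esub> \<phi> i y \<odot>\<^bsub>M\<^esub> m i)"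
        unfolding k_def using cl[OF x] cl[OF y] x y \<phi>_closed m
        by (intro M.M.finsum_cong') (auto simp: \<phi>_add M.smult_l_distr)
      then show ?thesis unfolding k_def using M.M.finsum_addf[OF cl[OF x] cl[OF y]] by simp
    qed
    show "k (a \<odot> x) = a \<odot>\<^bsub>M\<^esub> k x" if a: "a \<in> carrier R" and x: "x \<in> carrier A" for a x
    proof -
      have "k (a \<odot> x) = (\<Oplus>\<^bsub>M\<^esub>i\<in>{..<n}. a \<odot>\<^bsub>M\<^esub> (\<phi> i x \<odot>\<^bsub>M\<^esub> m i))"
        unfolding k_def using cl[OF x] a x \<phi>_closed m
        by (intro M.M.finsum_cong') (auto simp: \<phi>_smult M.smult_assoc1)
      then show ?thesis unfolding k_def using M.finsum_smult_ldistr[OF _ a cl[OF x]] by simp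
    qed
  qed
  moreover have "g (k x) = h x" if x: "x \<in> carrier A" for x
  proof -
    have "g (k x) = (\<Oplus>\<^bsub>N\<^esub>i\<in>{..<n}. g (\<phi> i x \<odot>\<^bsub>M\<^esub> m i))"
      unfolding k_def by (rule module_homs_finsum[OF M N g]) (use cl[OF x] in auto)
    also have "\<dots> = (\<Oplus>\<^bsub>N\<^esub>i\<in>{..<n}. h (\<phi> i x \<odot> e i))"
      using module_homsD[OF g] module_homsD[OF h] m e \<phi>_closed x by (intro N.M.finsum_cong') auto
    also have "\<dots> = h (\<Oplus>i\<in>{..<n}. \<phi> i x \<odot> e i)"
      by (rule module_homs_finsum[OF module_A N h, symmetric]) (use e \<phi>_closed x in auto)
    finally show ?thesis using \<phi>_expand[OF x] by simp
  qed
  ultimately show "\<exists>k\<in>module_homs R A M. \<forall>x\<in>carrier A. g (k x) = h x" by blast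
qed

text \<open>On representatives, the map from the tensor product of \<open>M\<close> and
  \<open>A\<close> to \<open>M\<close> induced by \<open>\<phi> i\<close> on the second
  factor.\<close>

definition coord :: "('a, 'c, 'u) module_scheme \<Rightarrow> nat \<Rightarrow> ('c \<times> 'b \<Rightarrow>\<^sub>0 int) \<Rightarrow> 'c" where
  "coord M i = frag_eval M (\<lambda>(x, y). \<phi> i y \<odot>\<^bsub>M\<^esub> x)"

lemma coord_rel:
  assumes M: "module R M" and i: "i < n" and r: "r \<in> tensor_relations R M A"
  shows "coord M i r = \<zero>\<^bsub>M\<^esub>"
proof -
  interpret M: module R M by fact
  interpret T: two_modules R M A by (rule two_modules.intro[OF M module_A])
  show ?thesis
    unfolding coord_def
    by (rule T.bilinear_eval_rel[OF _ _ _ _ _ r])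
      (use i \<phi>_closed in \<open>auto simp: \<phi>_add \<phi>_smult M.smult_l_distr M.smult_r_distr
        M.smult_assoc1[symmetric] R.m_comm M.abelian_group_axioms\<close>)
qed

text \<open>For a pure tensor of \<open>x\<close> and \<open>y\<close>, the expansion of
  \<open>y\<close> in the \<open>e i\<close> is inserted and the coefficients
  \<open>\<phi> i y\<close> are moved across to \<open>x\<close>; differences of representatives are
  handled by additivity.\<close>

lemma coord_expand:
  assumes M: "module R M" and t: "Poly_Mapping.keys t \<subseteq> carrier M \<times> carrier A"
  shows "t - (\<Sum>i<n. frag_of (coord M i t, e i)) \<in> tensor_relations R M A"
proof -
  interpret M: module R M by fact
  interpret T: two_modules R M A by (rule two_modules.intro[OF M module_A])
  have w: "(\<lambda>(x, y). \<phi> i y \<odot>\<^bsub>M\<^esub> x) \<in> carrier M \<times> carrier A \<rightarrow> carrier M" if "i < n" for i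
    using \<phi>_closed that by auto
  have cl: "coord M i c \<in> carrier M" if "i < n" "Poly_Mapping.keys c \<subseteq> carrier M \<times> carrier A" for i c
    unfolding coord_def using M.M.frag_eval_closed[OF w] that by blast
  show ?thesis
    using t
  proof (induction t rule: free_Abelian_group_induct[consumes 1, case_names zero diff gen])
    case zero
    have "- (\<Sum>i<n. frag_of (\<zero>\<^bsub>M\<^esub>, e i)) \<in> T.rel"
      by (intro T.rel_uminus T.rel_sum T.rel_zero_left e) simp
    then show ?case by (simp add: coord_def M.M.frag_eval_zero)
  next
    case (diff x y)
    have "(\<Sum>i<n. frag_of (coord M i (x - y), e i) - (frag_of (coord M i x, e i) - frag_of (coord M i y, e i))) \<in> T.rel"
    proof (rule T.rel_sum)
      fix i assume i: "i \<in> {..<n}"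
      let ?a = "coord M i x" and ?b = "coord M i y" and ?c = "coord M i (x - y)"
      have "?c = ?a \<ominus>\<^bsub>M\<^esub> ?b"
        unfolding coord_def using i by (intro M.M.frag_eval_diff[OF w] diff) auto
      moreover have ab: "?a \<in> carrier M" "?b \<in> carrier M" using cl i diff by auto
      ultimately have "?a = ?c \<oplus>\<^bsub>M\<^esub> ?b" and "?c \<in> carrier M"
        by (auto simp: a_minus_def M.M.a_assoc M.M.l_neg)
      then have "frag_of (?a, e i) - (frag_of (?c, e i) + frag_of (?b, e i)) \<in> T.rel"
        using T.rel_left[of ?c ?b "e i"] ab e i by auto
      from T.rel_uminus[OF this]
      show "frag_of (?c, e i) - (frag_of (?a, e i) - frag_of (?b, e i)) \<in> T.rel"
        by (simp add: algebra_simps)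
    qed
    then have "(\<Sum>i<n. frag_of (coord M i (x - y), e i)) - ((\<Sum>i<n. frag_of (coord M i x, e i)) - (\<Sum>i<n. frag_of (coord M i y, e i))) \<in> T.rel"
      by (simp add: sum_subtractf)
    from T.rel_diff[OF T.rel_diff[OF diff(3,4)] this] show ?case by (simp add: algebra_simps)
  next
    case (gen p)
    then obtain x y where p: "p = (x, y)" "x \<in> carrier M" "y \<in> carrier A" by blast
    have "frag_of (x, y) - (\<Sum>i<n. frag_of (x, \<phi> i y \<odot> e i)) \<in> T.rel"
      using T.rel_finsum_right[of "{..<n}" "\<lambda>i. \<phi> i y \<odot> e i" x] \<phi>_expand[OF p(3)] \<phi>_closed e p by auto
    moreover have "(\<Sum>i<n. frag_of (x, \<phi> i y \<odot> e i)) - (\<Sum>i<n. frag_of (\<phi> i y \<odot>\<^bsub>M\<^esub> x, e i)) \<in> T.rel"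
      using T.rel_sym[OF T.rel_smult] \<phi>_closed e p by (intro T.rel_sum_diff) auto
    ultimately have "frag_of (x, y) - (\<Sum>i<n. frag_of (\<phi> i y \<odot>\<^bsub>M\<^esub> x, e i)) \<in> T.rel"
      by (rule T.rel_trans)
    moreover have "coord M i (frag_of p) = \<phi> i y \<odot>\<^bsub>M\<^esub> x" if "i < n" for i
      unfolding coord_def using M.M.frag_eval_of[of "\<lambda>(x, y). \<phi> i y \<odot>\<^bsub>M\<^esub> x" p] p \<phi>_closed that by simp
    ultimately show ?case using p by simp
  qed
qed

text \<open>The coordinates are natural in the module. If the image of a tensor vanishes, then
  \<open>f\<close> kills all its coordinates, injectivity makes them zero, and
  \<open>coord_expand\<close> rebuilds the tensor from them.\<close>

lemma flat: "flat_module tm tn R A"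
  unfolding flat_module_def
proof (intro conjI allI impI module_A)
  fix M :: "('a, 'c) module" and N :: "('a, 'd) module" and f
  assume M: "module R M" and N: "module R N" and f: "f \<in> module_homs R M N"
    and inj: "inj_on f (carrier M)"
  interpret M: module R M by fact
  interpret N: module R N by fact
  interpret S: two_modules R M A by (rule two_modules.intro[OF M module_A])
  interpret T: two_modules R N A by (rule two_modules.intro[OF N module_A])
  let ?ext = "frag_extend (\<lambda>(x, y). frag_of (f x, y))"
  have id: "(\<lambda>x. x) \<in> module_homs R A A" by (simp add: module_homs_def)
  note tm = tensor_map_coset[OF M module_A N module_A f id]
  note F = module_homsD[OF f]
  show "inj_on (tensor_map R N A f (\<lambda>x. x)) (carrier (tensor_product R M A))"
  proof (rule inj_onI)
    fix s t assume "s \<in> carrier (tensor_product R M A)" "t \<in> carrier (tensor_product R M A)"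
      and eq: "tensor_map R N A f (\<lambda>x. x) s = tensor_map R N A f (\<lambda>x. x) t"
    then obtain c d where c: "c \<in> carrier S.F" "s = S.rel #>\<^bsub>S.F\<^esub> c"
      and d: "d \<in> carrier S.F" "t = S.rel #>\<^bsub>S.F\<^esub> d"
      unfolding S.carrier_tensor_product by blast
    have cd: "Poly_Mapping.keys (c - d) \<subseteq> carrier M \<times> carrier A"
      using c(1) d(1) keys_diff[of c d] by auto
    have ext: "?ext (c - d) \<in> T.rel"
      using eq unfolding c(2) d(2) tm(1)[OF c(1)] tm(1)[OF d(1)] T.coset_eq_iff
      by (simp add: frag_extend_diff)
    have w: "(\<lambda>(x, y). \<phi> i y \<odot>\<^bsub>M\<^esub> x) \<in> carrier M \<times> carrier A \<rightarrow> carrier M"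
       "(\<lambda>(x, y). \<phi> i y \<odot>\<^bsub>N\<^esub> x) \<in> carrier N \<times> carrier A \<rightarrow> carrier N" if "i < n" for i
      using \<phi>_closed that by auto
    have nat: "coord N i (?ext b) = f (coord M i b)"
      if i: "i < n" and b: "Poly_Mapping.keys b \<subseteq> carrier M \<times> carrier A" for i b
      using b
    proof (induction b rule: free_Abelian_group_induct[consumes 1, case_names zero diff gen])
      case zero
      show ?case using module_homs_zero[OF M N f] by (simp add: coord_def M.M.frag_eval_zero N.M.frag_eval_zero)
    next
      case (diff x y)
      have ek: "Poly_Mapping.keys (?ext b) \<subseteq> carrier N \<times> carrier A"
        if "Poly_Mapping.keys b \<subseteq> carrier M \<times> carrier A" for b
        using tm(2)[of b] that by simp
      have "coord N i (?ext (x - y)) = coord N i (?ext x) \<ominus>\<^bsub>N\<^esub> coord N i (?ext y)"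
        unfolding coord_def frag_extend_diff by (intro N.M.frag_eval_diff[OF w(2)[OF i]] ek diff)
      moreover have "coord M i (x - y) = coord M i x \<ominus>\<^bsub>M\<^esub> coord M i y"
        unfolding coord_def by (intro M.M.frag_eval_diff[OF w(1)[OF i]] diff)
      moreover have "coord M i x \<in> carrier M" "coord M i y \<in> carrier M"
        unfolding coord_def using M.M.frag_eval_closed[OF w(1)[OF i]] diff by auto
      moreover have "f (u \<ominus>\<^bsub>M\<^esub> v) = f u \<ominus>\<^bsub>N\<^esub> f v" if "u \<in> carrier M" "v \<in> carrier M" for u v
      proof -
        have "f u = f (u \<ominus>\<^bsub>M\<^esub> v) \<oplus>\<^bsub>N\<^esub> f v"
          using F(2)[of "u \<ominus>\<^bsub>M\<^esub> v" v] that by (simp add: a_minus_def M.M.a_assoc M.M.l_neg)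
        then show ?thesis using that F(1) by (simp add: a_minus_def N.M.a_assoc N.M.r_neg)
      qed
      ultimately show ?case using diff by simp
    next
      case (gen p)
      then obtain x y where p: "p = (x, y)" "x \<in> carrier M" "y \<in> carrier A" by blast
      then show ?case
        using F \<phi>_closed[OF i] M.M.frag_eval_of[of "\<lambda>(x, y). \<phi> i y \<odot>\<^bsub>M\<^esub> x" p]
          N.M.frag_eval_of[of "\<lambda>(x, y). \<phi> i y \<odot>\<^bsub>N\<^esub> x" "(f x, y)"]
        by (simp add: coord_def)
    qed
    have "coord M i (c - d) = \<zero>\<^bsub>M\<^esub>" if i: "i < n" for i
    proof -
      have "f (coord M i (c - d)) = \<zero>\<^bsub>N\<^esub>" using nat[OF i cd] coord_rel[OF N i ext] by simp
      moreover note module_homs_zero[OF M N f]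
      moreover have "coord M i (c - d) \<in> carrier M"
        unfolding coord_def using M.M.frag_eval_closed[OF w(1)[OF i] cd] .
      ultimately show ?thesis using inj by (simp add: inj_on_def)
    qed
    then have "(\<Sum>i<n. frag_of (coord M i (c - d), e i)) \<in> S.rel"
      by (intro S.rel_sum) (use S.rel_zero_left e in auto)
    from S.rel_add[OF coord_expand[OF M cd] this] have "c - d \<in> S.rel" by simp
    then show "s = t" unfolding c(2) d(2) S.coset_eq_iff .
  qed
qed

end

lemma (in abelian_group) frag_eval_sum:
  assumes w: "w \<in> S \<rightarrow> carrier G" and "finite I" "\<And>i. i \<in> I \<Longrightarrow> p i \<in> S"
  shows "frag_eval G w (\<Sum>i\<in>I. frag_of (p i)) = (\<Oplus>i\<in>I. w (p i))"
  using assms(2,3)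
proof (induction I)
  case empty
  then show ?case by (simp add: frag_eval_zero)
next
  case (insert i I)
  have "Poly_Mapping.keys (\<Sum>i\<in>I. frag_of (p i)) \<subseteq> S"
    using keys_sum[of "\<lambda>i. frag_of (p i)" I] insert by auto
  moreover have "w (p i) \<in> carrier G" using insert w by (auto simp: Pi_iff)
  ultimately have "frag_eval G w (frag_of (p i) + (\<Sum>i\<in>I. frag_of (p i))) = w (p i) \<oplus> (\<Oplus>i\<in>I. w (p i))"
    using frag_eval_add[OF w, of "frag_of (p i)"] frag_eval_of[of w "p i"] insert w by auto
  moreover have "(\<Oplus>j\<in>insert i I. w (p j)) = w (p i) \<oplus> (\<Oplus>i\<in>I. w (p i))"
    using insert w by (intro finsum_insert) auto
  ultimately show ?case using insert by simp
qed

section \<open>Separability and finite presentation\<close>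

context trace_form
begin

lemma separable:
  assumes h: "h \<in> carrier A" and he: "(\<Oplus>i\<in>{..<n}. h \<otimes> e i \<otimes> e i) = \<one>"
  shows "separable_algebra R A"
proof -
  interpret T: two_modules R A A by (rule two_modules.intro[OF module_A module_A])
  \<comment> \<open>\<open>D x\<close> represents \<open>x\<close> times the separability idempotent \<open>h \<Sum> e\<^sub>i \<otimes> e\<^sub>i\<close>.\<close>
  define D where "D x = (\<Sum>i<n. frag_of (h \<otimes> x \<otimes> e i, e i))" for x
  define d where "d x = T.rel #>\<^bsub>T.F\<^esub> D x" for x
  have kD: "Poly_Mapping.keys (D x) \<subseteq> carrier A \<times> carrier A" if "x \<in> carrier A" for x
    unfolding D_def using keys_sum[of "\<lambda>i. frag_of (h \<otimes> x \<otimes> e i, e i)" "{..<n}"] that h e by auto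
  then have DF: "D x \<in> carrier T.F" if "x \<in> carrier A" for x using that by simp
  have id: "(\<lambda>y. y) \<in> module_homs R A A" by (simp add: module_homs_def)
  show ?thesis
    unfolding separable_algebra_def
  proof (intro conjI alg.algebra_axioms bexI[of _ d] ballI)
    show "d \<in> carrier A \<rightarrow> carrier (tensor_product R A A)"
      unfolding T.carrier_tensor_product d_def using DF by blast
  next
    fix x y assume x: "x \<in> carrier A" and y: "y \<in> carrier A"
    have "D (x \<oplus> y) - (D x + D y) \<in> T.rel"
      unfolding D_def sum.distrib[symmetric]
    proof (rule T.rel_sum_diff)
      fix i assume "i \<in> {..<n}"
      then show "frag_of (h \<otimes> (x \<oplus> y) \<otimes> e i, e i)
          - (frag_of (h \<otimes> x \<otimes> e i, e i) + frag_of (h \<otimes> y \<otimes> e i, e i)) \<in> T.rel"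
        using T.rel_left[of "h \<otimes> x \<otimes> e i" "h \<otimes> y \<otimes> e i" "e i"] x y h e
        by (simp add: A.r_distr A.l_distr)
    qed
    then show "d (x \<oplus> y) = d x \<otimes>\<^bsub>tensor_product R A A\<^esub> d y"
      unfolding d_def T.mult_tensor_product[OF DF[OF x] DF[OF y]] T.coset_eq_iff .
  next
    fix s x assume s: "s \<in> carrier A" and x: "x \<in> carrier A"
    have hom: "(\<lambda>y. s \<otimes> y) \<in> module_homs R A A"
      using s by (auto simp: module_homs_def A.r_distr smult_comm)
    have "frag_extend (\<lambda>(x, y). frag_of (s \<otimes> x, y)) (D x) = D (s \<otimes> x)"
      unfolding D_def frag_extend_sum[OF finite_lessThan] o_def
      using s x h e by (intro sum.cong) (auto simp: A.m_ac)
    then show "d (s \<otimes> x) = tensor_map R A A (\<lambda>y. s \<otimes> y) (\<lambda>y. y) (d x)"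
      unfolding d_def tensor_map_coset(1)[OF module_A module_A module_A module_A hom id DF[OF x]] by simp
  next
    fix s x assume s: "s \<in> carrier A" and x: "x \<in> carrier A"
    have hom: "(\<lambda>y. y \<otimes> s) \<in> module_homs R A A"
      using s by (auto simp: module_homs_def A.l_distr alg.smult_assoc2)
    let ?u = "\<lambda>i. h \<otimes> x \<otimes> e i"
    let ?a = "\<lambda>i j. \<phi> j (e i \<otimes> s)"
    have u: "?u i \<in> carrier A" if "i < n" for i using that h x e by simp
    have a: "?a i j \<in> carrier R" if "i < n" "j < n" for i j using that s e by (simp add: \<phi>_closed)
    have ext: "frag_extend (\<lambda>(x, y). frag_of (x, y \<otimes> s)) (D x) = (\<Sum>i<n. frag_of (?u i, e i \<otimes> s))"
      unfolding D_def frag_extend_sum[OF finite_lessThan] o_def by simp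
    \<comment> \<open>The right action is carried over to the left factor: \<open>e i * s\<close> is
      expanded in the \<open>e j\<close>, the coefficients cross the tensor sign, the sums are
      interchanged, and the inner sum is contracted again by \<open>expand\<close>.\<close>
    have "(\<Sum>i<n. frag_of (?u i, e i \<otimes> s)) - (\<Sum>i<n. \<Sum>j<n. frag_of (?u i, ?a i j \<odot> e j)) \<in> T.rel"
    proof (rule T.rel_sum_diff)
      fix i assume i: "i \<in> {..<n}"
      then have "(\<Oplus>j\<in>{..<n}. ?a i j \<odot> e j) = e i \<otimes> s" using \<phi>_expand e s by simp
      then show "frag_of (?u i, e i \<otimes> s) - (\<Sum>j<n. frag_of (?u i, ?a i j \<odot> e j)) \<in> T.rel"
        using T.rel_finsum_right[of "{..<n}" "\<lambda>j. ?a i j \<odot> e j" "?u i"] i a u e by auto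
    qed
    moreover have "(\<Sum>i<n. \<Sum>j<n. frag_of (?u i, ?a i j \<odot> e j))
        - (\<Sum>i<n. \<Sum>j<n. frag_of (?a i j \<odot> ?u i, e j)) \<in> T.rel"
      by (intro T.rel_sum_diff T.rel_sym[OF T.rel_smult]) (use a u e in auto)
    moreover have "(\<Sum>j<n. \<Sum>i<n. frag_of (?a i j \<odot> ?u i, e j)) - D (x \<otimes> s) \<in> T.rel"
      unfolding D_def
    proof (rule T.rel_sum_diff)
      fix j assume "j \<in> {..<n}"
      then have j: "j < n" by simp
      have "(\<Oplus>i\<in>{..<n}. ?a i j \<odot> ?u i)
          = (\<Oplus>i\<in>{..<n}. h \<otimes> x \<otimes> (tr (e i \<otimes> (e j \<otimes> s)) \<odot> e i))"
      proof (rule A.finsum_cong')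
        fix i assume "i \<in> {..<n}"
        then have i: "i < n" by simp
        \<comment> \<open>Symmetry of the form: the coefficient of \<open>e j\<close> in
          \<open>e i * s\<close> equals the coefficient of \<open>e i\<close> in
          \<open>e j * s\<close>.\<close>
        have "e j \<otimes> (e i \<otimes> s) = e i \<otimes> (e j \<otimes> s)" using i j e s by (simp add: A.m_ac)
        then show "?a i j \<odot> ?u i = h \<otimes> x \<otimes> (tr (e i \<otimes> (e j \<otimes> s)) \<odot> e i)"
          using i j e s h x by (simp add: \<phi>_def smult_comm tr_closed)
      qed (use h x e s j tr_closed in auto)
      also have "\<dots> = h \<otimes> x \<otimes> (\<Oplus>i\<in>{..<n}. tr (e i \<otimes> (e j \<otimes> s)) \<odot> e i)"
        by (rule A.finsum_rdistr[symmetric]) (use h x e s j tr_closed in auto)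
      also have "\<dots> = h \<otimes> (x \<otimes> s) \<otimes> e j"
        using expand[of "e j \<otimes> s"] j e s h x by (simp add: A.m_ac)
      finally have "frag_of (h \<otimes> (x \<otimes> s) \<otimes> e j, e j)
          - (\<Sum>i<n. frag_of (?a i j \<odot> ?u i, e j)) \<in> T.rel"
        using T.rel_finsum_left[of "{..<n}" "\<lambda>i. ?a i j \<odot> ?u i" "e j"] j a u e by auto
      then show "(\<Sum>i<n. frag_of (?a i j \<odot> ?u i, e j)) - frag_of (h \<otimes> (x \<otimes> s) \<otimes> e j, e j) \<in> T.rel"
        by (rule T.rel_sym)
    qed
    ultimately have "(\<Sum>i<n. frag_of (?u i, e i \<otimes> s)) - D (x \<otimes> s) \<in> T.rel"
      using T.rel_trans sum.swap[of "\<lambda>i j. frag_of (?a i j \<odot> ?u i, e j)" "{..<n}" "{..<n}"]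
      by (metis (no_types, lifting))
    then show "d (x \<otimes> s) = tensor_map R A A (\<lambda>y. y) (\<lambda>y. y \<otimes> s) (d x)"
      unfolding d_def tensor_map_coset(1)[OF module_A module_A module_A module_A id hom DF[OF x]] ext
        T.coset_eq_iff by (rule T.rel_sym)
  next
    fix x assume x: "x \<in> carrier A"
    let ?w = "\<lambda>p. fst p \<otimes> snd p"
    have w: "?w \<in> carrier A \<times> carrier A \<rightarrow> carrier A" by auto
    \<comment> \<open>All representatives in the coset must have the same product, so that
      \<open>the_elem\<close> in \<open>tensor_multiplication\<close> is applied to a
      singleton.\<close>
    have "frag_eval A ?w c = x" if "c \<in> d x" for c
    proof -
      have r: "c - D x \<in> T.rel" using that T.coset_iff by (simp add: d_def)
      have kc: "Poly_Mapping.keys c \<subseteq> carrier A \<times> carrier A"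
        using keys_add[of "c - D x" "D x"] T.rel_keys[OF r] kD[OF x] by auto
      have "frag_eval A ?w (c - D x) = \<zero>"
        by (rule T.bilinear_eval_rel[OF _ _ _ _ _ r])
          (auto simp: A.l_distr A.r_distr alg.smult_assoc2 smult_comm A.abelian_group_axioms)
      then have "frag_eval A ?w c = frag_eval A ?w (D x)"
        using A.frag_eval_diff[OF w kc kD[OF x]] A.frag_eval_closed[OF w kc] A.frag_eval_closed[OF w kD[OF x]]
        by (simp add: A.r_right_minus_eq)
      also have "\<dots> = (\<Oplus>i\<in>{..<n}. h \<otimes> x \<otimes> e i \<otimes> e i)"
        unfolding D_def using A.frag_eval_sum[OF w, of "{..<n}" "\<lambda>i. (h \<otimes> x \<otimes> e i, e i)"] h x e by auto
      also have "\<dots> = (\<Oplus>i\<in>{..<n}. x \<otimes> (h \<otimes> e i \<otimes> e i))"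
        by (rule A.finsum_cong') (use h x e in \<open>auto simp: A.m_ac\<close>)
      also have "\<dots> = x \<otimes> (\<Oplus>i\<in>{..<n}. h \<otimes> e i \<otimes> e i)"
        by (rule A.finsum_rdistr[symmetric]) (use h x e in auto)
      finally show ?thesis using he x by simp
    qed
    moreover have "D x \<in> d x" by (simp add: d_def T.coset_iff T.rel_zero)
    ultimately have "frag_eval A ?w ` d x = {x}" by (auto simp: image_iff intro: bexI[of _ "D x"])
    then show "tensor_multiplication A (d x) = x"
      by (simp add: tensor_multiplication_def frag_eval_def)
  qed
qed

sublocale fam: algebra_family R A "{..<n}" e
  by unfold_locales (simp add: e)

lemma finitely_presented: "finitely_presented_algebra R A"
proof -
  let ?P = "mpoly_algebra R {..<n}"
  let ?C = "R.indexed_const :: 'a \<Rightarrow> nat multiset \<Rightarrow> 'a" and ?X = "R.indexed_var :: nat \<Rightarrow> nat multiset \<Rightarrow> 'a"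
  interpret P: cring ?P by (rule R.cring_mpoly_algebra)
  interpret ev: ring_hom_cring ?P A fam.ev by (rule fam.ring_hom_mpoly_eval)
  note simps = R.mpoly_algebra_simps
  have C: "?C k \<in> carrier ?P" if "k \<in> carrier R" for k
    unfolding simps using that by (rule R.indexed_pset.indexed_const)
  have X: "?X i \<in> carrier ?P" if "i < n" for i
    unfolding simps R.indexed_var_def using that by (intro R.indexed_pset.intros) auto
  have pmult: "R.indexed_pmult f i = f \<otimes>\<^bsub>?P\<^esub> ?X i" if "f \<in> carrier ?P" "i < n" for f i
  proof -
    have "f \<otimes>\<^bsub>?P\<^esub> ?X i = R.indexed_pmult (f \<otimes>\<^bsub>?P\<^esub> ?C \<one>\<^bsub>R\<^esub>) i"
      unfolding simps R.indexed_var_def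
      by (rule R.mp_mult_pmult) (use that in \<open>auto simp: simps R.indexed_const_def fam.support\<close>)
    also have "f \<otimes>\<^bsub>?P\<^esub> ?C \<one>\<^bsub>R\<^esub> = f" using P.r_one[OF that(1)] unfolding simps(4) .
    finally show ?thesis by simp
  qed
  have C_mult: "?C (a \<otimes>\<^bsub>R\<^esub> b) = ?C a \<otimes>\<^bsub>?P\<^esub> ?C b" if "a \<in> carrier R" "b \<in> carrier R" for a b
    unfolding simps using R.mp_mult_const[of "?C a" b] that by (auto simp: R.indexed_const_def)
  have C_add: "?C (a \<oplus>\<^bsub>R\<^esub> b) = ?C a \<oplus>\<^bsub>?P\<^esub> ?C b" for a b
    unfolding simps by (rule R.indexed_padd_const[symmetric])
  \<comment> \<open>An \<open>R\<close>-linear section of the evaluation whose values are linear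
    forms in the variables. Its value at the unit is a linear form and not the constant 1, which is
    why a relation for the unit appears below.\<close>
  define L where "L a = (\<Oplus>\<^bsub>?P\<^esub>k\<in>{..<n}. ?C (\<phi> k a) \<otimes>\<^bsub>?P\<^esub> ?X k)" for a
  have Lc: "(\<lambda>k. ?C (\<phi> k a) \<otimes>\<^bsub>?P\<^esub> ?X k) \<in> {..<n} \<rightarrow> carrier ?P" if "a \<in> carrier A" for a
    using that C X \<phi>_closed by auto
  have L_closed: "L a \<in> carrier ?P" if "a \<in> carrier A" for a
    unfolding L_def by (rule P.finsum_closed[OF Lc[OF that]])
  have L_add: "L (a \<oplus> b) = L a \<oplus>\<^bsub>?P\<^esub> L b" if a: "a \<in> carrier A" and b: "b \<in> carrier A" for a b
  proof -
    have "L (a \<oplus> b) = (\<Oplus>\<^bsub>?P\<^esub>k\<in>{..<n}. ?C (\<phi> k a) \<otimes>\<^bsub>?P\<^esub> ?X k \<oplus>\<^bsub>?P\<^esub> ?C (\<phi> k b) \<otimes>\<^bsub>?P\<^esub> ?X k)"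
      unfolding L_def using a b Lc[OF a] Lc[OF b] C X \<phi>_closed
      by (intro P.finsum_cong') (auto simp: \<phi>_add C_add P.l_distr)
    then show ?thesis unfolding L_def using P.finsum_addf[OF Lc[OF a] Lc[OF b]] by simp
  qed
  have L_smult: "L (r \<odot> a) = ?C r \<otimes>\<^bsub>?P\<^esub> L a" if r: "r \<in> carrier R" and a: "a \<in> carrier A" for r a
  proof -
    have "L (r \<odot> a) = (\<Oplus>\<^bsub>?P\<^esub>k\<in>{..<n}. ?C r \<otimes>\<^bsub>?P\<^esub> (?C (\<phi> k a) \<otimes>\<^bsub>?P\<^esub> ?X k))"
      unfolding L_def using a r Lc[OF a] C X \<phi>_closed
      by (intro P.finsum_cong') (auto simp: \<phi>_smult C_mult P.m_assoc)
    then show ?thesis unfolding L_def using P.finsum_rdistr[OF _ C[OF r] Lc[OF a]] by simp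
  qed
  have L_zero: "L \<zero> = \<zero>\<^bsub>?P\<^esub>"
    using L_add[of "\<zero>" "\<zero>"] L_closed[of "\<zero>"] P.add.r_cancel_one' by force
  have L_sum: "L (\<Oplus>k\<in>K. g k) = (\<Oplus>\<^bsub>?P\<^esub>k\<in>K. L (g k))" if "finite K" "\<And>k. k \<in> K \<Longrightarrow> g k \<in> carrier A" for K :: "nat set" and g
    using that
  proof (induction K)
    case (insert k K)
    have "L (\<Oplus>k\<in>insert k K. g k) = L (g k \<oplus> (\<Oplus>k\<in>K. g k))"
      using insert by (subst A.finsum_insert) auto
    also have "\<dots> = L (g k) \<oplus>\<^bsub>?P\<^esub> (\<Oplus>\<^bsub>?P\<^esub>k\<in>K. L (g k))"
      using insert by (subst L_add) (auto intro!: A.finsum_closed)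
    also have "\<dots> = (\<Oplus>\<^bsub>?P\<^esub>k\<in>insert k K. L (g k))"
      using insert L_closed by (subst P.finsum_insert) auto
    finally show ?case .
  qed (simp add: L_zero)
  have evC: "fam.ev (?C k) = k \<odot> \<one>" if "k \<in> carrier R" for k using fam.ev_const[OF that] .
  have evX: "fam.ev (?X i) = e i" if "i < n" for i using fam.ev_var that by simp
  have evL: "fam.ev (L a) = a" if a: "a \<in> carrier A" for a
  proof -
    have "fam.ev (L a) = (\<Oplus>k\<in>{..<n}. fam.ev (?C (\<phi> k a) \<otimes>\<^bsub>?P\<^esub> ?X k))"
      unfolding L_def using ev.hom_finsum[OF Lc[OF a]] by (simp add: o_def)
    also have "\<dots> = (\<Oplus>k\<in>{..<n}. \<phi> k a \<odot> e k)"
      using a C X \<phi>_closed e by (intro A.finsum_cong') (auto simp: evC evX alg.smult_assoc2)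
    finally show ?thesis using \<phi>_expand[OF a] by simp
  qed
  \<comment> \<open>Modulo the relations \<open>X\<^sub>i X\<^sub>j = L (e\<^sub>i e\<^sub>j)\<close> and \<open>1 = L 1\<close> every polynomial \<open>f\<close> becomes \<open>L (ev f)\<close>.\<close>
  define Rel where "Rel = insert (\<one>\<^bsub>?P\<^esub> \<ominus>\<^bsub>?P\<^esub> L \<one>)
    ((\<lambda>(i, j). ?X i \<otimes>\<^bsub>?P\<^esub> ?X j \<ominus>\<^bsub>?P\<^esub> L (e i \<otimes> e j)) ` ({..<n} \<times> {..<n}))"
  have Rel: "Rel \<subseteq> carrier ?P" using X L_closed e by (auto simp: Rel_def)
  interpret J: ideal "Idl\<^bsub>?P\<^esub> Rel" ?P by (rule P.genideal_ideal[OF Rel])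
  let ?J = "Idl\<^bsub>?P\<^esub> Rel"
  have RelJ: "x \<in> ?J" if "x \<in> Rel" for x using P.genideal_self[OF Rel] that by blast
  have trans: "f \<ominus>\<^bsub>?P\<^esub> k \<in> ?J"
    if "f \<ominus>\<^bsub>?P\<^esub> g \<in> ?J" "g \<ominus>\<^bsub>?P\<^esub> k \<in> ?J" "f \<in> carrier ?P" "g \<in> carrier ?P" "k \<in> carrier ?P" for f g k
  proof -
    have "f \<ominus>\<^bsub>?P\<^esub> k = (f \<ominus>\<^bsub>?P\<^esub> g) \<oplus>\<^bsub>?P\<^esub> (g \<ominus>\<^bsub>?P\<^esub> k)"
      using that(3-5) by (simp add: a_minus_def P.a_assoc[symmetric]) (simp add: P.a_assoc P.l_neg)
    then show ?thesis using that(1,2) by simp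
  qed
  have mult: "k \<otimes>\<^bsub>?P\<^esub> f \<ominus>\<^bsub>?P\<^esub> k \<otimes>\<^bsub>?P\<^esub> g \<in> ?J"
    if "f \<ominus>\<^bsub>?P\<^esub> g \<in> ?J" "f \<in> carrier ?P" "g \<in> carrier ?P" "k \<in> carrier ?P" for f g k
  proof -
    have "k \<otimes>\<^bsub>?P\<^esub> f \<ominus>\<^bsub>?P\<^esub> k \<otimes>\<^bsub>?P\<^esub> g = k \<otimes>\<^bsub>?P\<^esub> (f \<ominus>\<^bsub>?P\<^esub> g)"
      using that(2-4) by (simp add: a_minus_def P.r_distr P.r_minus)
    then show ?thesis using that J.I_l_closed by simp
  qed
  have add: "(f \<oplus>\<^bsub>?P\<^esub> f') \<ominus>\<^bsub>?P\<^esub> (g \<oplus>\<^bsub>?P\<^esub> g') \<in> ?J"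
    if "f \<ominus>\<^bsub>?P\<^esub> g \<in> ?J" "f' \<ominus>\<^bsub>?P\<^esub> g' \<in> ?J" "f \<in> carrier ?P" "g \<in> carrier ?P" "f' \<in> carrier ?P" "g' \<in> carrier ?P"
    for f f' g g'
  proof -
    have "(f \<oplus>\<^bsub>?P\<^esub> f') \<ominus>\<^bsub>?P\<^esub> (g \<oplus>\<^bsub>?P\<^esub> g') = (f \<ominus>\<^bsub>?P\<^esub> g) \<oplus>\<^bsub>?P\<^esub> (f' \<ominus>\<^bsub>?P\<^esub> g')"
      using that(3-6) by (simp add: a_minus_def P.minus_add P.a_ac)
    then show ?thesis using that(1,2) by simp
  qed
  have sums: "(\<Oplus>\<^bsub>?P\<^esub>k\<in>K. f k) \<ominus>\<^bsub>?P\<^esub> (\<Oplus>\<^bsub>?P\<^esub>k\<in>K. g k) \<in> ?J"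
    if "finite K" "\<And>k. k \<in> K \<Longrightarrow> f k \<ominus>\<^bsub>?P\<^esub> g k \<in> ?J" "\<And>k. k \<in> K \<Longrightarrow> f k \<in> carrier ?P" "\<And>k. k \<in> K \<Longrightarrow> g k \<in> carrier ?P"
    for K :: "nat set" and f g
    using that
  proof (induction K)
    case empty
    then show ?case using J.zero_closed by (simp add: a_minus_def)
  next
    case (insert k K)
    have "(f k \<oplus>\<^bsub>?P\<^esub> (\<Oplus>\<^bsub>?P\<^esub>k\<in>K. f k)) \<ominus>\<^bsub>?P\<^esub> (g k \<oplus>\<^bsub>?P\<^esub> (\<Oplus>\<^bsub>?P\<^esub>k\<in>K. g k)) \<in> ?J"
      using insert by (intro add) (auto intro!: P.finsum_closed)
    moreover have "(\<Oplus>\<^bsub>?P\<^esub>j\<in>insert k K. f j) = f k \<oplus>\<^bsub>?P\<^esub> (\<Oplus>\<^bsub>?P\<^esub>k\<in>K. f k)"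
      "(\<Oplus>\<^bsub>?P\<^esub>j\<in>insert k K. g j) = g k \<oplus>\<^bsub>?P\<^esub> (\<Oplus>\<^bsub>?P\<^esub>k\<in>K. g k)"
      using insert by (auto intro!: P.finsum_insert)
    ultimately show ?case by simp
  qed
  \<comment> \<open>Products of two variables are again linear forms modulo the relations, so the
    linear forms \<open>L a\<close> are closed under multiplication by a variable.\<close>
  have L_mult_X: "L a \<otimes>\<^bsub>?P\<^esub> ?X i \<ominus>\<^bsub>?P\<^esub> L (a \<otimes> e i) \<in> ?J" if a: "a \<in> carrier A" and i: "i < n" for a i
  proof -
    have "L a \<otimes>\<^bsub>?P\<^esub> ?X i = (\<Oplus>\<^bsub>?P\<^esub>k\<in>{..<n}. ?C (\<phi> k a) \<otimes>\<^bsub>?P\<^esub> ?X k \<otimes>\<^bsub>?P\<^esub> ?X i)"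
      unfolding L_def by (rule P.finsum_ldistr[OF _ X[OF i] Lc[OF a]]) simp
    also have "\<dots> = (\<Oplus>\<^bsub>?P\<^esub>k\<in>{..<n}. ?C (\<phi> k a) \<otimes>\<^bsub>?P\<^esub> (?X k \<otimes>\<^bsub>?P\<^esub> ?X i))"
      using C X \<phi>_closed a i by (intro P.finsum_cong') (auto simp: P.m_assoc)
    finally have 1: "L a \<otimes>\<^bsub>?P\<^esub> ?X i = (\<Oplus>\<^bsub>?P\<^esub>k\<in>{..<n}. ?C (\<phi> k a) \<otimes>\<^bsub>?P\<^esub> (?X k \<otimes>\<^bsub>?P\<^esub> ?X i))" .
    have "a \<otimes> e i = (\<Oplus>k\<in>{..<n}. \<phi> k a \<odot> e k) \<otimes> e i" using \<phi>_expand[OF a] by simp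
    also have "\<dots> = (\<Oplus>k\<in>{..<n}. (\<phi> k a \<odot> e k) \<otimes> e i)"
      using e i a \<phi>_closed by (intro A.finsum_ldistr) auto
    also have "\<dots> = (\<Oplus>k\<in>{..<n}. \<phi> k a \<odot> (e k \<otimes> e i))"
      using e i a \<phi>_closed by (intro A.finsum_cong') (auto simp: alg.smult_assoc2)
    finally have "L (a \<otimes> e i) = (\<Oplus>\<^bsub>?P\<^esub>k\<in>{..<n}. L (\<phi> k a \<odot> (e k \<otimes> e i)))"
      using L_sum[of "{..<n}" "\<lambda>k. \<phi> k a \<odot> (e k \<otimes> e i)"] e i a \<phi>_closed by simp
    also have "\<dots> = (\<Oplus>\<^bsub>?P\<^esub>k\<in>{..<n}. ?C (\<phi> k a) \<otimes>\<^bsub>?P\<^esub> L (e k \<otimes> e i))"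
      using e i a \<phi>_closed C L_closed by (intro P.finsum_cong') (auto simp: L_smult)
    finally have 2: "L (a \<otimes> e i) = (\<Oplus>\<^bsub>?P\<^esub>k\<in>{..<n}. ?C (\<phi> k a) \<otimes>\<^bsub>?P\<^esub> L (e k \<otimes> e i))" .
    show ?thesis
      unfolding 1 2
    proof (rule sums)
      fix k assume "k \<in> {..<n}"
      moreover have "?X k \<otimes>\<^bsub>?P\<^esub> ?X i \<ominus>\<^bsub>?P\<^esub> L (e k \<otimes> e i) \<in> ?J"
        using \<open>k \<in> {..<n}\<close> i by (intro RelJ) (auto simp: Rel_def)
      ultimately show "?C (\<phi> k a) \<otimes>\<^bsub>?P\<^esub> (?X k \<otimes>\<^bsub>?P\<^esub> ?X i) \<ominus>\<^bsub>?P\<^esub> ?C (\<phi> k a) \<otimes>\<^bsub>?P\<^esub> L (e k \<otimes> e i) \<in> ?J"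
        using X L_closed e C \<phi>_closed a i by (intro mult) auto
    qed (use C X L_closed \<phi>_closed a i e in auto)
  qed
  \<comment> \<open>Induction along the construction of \<open>f\<close>: constants use the relation
    for the unit, variables use \<open>L_mult_X\<close>.\<close>
  have reduce: "f \<in> carrier ?P \<and> f \<ominus>\<^bsub>?P\<^esub> L (fam.ev f) \<in> ?J" if "f \<in> fam.PR" for f
    using that
  proof (induction rule: R.indexed_pset.induct)
    case (indexed_const k)
    have "?C k \<otimes>\<^bsub>?P\<^esub> \<one>\<^bsub>?P\<^esub> \<ominus>\<^bsub>?P\<^esub> ?C k \<otimes>\<^bsub>?P\<^esub> L \<one> \<in> ?J"
      using indexed_const C L_closed by (intro mult RelJ) (auto simp: Rel_def)
    then show ?case using C[OF indexed_const] L_smult indexed_const evC by simp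
  next
    case (indexed_padd f g)
    have "(f \<oplus>\<^bsub>?P\<^esub> g) \<ominus>\<^bsub>?P\<^esub> (L (fam.ev f) \<oplus>\<^bsub>?P\<^esub> L (fam.ev g)) \<in> ?J"
      using indexed_padd L_closed by (intro add) auto
    moreover have "R.indexed_padd f g = f \<oplus>\<^bsub>?P\<^esub> g" by (simp add: simps)
    ultimately show ?case using indexed_padd L_add by simp
  next
    case (indexed_pmult f i)
    then have i: "i < n" and f: "f \<in> carrier ?P" by auto
    have "?X i \<otimes>\<^bsub>?P\<^esub> f \<ominus>\<^bsub>?P\<^esub> ?X i \<otimes>\<^bsub>?P\<^esub> L (fam.ev f) \<in> ?J"
      using indexed_pmult X[OF i] L_closed by (intro mult) auto
    then have "f \<otimes>\<^bsub>?P\<^esub> ?X i \<ominus>\<^bsub>?P\<^esub> L (fam.ev f) \<otimes>\<^bsub>?P\<^esub> ?X i \<in> ?J"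
      using X[OF i] f L_closed by (simp add: P.m_comm)
    moreover have "L (fam.ev f) \<otimes>\<^bsub>?P\<^esub> ?X i \<ominus>\<^bsub>?P\<^esub> L (fam.ev f \<otimes> e i) \<in> ?J"
      using L_mult_X f i by simp
    ultimately have "f \<otimes>\<^bsub>?P\<^esub> ?X i \<ominus>\<^bsub>?P\<^esub> L (fam.ev f \<otimes> e i) \<in> ?J"
      by (rule trans) (use f X[OF i] L_closed e i in auto)
    then show ?case using pmult[OF f i] f X[OF i] evX[OF i] by simp
  qed
  have kernel: "a_kernel ?P A fam.ev = ?J"
  proof
    show "?J \<subseteq> a_kernel ?P A fam.ev"
    proof (rule P.genideal_minimal)
      show "ideal (a_kernel ?P A fam.ev) ?P" 
        using ring_hom_ring.kernel_is_ideal[OF ring_hom_ringI2[OF P.ring_axioms A.ring_axioms ev.homh]] .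
      have "fam.ev (f \<ominus>\<^bsub>?P\<^esub> g) = \<zero>" if "f \<in> carrier ?P" "g \<in> carrier ?P" "fam.ev f = fam.ev g" for f g
        using that by (simp add: a_minus_def A.r_neg)
      note diff = this
      have ev0: "fam.ev (?X i \<otimes>\<^bsub>?P\<^esub> ?X j \<ominus>\<^bsub>?P\<^esub> L (e i \<otimes> e j)) = \<zero>" if "i < n" "j < n" for i j
        using that X L_closed e evX evL by (intro diff) simp_all
      have ev1: "fam.ev (\<one>\<^bsub>?P\<^esub> \<ominus>\<^bsub>?P\<^esub> L \<one>) = \<zero>"
        using L_closed evL by (intro diff) simp_all
      have "fam.ev f = \<zero>" if "f \<in> Rel" for f
        using that unfolding Rel_def by (elim insertE imageE SigmaE) (simp_all add: ev0 ev1)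
      then show "Rel \<subseteq> a_kernel ?P A fam.ev"
        using Rel unfolding a_kernel_def' by blast
    qed
    show "a_kernel ?P A fam.ev \<subseteq> ?J"
    proof
      fix f assume "f \<in> a_kernel ?P A fam.ev"
      then have f: "f \<in> carrier ?P" "fam.ev f = \<zero>" unfolding a_kernel_def' by blast+
      \<comment> \<open>For \<open>f\<close> in the kernel the linear form \<open>L (ev f)\<close>
        is zero, so \<open>f\<close> itself lies in the ideal of relations.\<close>
      have "f \<ominus>\<^bsub>?P\<^esub> L (fam.ev f) \<in> ?J" using reduce[of f] f(1) unfolding simps(1) by blast
      then show "f \<in> ?J" using f by (simp only: L_zero a_minus_def P.minus_zero P.r_zero)
    qed
  qed
  have "fam.ev ` carrier ?P = carrier A"
  proof
    show "fam.ev ` carrier ?P \<subseteq> carrier A" using ev.hom_closed by blast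
    show "carrier A \<subseteq> fam.ev ` carrier ?P"
    proof
      fix a assume "a \<in> carrier A"
      then show "a \<in> fam.ev ` carrier ?P" by (intro image_eqI[of _ _ "L a"]) (simp_all add: evL L_closed)
    qed
  qed
  moreover have "finite Rel" by (simp add: Rel_def)
  ultimately show ?thesis
    unfolding finitely_presented_algebra_def
    using Rel kernel e alg.algebra_axioms by (intro conjI exI[of _ n] exI[of _ e] exI[of _ Rel]) auto
qed

end

section \<open>Localization and rank\<close>

locale module_localization = module R M
  for R :: "('a, 'r) ring_scheme" (structure) and M :: "('a, 'b, 'm) module_scheme" +
  fixes U :: "'a set"
  assumes U: "U \<subseteq> carrier R" and U_one: "\<one> \<in> U" and U_mult: "u \<in> U \<Longrightarrow> v \<in> U \<Longrightarrow> u \<otimes> v \<in> U"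
begin

abbreviation "fr \<equiv> fraction R U M"

lemma U_carrier: "u \<in> U \<Longrightarrow> u \<in> carrier R" using U by blast

lemma frac_mem: "(n, t) \<in> fr m s \<longleftrightarrow>
    n \<in> carrier M \<and> t \<in> U \<and> (\<exists>u\<in>U. (u \<otimes> t) \<odot>\<^bsub>M\<^esub> m = (u \<otimes> s) \<odot>\<^bsub>M\<^esub> n)"
  by (simp add: fraction_def)

lemma frac_self: "m \<in> carrier M \<Longrightarrow> s \<in> U \<Longrightarrow> (m, s) \<in> fr m s"
  using U_one by (auto simp: frac_mem)

text \<open>Transitivity of the equivalence of fractions. If \<open>u\<close> witnesses the given
  equality and \<open>v\<close> the membership of a third pair, then \<open>u v s\<close> witnesses
  the combination.\<close>

lemma frac_eqI:
  assumes "m \<in> carrier M" "n \<in> carrier M" "s \<in> U" "t \<in> U" "u \<in> U"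
    and eq: "(u \<otimes> t) \<odot>\<^bsub>M\<^esub> m = (u \<otimes> s) \<odot>\<^bsub>M\<^esub> n"
  shows "fr m s = fr n t"
proof -
  have sub: "fr m s \<subseteq> fr n t"
    if mn: "m \<in> carrier M" "n \<in> carrier M" "s \<in> U" "t \<in> U" "u \<in> U"
      and eq: "(u \<otimes> t) \<odot>\<^bsub>M\<^esub> m = (u \<otimes> s) \<odot>\<^bsub>M\<^esub> n" for m n s t u
  proof
    fix p assume "p \<in> fr m s"
    then obtain l w v where p: "p = (l, w)" "l \<in> carrier M" "w \<in> U" "v \<in> U"
      "(v \<otimes> w) \<odot>\<^bsub>M\<^esub> m = (v \<otimes> s) \<odot>\<^bsub>M\<^esub> l"
      by (cases p) (auto simp: frac_mem)
    note c = U_carrier[OF mn(3)] U_carrier[OF mn(4)] U_carrier[OF mn(5)] U_carrier[OF p(3)] U_carrier[OF p(4)]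
    have "(u \<otimes> v \<otimes> s \<otimes> w) \<odot>\<^bsub>M\<^esub> n = (v \<otimes> w) \<odot>\<^bsub>M\<^esub> ((u \<otimes> s) \<odot>\<^bsub>M\<^esub> n)"
      using c mn by (simp add: smult_assoc1[symmetric] R.m_ac)
    also have "\<dots> = (v \<otimes> w) \<odot>\<^bsub>M\<^esub> ((u \<otimes> t) \<odot>\<^bsub>M\<^esub> m)" by (simp only: eq)
    also have "\<dots> = (u \<otimes> t) \<odot>\<^bsub>M\<^esub> ((v \<otimes> w) \<odot>\<^bsub>M\<^esub> m)"
      using c mn by (simp add: smult_assoc1[symmetric] R.m_ac)
    also have "\<dots> = (u \<otimes> t) \<odot>\<^bsub>M\<^esub> ((v \<otimes> s) \<odot>\<^bsub>M\<^esub> l)" by (simp only: p(5))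
    also have "\<dots> = (u \<otimes> v \<otimes> s \<otimes> t) \<odot>\<^bsub>M\<^esub> l"
      using c p by (simp add: smult_assoc1[symmetric] R.m_ac)
    finally show "p \<in> fr n t"
      using p(1-3) mn U_mult[OF U_mult[OF mn(5) p(4)] mn(3)] by (auto simp: frac_mem)
  qed
  show ?thesis using sub[OF assms] sub[OF assms(2,1,4,3,5) eq[symmetric]] by blast
qed

lemma frac_eqD:
  assumes "m \<in> carrier M" "s \<in> U" "fr m s = fr n t"
  obtains u where "u \<in> U" "(u \<otimes> t) \<odot>\<^bsub>M\<^esub> m = (u \<otimes> s) \<odot>\<^bsub>M\<^esub> n"
  using frac_self[OF assms(1,2)] assms(3) by (fastforce simp: frac_mem)

lemma frac_memD:
  assumes "(n, t) \<in> fr m s" "m \<in> carrier M" "s \<in> U"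
  shows "n \<in> carrier M" "t \<in> U" "fr n t = fr m s"
proof -
  show n: "n \<in> carrier M" "t \<in> U" using assms(1) by (auto simp: frac_mem)
  obtain u where "u \<in> U" "(u \<otimes> t) \<odot>\<^bsub>M\<^esub> m = (u \<otimes> s) \<odot>\<^bsub>M\<^esub> n" using assms(1) by (auto simp: frac_mem)
  then show "fr n t = fr m s" using frac_eqI assms(2,3) n by metis
qed

abbreviation "LM \<equiv> localization R U M"

lemma carrier_LM: "carrier LM = {fr m s |m s. m \<in> carrier M \<and> s \<in> U}"
  by (simp add: localization_def)

lemma zero_LM: "\<zero>\<^bsub>LM\<^esub> = fr \<zero>\<^bsub>M\<^esub> \<one>"
  by (simp add: localization_def)

lemma frac_cancel:
  assumes "m \<in> carrier M" "s \<in> U" "u \<in> U"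
  shows "fr (u \<odot>\<^bsub>M\<^esub> m) (u \<otimes> s) = fr m s"
  by (rule frac_eqI[where u = "\<one>"])
    (use assms U_carrier U_one U_mult in \<open>auto simp: smult_assoc1[symmetric] R.m_ac\<close>)

text \<open>The union in the definition runs over all representatives. If \<open>u\<close> and
  \<open>v\<close> witness the changes of the two representatives, then \<open>u v\<close> witnesses
  that the sum is unchanged, so the union is one class.\<close>

lemma add_LM:
  assumes m: "m \<in> carrier M" "s \<in> U" and n: "n \<in> carrier M" "t \<in> U"
  shows "fr m s \<oplus>\<^bsub>LM\<^esub> fr n t = fr (t \<odot>\<^bsub>M\<^esub> m \<oplus>\<^bsub>M\<^esub> s \<odot>\<^bsub>M\<^esub> n) (s \<otimes> t)"
proof -
  have "fr (t' \<odot>\<^bsub>M\<^esub> m' \<oplus>\<^bsub>M\<^esub> s' \<odot>\<^bsub>M\<^esub> n') (s' \<otimes> t') = fr (t \<odot>\<^bsub>M\<^esub> m \<oplus>\<^bsub>M\<^esub> s \<odot>\<^bsub>M\<^esub> n) (s \<otimes> t)"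
    if mem: "(m', s') \<in> fr m s" "(n', t') \<in> fr n t" for m' s' n' t'
  proof -
    note m' = frac_memD[OF mem(1) m] and n' = frac_memD[OF mem(2) n]
    obtain u where u: "u \<in> U" "(u \<otimes> s) \<odot>\<^bsub>M\<^esub> m' = (u \<otimes> s') \<odot>\<^bsub>M\<^esub> m"
      using frac_eqD[OF m'(1,2,3)] by blast
    obtain v where v: "v \<in> U" "(v \<otimes> t) \<odot>\<^bsub>M\<^esub> n' = (v \<otimes> t') \<odot>\<^bsub>M\<^esub> n"
      using frac_eqD[OF n'(1,2,3)] by blast
    note c = U_carrier[OF m(2)] U_carrier[OF n(2)] U_carrier[OF m'(2)] U_carrier[OF n'(2)]
      U_carrier[OF u(1)] U_carrier[OF v(1)]
    have "(u \<otimes> v \<otimes> (s \<otimes> t)) \<odot>\<^bsub>M\<^esub> (t' \<odot>\<^bsub>M\<^esub> m' \<oplus>\<^bsub>M\<^esub> s' \<odot>\<^bsub>M\<^esub> n')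
        = (v \<otimes> t \<otimes> t') \<odot>\<^bsub>M\<^esub> ((u \<otimes> s) \<odot>\<^bsub>M\<^esub> m') \<oplus>\<^bsub>M\<^esub> (u \<otimes> s \<otimes> s') \<odot>\<^bsub>M\<^esub> ((v \<otimes> t) \<odot>\<^bsub>M\<^esub> n')"
      using c m' n' by (simp add: smult_r_distr smult_assoc1[symmetric] R.m_ac)
    also have "\<dots> = (v \<otimes> t \<otimes> t') \<odot>\<^bsub>M\<^esub> ((u \<otimes> s') \<odot>\<^bsub>M\<^esub> m) \<oplus>\<^bsub>M\<^esub> (u \<otimes> s \<otimes> s') \<odot>\<^bsub>M\<^esub> ((v \<otimes> t') \<odot>\<^bsub>M\<^esub> n)"
      by (simp only: u(2) v(2))
    also have "\<dots> = (u \<otimes> v \<otimes> (s' \<otimes> t')) \<odot>\<^bsub>M\<^esub> (t \<odot>\<^bsub>M\<^esub> m \<oplus>\<^bsub>M\<^esub> s \<odot>\<^bsub>M\<^esub> n)"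
      using c m n by (simp add: smult_r_distr smult_assoc1[symmetric] R.m_ac)
    finally show ?thesis
      using c m n m' n' u v by (intro frac_eqI[where u = "u \<otimes> v"]) (auto intro: U_mult)
  qed
  then have "(\<Union>(m, s)\<in>fr m s. \<Union>(n, t)\<in>fr n t. fr (t \<odot>\<^bsub>M\<^esub> m \<oplus>\<^bsub>M\<^esub> s \<odot>\<^bsub>M\<^esub> n) (s \<otimes> t))
      = fr (t \<odot>\<^bsub>M\<^esub> m \<oplus>\<^bsub>M\<^esub> s \<odot>\<^bsub>M\<^esub> n) (s \<otimes> t)"
    using frac_self[OF m] frac_self[OF n] by fast
  then show ?thesis by (simp add: localization_def)
qed

text \<open>Provides the additive structure in which the finite sums of \<open>free_of_rank\<close>
  are formed.\<close>

lemma comm_monoid_LM: "abelian_monoid LM"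
proof (rule abelian_monoidI)
  fix x y z assume "x \<in> carrier LM" "y \<in> carrier LM" "z \<in> carrier LM"
  then obtain m s n t l u where x: "x = fr m s" "m \<in> carrier M" "s \<in> U"
    and y: "y = fr n t" "n \<in> carrier M" "t \<in> U" and z: "z = fr l u" "l \<in> carrier M" "u \<in> U"
    unfolding carrier_LM by blast
  note c = U_carrier[OF x(3)] U_carrier[OF y(3)] U_carrier[OF z(3)]
  show "(x \<oplus>\<^bsub>LM\<^esub> y) \<oplus>\<^bsub>LM\<^esub> z = x \<oplus>\<^bsub>LM\<^esub> (y \<oplus>\<^bsub>LM\<^esub> z)"
    using c x y z U_mult by (simp add: add_LM smult_r_distr smult_assoc1[symmetric] R.m_ac M.a_ac)
next
  fix x y assume "x \<in> carrier LM" "y \<in> carrier LM"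
  then obtain m s n t where x: "x = fr m s" "m \<in> carrier M" "s \<in> U"
    and y: "y = fr n t" "n \<in> carrier M" "t \<in> U" unfolding carrier_LM by blast
  note c = U_carrier[OF x(3)] U_carrier[OF y(3)]
  show "x \<oplus>\<^bsub>LM\<^esub> y = y \<oplus>\<^bsub>LM\<^esub> x"
    using c x y by (simp add: add_LM R.m_comm M.a_comm)
  show "x \<oplus>\<^bsub>LM\<^esub> y \<in> carrier LM"
    using c x y U_mult by (auto simp: add_LM carrier_LM)
next
  show "\<zero>\<^bsub>LM\<^esub> \<in> carrier LM" using U_one by (auto simp: zero_LM carrier_LM)
  fix x assume "x \<in> carrier LM"
  then obtain m s where x: "x = fr m s" "m \<in> carrier M" "s \<in> U" unfolding carrier_LM by blast
  then show "\<zero>\<^bsub>LM\<^esub> \<oplus>\<^bsub>LM\<^esub> x = x"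
    using U_carrier[OF x(3)] U_one by (simp add: zero_LM add_LM)
qed

end

lemma self_algebra_simps [simp]:
  "carrier (self_algebra S) = carrier S" "x \<otimes>\<^bsub>self_algebra S\<^esub> y = x \<otimes>\<^bsub>S\<^esub> y" "\<one>\<^bsub>self_algebra S\<^esub> = \<one>\<^bsub>S\<^esub>"
  "\<zero>\<^bsub>self_algebra S\<^esub> = \<zero>\<^bsub>S\<^esub>" "x \<oplus>\<^bsub>self_algebra S\<^esub> y = x \<oplus>\<^bsub>S\<^esub> y" "x \<odot>\<^bsub>self_algebra S\<^esub> y = x \<otimes>\<^bsub>S\<^esub> y"
  by (simp_all add: self_algebra_def)

lemma finsum_self_algebra: "finsum (self_algebra S) f I = finsum S f I"
  by (simp add: finsum_def finprod_def self_algebra_def)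

lemma a_inv_self_algebra: "\<ominus>\<^bsub>self_algebra S\<^esub> x = \<ominus>\<^bsub>S\<^esub> x"
  by (simp add: a_inv_def m_inv_def self_algebra_def)

lemma (in cring) cring_self_algebra: "cring (self_algebra R)"
proof (rule cringI)
  show "abelian_group (self_algebra R)"
    by (rule abelian_groupI) (auto simp: a_ac intro!: bexI[of _ "\<ominus> _"] l_neg)
  show "Group.comm_monoid (self_algebra R)"
    by (rule comm_monoidI) (auto simp: m_ac)
qed (simp add: l_distr)

lemma (in cring) module_self_algebra: "module R (self_algebra R)"
proof -
  interpret A: cring "self_algebra R" by (rule cring_self_algebra)
  show ?thesis
    by (rule moduleI) (auto simp: l_distr r_distr m_assoc is_cring A.abelian_group_axioms)
qed

context module_localization
begin

interpretation self: module_localization R "self_algebra R" U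
  by (intro module_localization.intro R.module_self_algebra module_localization_axioms.intro U U_one U_mult)

abbreviation "LR \<equiv> localization R U (self_algebra R)"

lemma smult_LM:
  assumes a: "a \<in> carrier R" "s \<in> U" and m: "m \<in> carrier M" "t \<in> U"
  shows "self.fr a s \<odot>\<^bsub>LM\<^esub> fr m t = fr (a \<odot>\<^bsub>M\<^esub> m) (s \<otimes> t)"
proof -
  have "fr (a' \<odot>\<^bsub>M\<^esub> m') (s' \<otimes> t') = fr (a \<odot>\<^bsub>M\<^esub> m) (s \<otimes> t)"
    if mem: "(a', s') \<in> self.fr a s" "(m', t') \<in> fr m t" for a' s' m' t'
  proof -
    have a': "a' \<in> carrier R" "s' \<in> U" "self.fr a' s' = self.fr a s"
      using self.frac_memD[OF mem(1)] a by auto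
    note m' = frac_memD[OF mem(2) m]
    obtain u where u: "u \<in> U" "(u \<otimes> s) \<otimes> a' = (u \<otimes> s') \<otimes> a"
      using self.frac_eqD[of a' s' a s] a' by auto
    obtain v where v: "v \<in> U" "(v \<otimes> t) \<odot>\<^bsub>M\<^esub> m' = (v \<otimes> t') \<odot>\<^bsub>M\<^esub> m"
      using frac_eqD[OF m'(1,2,3)] by blast
    note c = U_carrier[OF a(2)] U_carrier[OF m(2)] U_carrier[OF a'(2)] U_carrier[OF m'(2)]
      U_carrier[OF u(1)] U_carrier[OF v(1)]
    have "(u \<otimes> v \<otimes> (s \<otimes> t)) \<odot>\<^bsub>M\<^esub> (a' \<odot>\<^bsub>M\<^esub> m')
        = ((u \<otimes> s) \<otimes> a') \<odot>\<^bsub>M\<^esub> ((v \<otimes> t) \<odot>\<^bsub>M\<^esub> m')"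
      using c a' m' by (simp add: smult_assoc1[symmetric] R.m_ac)
    also have "\<dots> = ((u \<otimes> s') \<otimes> a) \<odot>\<^bsub>M\<^esub> ((v \<otimes> t') \<odot>\<^bsub>M\<^esub> m)" by (simp only: u(2) v(2))
    also have "\<dots> = (u \<otimes> v \<otimes> (s' \<otimes> t')) \<odot>\<^bsub>M\<^esub> (a \<odot>\<^bsub>M\<^esub> m)"
      using c a m by (simp add: smult_assoc1[symmetric] R.m_ac)
    finally show ?thesis
      using c a m a' m' u v by (intro frac_eqI[where u = "u \<otimes> v"]) (auto intro: U_mult)
  qed
  moreover have mem: "(a, s) \<in> self.fr a s" using self.frac_self[of a s] a by simp
  ultimately have "(\<Union>(a, s)\<in>self.fr a s. \<Union>(m, t)\<in>fr m t. fr (a \<odot>\<^bsub>M\<^esub> m) (s \<otimes> t))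
      = fr (a \<odot>\<^bsub>M\<^esub> m) (s \<otimes> t)"
    using mem frac_self[OF m] by fast
  then show ?thesis by (simp add: localization_def)
qed

text \<open>A criterion with denominators cleared: generation and independence are required over
  \<open>R\<close> up to a factor in \<open>U\<close>. Independence compares two combinations, since
  on the localization only an abelian monoid has been established.\<close>

lemma free_of_rank_2:
  assumes b: "b0 \<in> carrier M" "b1 \<in> carrier M"
    and span: "\<And>x. x \<in> carrier M \<Longrightarrow> \<exists>u\<in>U. \<exists>a0\<in>carrier R. \<exists>a1\<in>carrier R. u \<odot>\<^bsub>M\<^esub> x = a0 \<odot>\<^bsub>M\<^esub> b0 \<oplus>\<^bsub>M\<^esub> a1 \<odot>\<^bsub>M\<^esub> b1"
    and indep: "\<And>a0 a1 a0' a1'. a0 \<in> carrier R \<Longrightarrow> a1 \<in> carrier R \<Longrightarrow> a0' \<in> carrier R \<Longrightarrow> a1' \<in> carrier R \<Longrightarrow>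
      a0 \<odot>\<^bsub>M\<^esub> b0 \<oplus>\<^bsub>M\<^esub> a1 \<odot>\<^bsub>M\<^esub> b1 = a0' \<odot>\<^bsub>M\<^esub> b0 \<oplus>\<^bsub>M\<^esub> a1' \<odot>\<^bsub>M\<^esub> b1 \<Longrightarrow>
      \<exists>u\<in>U. u \<otimes> a0 = u \<otimes> a0' \<and> u \<otimes> a1 = u \<otimes> a1'"
  shows "free_of_rank LR LM 2"
proof -
  interpret L: abelian_monoid LM by (rule comm_monoid_LM)
  define b where "b i = (if i = (0::nat) then fr b0 \<one> else fr b1 \<one>)" for i
  have b_closed: "b i \<in> carrier LM" for i
    using assms U_one by (auto simp: b_def carrier_LM)
  have LRc: "carrier LR = {self.fr a s |a s. a \<in> carrier R \<and> s \<in> U}"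
    using self.carrier_LM by simp
  have smult_b: "self.fr a s \<odot>\<^bsub>LM\<^esub> b i = fr (a \<odot>\<^bsub>M\<^esub> (if i = 0 then b0 else b1)) s"
    if "a \<in> carrier R" "s \<in> U" for a s i
    using that smult_LM U_one U_carrier assms(1,2) by (simp add: b_def)
  have sum2: "(\<Oplus>\<^bsub>LM\<^esub>i\<in>{..<2}. c i \<odot>\<^bsub>LM\<^esub> b i)
      = fr ((s1 \<otimes> a0) \<odot>\<^bsub>M\<^esub> b0 \<oplus>\<^bsub>M\<^esub> (s0 \<otimes> a1) \<odot>\<^bsub>M\<^esub> b1) (s0 \<otimes> s1)"
    if "c 0 = self.fr a0 s0" "c 1 = self.fr a1 s1" "a0 \<in> carrier R" "a1 \<in> carrier R" "s0 \<in> U" "s1 \<in> U"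
    for c :: "nat \<Rightarrow> _" and a0 a1 s0 s1
  proof -
    have two: "{..<2::nat} = {0, 1}" by auto
    have cl: "fr (a0 \<odot>\<^bsub>M\<^esub> b0) s0 \<in> carrier LM" "fr (a1 \<odot>\<^bsub>M\<^esub> b1) s1 \<in> carrier LM"
      using that b by (auto simp: carrier_LM)
    have s0: "c 0 \<odot>\<^bsub>LM\<^esub> b 0 = fr (a0 \<odot>\<^bsub>M\<^esub> b0) s0" and s1: "c 1 \<odot>\<^bsub>LM\<^esub> b 1 = fr (a1 \<odot>\<^bsub>M\<^esub> b1) s1"
      using that smult_b by auto
    have "(\<Oplus>\<^bsub>LM\<^esub>i\<in>{..<2}. c i \<odot>\<^bsub>LM\<^esub> b i) = c 0 \<odot>\<^bsub>LM\<^esub> b 0 \<oplus>\<^bsub>LM\<^esub> c 1 \<odot>\<^bsub>LM\<^esub> b 1"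
      unfolding two using s0 s1 cl by (simp add: L.finsum_insert)
    also have "\<dots> = fr ((s1 \<otimes> a0) \<odot>\<^bsub>M\<^esub> b0 \<oplus>\<^bsub>M\<^esub> (s0 \<otimes> a1) \<odot>\<^bsub>M\<^esub> b1) (s0 \<otimes> s1)"
      unfolding s0 s1 using that b U_carrier by (simp add: add_LM smult_assoc1)
    finally show ?thesis .
  qed
  show ?thesis
    unfolding free_of_rank_def
  proof (intro bexI[of _ b] ballI ex_ex1I)
    show "b \<in> {..<2} \<rightarrow> carrier LM" using b_closed by auto
    fix x assume "x \<in> carrier LM"
    then obtain m s where x: "x = fr m s" "m \<in> carrier M" "s \<in> U" unfolding carrier_LM by blast
    obtain u a0 a1 where u: "u \<in> U" "a0 \<in> carrier R" "a1 \<in> carrier R"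
      "u \<odot>\<^bsub>M\<^esub> m = a0 \<odot>\<^bsub>M\<^esub> b0 \<oplus>\<^bsub>M\<^esub> a1 \<odot>\<^bsub>M\<^esub> b1"
      using span[OF x(2)] by blast
    \<comment> \<open>The fraction \<open>m/s\<close> equals \<open>(u m)/(u s)\<close>, which gives
      both coefficients the same denominator.\<close>
    let ?t = "u \<otimes> s"
    have t: "?t \<in> U" using U_mult u x by blast
    define c where "c = (\<lambda>i\<in>{..<2::nat}. self.fr (if i = 0 then a0 else a1) ?t)"
    have "(\<Oplus>\<^bsub>LM\<^esub>i\<in>{..<2}. c i \<odot>\<^bsub>LM\<^esub> b i)
        = fr ((?t \<otimes> a0) \<odot>\<^bsub>M\<^esub> b0 \<oplus>\<^bsub>M\<^esub> (?t \<otimes> a1) \<odot>\<^bsub>M\<^esub> b1) (?t \<otimes> ?t)"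
      by (rule sum2) (use u t in \<open>auto simp: c_def\<close>)
    also have "\<dots> = fr (?t \<odot>\<^bsub>M\<^esub> (u \<odot>\<^bsub>M\<^esub> m)) (?t \<otimes> ?t)"
      unfolding u(4) using u b t U_carrier by (simp add: smult_r_distr smult_assoc1)
    also have "\<dots> = x"
      using frac_cancel[of "u \<odot>\<^bsub>M\<^esub> m" ?t ?t] frac_cancel[OF x(2,3) u(1)] x u t b U_carrier by simp
    finally have "x = (\<Oplus>\<^bsub>LM\<^esub>i\<in>{..<2}. c i \<odot>\<^bsub>LM\<^esub> b i)" by simp
    moreover have "c i \<in> carrier LR" if "i < 2" for i
      unfolding LRc c_def using that u(2,3) t by (cases "i = 0") auto
    then have "c \<in> {..<2} \<rightarrow>\<^sub>E carrier LR" by (auto simp: PiE_iff c_def)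
    ultimately show "\<exists>c. c \<in> {..<2} \<rightarrow>\<^sub>E carrier LR \<and> x = (\<Oplus>\<^bsub>LM\<^esub>i\<in>{..<2}. c i \<odot>\<^bsub>LM\<^esub> b i)" by blast
  next
    fix x c c'
    assume c: "c \<in> {..<2} \<rightarrow>\<^sub>E carrier LR \<and> x = (\<Oplus>\<^bsub>LM\<^esub>i\<in>{..<2}. c i \<odot>\<^bsub>LM\<^esub> b i)"
      and c': "c' \<in> {..<2} \<rightarrow>\<^sub>E carrier LR \<and> x = (\<Oplus>\<^bsub>LM\<^esub>i\<in>{..<2}. c' i \<odot>\<^bsub>LM\<^esub> b i)"
    have mem: "c 0 \<in> carrier LR" "c 1 \<in> carrier LR" "c' 0 \<in> carrier LR" "c' 1 \<in> carrier LR"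
      using c c' by (auto simp: PiE_iff)
    obtain a0 s0 where 0: "c 0 = self.fr a0 s0" "a0 \<in> carrier R" "s0 \<in> U" using mem(1) unfolding LRc by blast
    obtain a1 s1 where 1: "c 1 = self.fr a1 s1" "a1 \<in> carrier R" "s1 \<in> U" using mem(2) unfolding LRc by blast
    obtain a0' s0' where 2: "c' 0 = self.fr a0' s0'" "a0' \<in> carrier R" "s0' \<in> U" using mem(3) unfolding LRc by blast
    obtain a1' s1' where 3: "c' 1 = self.fr a1' s1'" "a1' \<in> carrier R" "s1' \<in> U" using mem(4) unfolding LRc by blast
    note cc = U_carrier[OF 0(3)] U_carrier[OF 1(3)] U_carrier[OF 2(3)] U_carrier[OF 3(3)]
    have "fr ((s1 \<otimes> a0) \<odot>\<^bsub>M\<^esub> b0 \<oplus>\<^bsub>M\<^esub> (s0 \<otimes> a1) \<odot>\<^bsub>M\<^esub> b1) (s0 \<otimes> s1)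
        = fr ((s1' \<otimes> a0') \<odot>\<^bsub>M\<^esub> b0 \<oplus>\<^bsub>M\<^esub> (s0' \<otimes> a1') \<odot>\<^bsub>M\<^esub> b1) (s0' \<otimes> s1')"
      using c c' sum2[of c a0 s0 a1 s1] sum2[of c' a0' s0' a1' s1'] 0 1 2 3 by simp
    then obtain w where w: "w \<in> U"
      "(w \<otimes> (s0' \<otimes> s1')) \<odot>\<^bsub>M\<^esub> ((s1 \<otimes> a0) \<odot>\<^bsub>M\<^esub> b0 \<oplus>\<^bsub>M\<^esub> (s0 \<otimes> a1) \<odot>\<^bsub>M\<^esub> b1)
        = (w \<otimes> (s0 \<otimes> s1)) \<odot>\<^bsub>M\<^esub> ((s1' \<otimes> a0') \<odot>\<^bsub>M\<^esub> b0 \<oplus>\<^bsub>M\<^esub> (s0' \<otimes> a1') \<odot>\<^bsub>M\<^esub> b1)"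
      by (rule frac_eqD[rotated 2]) (use 0 1 b U_mult cc in auto)
    note wc = U_carrier[OF w(1)]
    have eq: "(w \<otimes> s0' \<otimes> s1' \<otimes> s1 \<otimes> a0) \<odot>\<^bsub>M\<^esub> b0 \<oplus>\<^bsub>M\<^esub> (w \<otimes> s0' \<otimes> s1' \<otimes> s0 \<otimes> a1) \<odot>\<^bsub>M\<^esub> b1
        = (w \<otimes> s0 \<otimes> s1 \<otimes> s1' \<otimes> a0') \<odot>\<^bsub>M\<^esub> b0 \<oplus>\<^bsub>M\<^esub> (w \<otimes> s0 \<otimes> s1 \<otimes> s0' \<otimes> a1') \<odot>\<^bsub>M\<^esub> b1"
      using w(2) wc cc 0 1 2 3 b by (simp add: smult_r_distr smult_assoc1[symmetric] R.m_assoc)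
    obtain u where u: "u \<in> U"
      "u \<otimes> (w \<otimes> s0' \<otimes> s1' \<otimes> s1 \<otimes> a0) = u \<otimes> (w \<otimes> s0 \<otimes> s1 \<otimes> s1' \<otimes> a0')"
      "u \<otimes> (w \<otimes> s0' \<otimes> s1' \<otimes> s0 \<otimes> a1) = u \<otimes> (w \<otimes> s0 \<otimes> s1 \<otimes> s0' \<otimes> a1')"
      using indep[OF _ _ _ _ eq] wc cc 0 1 2 3 by auto
    note uc = U_carrier[OF u(1)]
    \<comment> \<open>The factors \<open>w\<close>, \<open>s1\<close> and \<open>s1'\<close> occur
      on both sides of the equation for the first coefficient and are absorbed into the witness. The
      second coefficient is treated in the same way with \<open>s0\<close> and
      \<open>s0'\<close>.\<close>
    have "self.fr a0 s0 = self.fr a0' s0'"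
    proof (rule self.frac_eqI)
      show "u \<otimes> (w \<otimes> s1 \<otimes> s1') \<in> U" by (intro U_mult u(1) w(1) 1(3) 3(3))
      show "(u \<otimes> (w \<otimes> s1 \<otimes> s1') \<otimes> s0') \<odot>\<^bsub>self_algebra R\<^esub> a0
          = (u \<otimes> (w \<otimes> s1 \<otimes> s1') \<otimes> s0) \<odot>\<^bsub>self_algebra R\<^esub> a0'"
        using u(2) uc wc cc 0 2 by (simp add: R.m_ac)
    qed (use 0 2 in auto)
    moreover have "self.fr a1 s1 = self.fr a1' s1'"
    proof (rule self.frac_eqI)
      show "u \<otimes> (w \<otimes> s0 \<otimes> s0') \<in> U" by (intro U_mult u(1) w(1) 0(3) 2(3))
      show "(u \<otimes> (w \<otimes> s0 \<otimes> s0') \<otimes> s1') \<odot>\<^bsub>self_algebra R\<^esub> a1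
          = (u \<otimes> (w \<otimes> s0 \<otimes> s0') \<otimes> s1) \<odot>\<^bsub>self_algebra R\<^esub> a1'"
        using u(3) uc wc cc 1 3 by (simp add: R.m_ac)
    qed (use 1 3 in auto)
    ultimately have "c 0 = c' 0" "c 1 = c' 1" using 0 1 2 3 by auto
    then have "c i = c' i" if "i < 2" for i using that by (auto simp: less_2_cases_iff)
    then show "c = c'" using c c' by (intro PiE_ext[of c "{..<2}" _ c']) auto
  qed
qed

end

section \<open>Rings with an antipodal involution\<close>

text \<open>Isolates what is used about the coordinate ring: an involution, an invariant half
  \<open>h\<close> of the unit, and anti-invariant elements whose squares sum to 1. Polynomials play
  no part in this section.\<close>

locale sphere_involution = S: cring S for S :: "('b, 'm) ring_scheme" (structure) +
  fixes \<sigma> :: "'b \<Rightarrow> 'b" and h :: 'b and n :: nat and z :: "nat \<Rightarrow> 'b"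
  assumes \<sigma>_hom: "\<sigma> \<in> Ring.ring_hom S S" and \<sigma>_\<sigma>: "x \<in> carrier S \<Longrightarrow> \<sigma> (\<sigma> x) = x"
    and h: "h \<in> carrier S" "\<sigma> h = h" "h \<oplus> h = \<one>"
    and z: "i < n \<Longrightarrow> z i \<in> carrier S" "i < n \<Longrightarrow> \<sigma> (z i) = \<ominus> z i"
    and sphere: "(\<Oplus>i\<in>{..<n}. z i \<otimes> z i) = \<one>"
begin

definition R :: "('b, 'm) ring_scheme" where "R = S\<lparr>carrier := {x \<in> carrier S. \<sigma> x = x}\<rparr>"

abbreviation A :: "('b, 'b) module" where "A \<equiv> self_algebra S"

lemma R_simps [simp]:
  "carrier R = {x \<in> carrier S. \<sigma> x = x}" "x \<otimes>\<^bsub>R\<^esub> y = x \<otimes> y" "x \<oplus>\<^bsub>R\<^esub> y = x \<oplus> y"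
  "\<one>\<^bsub>R\<^esub> = \<one>" "\<zero>\<^bsub>R\<^esub> = \<zero>"
  by (simp_all add: R_def)

interpretation \<sigma>: ring_hom_cring S S \<sigma>
  by (intro ring_hom_cring.intro ring_hom_cring_axioms.intro \<sigma>_hom S.is_cring)

lemma fixed_subcring: "subcring {x \<in> carrier S. \<sigma> x = x} S"
  by (rule S.subcringI'[OF S.subringI]) auto

sublocale R: cring R
  using S.subcring_iff[of "{x \<in> carrier S. \<sigma> x = x}"] fixed_subcring by (auto simp: R_def)

sublocale A: cring A by (rule S.cring_self_algebra)

sublocale alg: algebra R A
  by (rule algebraI)
    (auto simp: R.is_cring A.is_cring S.l_distr S.r_distr S.m_assoc)

definition tr :: "'b \<Rightarrow> 'b" where "tr x = h \<otimes> (x \<oplus> \<sigma> x)"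
definition od :: "'b \<Rightarrow> 'b" where "od x = h \<otimes> (x \<ominus> \<sigma> x)"
text \<open>The default value \<open>\<one>\<close> is taken at the index \<open>n\<close>, so that
  \<open>e\<close> has \<open>n + 1\<close> members in use: the last one accounts for even parts,
  the \<open>z i\<close> account for odd parts.\<close>

definition e :: "nat \<Rightarrow> 'b" where "e i = (if i < n then z i else \<one>)"

lemma e_closed: "e i \<in> carrier S" using z by (simp add: e_def)

lemma tr_fixed: "x \<in> carrier S \<Longrightarrow> tr x \<in> carrier R"
  using h by (simp add: tr_def \<sigma>_\<sigma> S.a_comm)

lemma od_closed: "x \<in> carrier S \<Longrightarrow> od x \<in> carrier S"
  using h by (simp add: od_def)

lemma \<sigma>_od: "x \<in> carrier S \<Longrightarrow> \<sigma> (od x) = \<ominus> od x"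
  using h by (simp add: od_def \<sigma>_\<sigma> a_minus_def S.r_minus[symmetric] S.minus_add S.a_comm)

lemma decompose: assumes "x \<in> carrier S" shows "tr x \<oplus> od x = x"
proof -
  have "tr x \<oplus> od x = h \<otimes> ((x \<oplus> \<sigma> x) \<oplus> (x \<ominus> \<sigma> x))"
    using assms h by (simp add: tr_def od_def S.r_distr)
  also have "(x \<oplus> \<sigma> x) \<oplus> (x \<ominus> \<sigma> x) = (x \<oplus> x) \<oplus> (\<sigma> x \<ominus> \<sigma> x)"
    using assms by (simp add: a_minus_def S.a_ac)
  also have "h \<otimes> \<dots> = (h \<oplus> h) \<otimes> x"
    using assms h(1) by (simp add: a_minus_def S.r_neg S.r_distr S.l_distr)
  finally show ?thesis using assms h by simp
qed

text \<open>Since \<open>z i\<close> changes sign under \<open>\<sigma>\<close>, multiplication by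
  it exchanges even and odd parts.\<close>

lemma tr_z: assumes "i < n" "x \<in> carrier S" shows "tr (z i \<otimes> x) = z i \<otimes> od x"
proof -
  have "z i \<otimes> x \<oplus> \<sigma> (z i \<otimes> x) = z i \<otimes> (x \<ominus> \<sigma> x)"
    using assms z by (simp add: a_minus_def S.r_distr S.l_minus S.r_minus)
  then show ?thesis using assms z h by (simp add: tr_def od_def S.m_lcomm)
qed

lemma sum_e:
  assumes "\<And>i. i \<le> n \<Longrightarrow> f i \<in> carrier S"
  shows "(\<Oplus>i\<in>{..<Suc n}. f i) = f n \<oplus> (\<Oplus>i\<in>{..<n}. f i)"
proof -
  have "{..<Suc n} = insert n {..<n}" by auto
  then show ?thesis using assms by (simp add: S.finsum_insert Pi_iff)
qed

text \<open>The unit contributes \<open>tr x\<close>; each \<open>z i\<close> contributes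
  \<open>z i * z i * od x\<close>, and the sphere equation sums these to
  \<open>od x\<close>.\<close>

lemma expand:
  assumes x: "x \<in> carrier S"
  shows "(\<Oplus>i\<in>{..<Suc n}. tr (e i \<otimes> x) \<otimes> e i) = x"
proof -
  have "(\<Oplus>i\<in>{..<Suc n}. tr (e i \<otimes> x) \<otimes> e i)
      = tr (e n \<otimes> x) \<otimes> e n \<oplus> (\<Oplus>i\<in>{..<n}. tr (e i \<otimes> x) \<otimes> e i)"
    using tr_fixed e_closed x by (intro sum_e) auto
  also have "tr (e n \<otimes> x) \<otimes> e n = tr x" using tr_fixed x by (simp add: e_def)
  also have "(\<Oplus>i\<in>{..<n}. tr (e i \<otimes> x) \<otimes> e i) = (\<Oplus>i\<in>{..<n}. z i \<otimes> z i \<otimes> od x)"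
  proof (intro S.finsum_cong' refl)
    fix i assume "i \<in> {..<n}"
    then show "tr (e i \<otimes> x) \<otimes> e i = z i \<otimes> z i \<otimes> od x"
      using z od_closed[OF x] tr_z[OF _ x, of i] by (simp add: e_def S.m_ac)
  qed (use z od_closed[OF x] in auto)
  also have "\<dots> = (\<Oplus>i\<in>{..<n}. z i \<otimes> z i) \<otimes> od x"
    using z od_closed[OF x] by (intro S.finsum_ldistr[symmetric]) auto
  finally show ?thesis using sphere od_closed[OF x] decompose[OF x] by simp
qed

sublocale trace_form R A "Suc n" e tr
proof
  show "tr x \<in> carrier R" if "x \<in> carrier A" for x using that tr_fixed by simp
  show "tr (x \<oplus>\<^bsub>A\<^esub> y) = tr x \<oplus>\<^bsub>R\<^esub> tr y" if "x \<in> carrier A" "y \<in> carrier A" for x y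
    using that h by (simp add: tr_def S.r_distr[symmetric] S.a_ac)
  show "tr (a \<odot>\<^bsub>A\<^esub> x) = a \<otimes>\<^bsub>R\<^esub> tr x" if "a \<in> carrier R" "x \<in> carrier A" for a x
    using that h by (simp add: tr_def S.r_distr S.m_ac)
  show "(\<Oplus>\<^bsub>A\<^esub>i\<in>{..<Suc n}. tr (e i \<otimes>\<^bsub>A\<^esub> x) \<odot>\<^bsub>A\<^esub> e i) = x" if "x \<in> carrier A" for x
    using that expand by (simp only: finsum_self_algebra self_algebra_simps)
qed (simp add: e_closed)

text \<open>The squares of the \<open>e i\<close> sum to 1 from the \<open>z i\<close> plus 1 from
  the unit, that is to 2, and \<open>h\<close> is its inverse.\<close>

lemma separable_S: "separable_algebra R A"
proof (rule separable)
  show "h \<in> carrier A" using h by simp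
  have "(\<Oplus>i\<in>{..<Suc n}. h \<otimes> e i \<otimes> e i) = h \<otimes> e n \<otimes> e n \<oplus> (\<Oplus>i\<in>{..<n}. h \<otimes> e i \<otimes> e i)"
    using h e_closed by (intro sum_e) auto
  also have "(\<Oplus>i\<in>{..<n}. h \<otimes> e i \<otimes> e i) = (\<Oplus>i\<in>{..<n}. h \<otimes> (z i \<otimes> z i))"
    using h z by (intro S.finsum_cong') (auto simp: e_def S.m_assoc)
  also have "\<dots> = h \<otimes> (\<Oplus>i\<in>{..<n}. z i \<otimes> z i)"
    using h z by (intro S.finsum_rdistr[symmetric]) auto
  finally show "(\<Oplus>\<^bsub>A\<^esub>i\<in>{..<Suc n}. h \<otimes>\<^bsub>A\<^esub> e i \<otimes>\<^bsub>A\<^esub> e i) = \<one>\<^bsub>A\<^esub>"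
    using sphere h by (simp only: finsum_self_algebra self_algebra_simps) (simp add: e_def)
qed

text \<open>If all \<open>z i * z i\<close> belonged to the prime \<open>p\<close>, so would their
  sum 1. For an index with \<open>z i * z i\<close> outside \<open>p\<close>, this square becomes a
  denominator.\<close>

lemma rank_2: "has_constant_rank R A 2"
  unfolding has_constant_rank_def
proof (intro allI impI)
  fix p assume p: "primeideal p R"
  interpret p: primeideal p R by (rule p)
  have one: "\<one> \<notin> p"
    using p.I_notcarr p.one_imp_carrier by auto
  obtain i where i: "i < n" "z i \<otimes> z i \<notin> p"
  proof -
    have False if all: "\<And>i. i < n \<Longrightarrow> z i \<otimes> z i \<in> p"
    proof -
    have "(\<Oplus>i\<in>I. z i \<otimes> z i) \<in> p" if "finite I" "I \<subseteq> {..<n}" for I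
      using that
    proof (induction I)
      case empty
      then show ?case using p.zero_closed by simp
    next
      case (insert k I)
      have "(\<Oplus>i\<in>insert k I. z i \<otimes> z i) = z k \<otimes> z k \<oplus> (\<Oplus>i\<in>I. z i \<otimes> z i)"
        using insert z by (intro S.finsum_insert) auto
      then show ?case using insert all p.a_closed by auto
    qed
    then show False using sphere one by (metis finite_lessThan order_refl)
    qed
    then show thesis using that by blast
  qed
  let ?U = "carrier R - p" and ?u = "z i \<otimes> z i"
  note zi = z[OF i(1)]
  have u: "?u \<in> ?U" using i zi by (simp add: S.l_minus S.r_minus)
  interpret L: module_localization R A ?U
  proof (intro module_localization.intro module_A module_localization_axioms.intro)
    show "\<one>\<^bsub>R\<^esub> \<in> ?U" using one by simp
    show "a \<otimes>\<^bsub>R\<^esub> b \<in> ?U" if "a \<in> ?U" "b \<in> ?U" for a b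
      using that p.I_prime[of a b] R.m_closed[of a b] by blast
  qed blast
  show "free_of_rank (localization R ?U (self_algebra R)) (localization R ?U A) 2"
  proof (rule L.free_of_rank_2)
    show "\<one> \<in> carrier A" "z i \<in> carrier A" using zi by auto
    fix x assume "x \<in> carrier A"
    then have x: "x \<in> carrier S" by simp
    \<comment> \<open>After multiplication by the square, the odd part is the invariant
      \<open>z i * od x\<close> times \<open>z i\<close>; this is where the denominator is
      spent.\<close>
    have "?u \<otimes> x = ?u \<otimes> (tr x \<oplus> od x)" using decompose[OF x] by simp
    also have "\<dots> = (?u \<otimes> tr x) \<otimes> \<one> \<oplus> (z i \<otimes> od x) \<otimes> z i"
      using zi tr_fixed[OF x] od_closed[OF x] by (simp add: S.r_distr S.m_ac)
    finally have "?u \<odot>\<^bsub>A\<^esub> x = (?u \<otimes> tr x) \<odot>\<^bsub>A\<^esub> \<one> \<oplus>\<^bsub>A\<^esub> (z i \<otimes> od x) \<odot>\<^bsub>A\<^esub> z i" by simp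
    moreover have "?u \<otimes> tr x \<in> carrier R" using u tr_fixed[OF x] by auto
    moreover have "z i \<otimes> od x \<in> carrier R"
      using zi od_closed[OF x] \<sigma>_od[OF x] by (simp add: S.l_minus S.r_minus)
    ultimately show "\<exists>u\<in>?U. \<exists>a0\<in>carrier R. \<exists>a1\<in>carrier R. u \<odot>\<^bsub>A\<^esub> x = a0 \<odot>\<^bsub>A\<^esub> \<one> \<oplus>\<^bsub>A\<^esub> a1 \<odot>\<^bsub>A\<^esub> z i"
      using u by blast
  next
    fix a0 a1 a0' a1'
    assume "a0 \<in> carrier R" "a1 \<in> carrier R" "a0' \<in> carrier R" "a1' \<in> carrier R"
      and "a0 \<odot>\<^bsub>A\<^esub> \<one> \<oplus>\<^bsub>A\<^esub> a1 \<odot>\<^bsub>A\<^esub> z i = a0' \<odot>\<^bsub>A\<^esub> \<one> \<oplus>\<^bsub>A\<^esub> a1' \<odot>\<^bsub>A\<^esub> z i"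
    then have c: "a0 \<in> carrier S" "a1 \<in> carrier S" "a0' \<in> carrier S" "a1' \<in> carrier S"
      and fixed: "\<sigma> a0 = a0" "\<sigma> a1 = a1" "\<sigma> a0' = a0'" "\<sigma> a1' = a1'"
      and eq: "a0 \<oplus> a1 \<otimes> z i = a0' \<oplus> a1' \<otimes> z i" by simp_all
    \<comment> \<open>The averaging map kills \<open>a * z i\<close> for invariant \<open>a\<close>,
      so it reads off the coefficient of the unit.\<close>
    have half: "tr (b \<oplus> a \<otimes> z i) = b" if ab: "a \<in> carrier S" "b \<in> carrier S" "\<sigma> a = a" "\<sigma> b = b" for a b
    proof -
      have "(b \<oplus> a \<otimes> z i) \<oplus> \<sigma> (b \<oplus> a \<otimes> z i)
          = (b \<oplus> b) \<oplus> (a \<otimes> z i \<oplus> \<ominus> (a \<otimes> z i))"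
        using ab zi by (simp add: S.r_minus S.a_ac)
      also have "\<dots> = b \<oplus> b" using ab zi by (simp add: S.r_neg)
      finally show ?thesis
        using h ab(2) S.l_distr[OF h(1) h(1) ab(2)] by (simp add: tr_def S.r_distr)
    qed
    have a0: "a0 = a0'"
      using half[of a1 a0] half[of a1' a0'] c fixed eq by simp
    then have "a1 \<otimes> z i = a1' \<otimes> z i"
      using eq c zi S.add.l_cancel[of a0 "a1 \<otimes> z i" "a1' \<otimes> z i"] by simp
    \<comment> \<open>\<open>z i\<close> is not in \<open>R\<close>; a second factor
      \<open>z i\<close> turns the equation into one with the admissible multiplier
      \<open>?u\<close>.\<close>
    then have "z i \<otimes> (a1 \<otimes> z i) = z i \<otimes> (a1' \<otimes> z i)" by simp
    then have "?u \<otimes> a1 = ?u \<otimes> a1'" using c zi by (simp add: S.m_ac)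
    then show "\<exists>u\<in>?U. u \<otimes>\<^bsub>R\<^esub> a0 = u \<otimes>\<^bsub>R\<^esub> a0' \<and> u \<otimes>\<^bsub>R\<^esub> a1 = u \<otimes>\<^bsub>R\<^esub> a1'"
      using u a0 by (intro bexI[of _ ?u]) auto
  qed
qed

theorem quadratic_etale: "quadratic_etale_algebra tm tn R A"
  unfolding quadratic_etale_algebra_def etale_algebra_def
  using alg.algebra_axioms flat separable_S finitely_presented projective rank_2 by blast

end

section \<open>The real sphere\<close>

lemma (in cring) algebra_mpoly_algebra:
  fixes I :: "'i set"
  shows "algebra R (mpoly_algebra R I)"
proof -
  have smult: "(\<lambda>m. a \<otimes> f m) = (\<lambda>m. f m \<otimes> a)" if "a \<in> carrier R" "f \<in> indexed_pset I (carrier R)"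
    for a and f :: "'i multiset \<Rightarrow> 'a"
    using that indexed_psetD(1)[of f I] by (intro ext) (simp add: m_comm)
  show ?thesis
  proof (rule algebraI[OF is_cring cring_mpoly_algebra]; unfold mpoly_algebra_simps)
    fix a b and f g :: "'i multiset \<Rightarrow> 'a"
    assume a: "a \<in> carrier R" and f: "f \<in> indexed_pset I (carrier R)"
    note F = indexed_psetD(1)[OF f]
    show "(\<lambda>m. a \<otimes> f m) \<in> indexed_pset I (carrier R)"
      unfolding smult[OF a f] by (rule pset_closed_smult[OF f a])
    show "(\<lambda>m. (a \<oplus> b) \<otimes> f m) = indexed_padd (\<lambda>m. a \<otimes> f m) (\<lambda>m. b \<otimes> f m)" if "b \<in> carrier R"
      using that a F by (intro ext) (simp add: indexed_padd_def l_distr)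
    show "(\<lambda>m. (a \<otimes> b) \<otimes> f m) = (\<lambda>m. a \<otimes> (b \<otimes> f m))" if "b \<in> carrier R"
      using that a F by (intro ext) (simp add: m_assoc)
    assume g: "g \<in> indexed_pset I (carrier R)"
    note G = indexed_psetD(1)[OF g]
    show "(\<lambda>m. a \<otimes> indexed_padd f g m) = indexed_padd (\<lambda>m. a \<otimes> f m) (\<lambda>m. a \<otimes> g m)"
      using a F G by (intro ext) (simp add: indexed_padd_def r_distr)
    show "mp_mult (\<lambda>m. a \<otimes> f m) g = (\<lambda>m. a \<otimes> mp_mult f g m)"
      using a F G
      by (intro ext) (simp add: mp_mult_def finsum_rdistr finite_submultisets m_assoc Pi_iff)
  next
    fix f :: "'i multiset \<Rightarrow> 'a" assume "f \<in> indexed_pset I (carrier R)"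
    then show "(\<lambda>m. \<one> \<otimes> f m) = f" using indexed_psetD(1)[of f I] by simp
  qed
qed

section \<open>Real polynomials and their values\<close>

interpretation K: cring real_ring
  by (rule cring_from_type_algebra)

lemma real_ring_simps [simp]:
  "carrier real_ring = UNIV" "x \<otimes>\<^bsub>real_ring\<^esub> y = x * y" "x \<oplus>\<^bsub>real_ring\<^esub> y = x + y"
  "\<one>\<^bsub>real_ring\<^esub> = 1" "\<zero>\<^bsub>real_ring\<^esub> = 0"
  by (simp_all add: ring_of_type_algebra_def)

lemma a_inv_real_ring: "\<ominus>\<^bsub>real_ring\<^esub> x = - x"
  by (rule K.minus_equality) auto

interpretation KA: cring "self_algebra real_ring"
  by (rule K.cring_self_algebra)

lemma finsum_real: "finite I \<Longrightarrow> finsum (self_algebra real_ring) f I = sum f I"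
  by (induction I rule: finite_induct) (simp_all add: KA.finsum_insert)

lemma pow_real: "x [^]\<^bsub>self_algebra real_ring\<^esub> (n::nat) = x ^ n"
  by (induction n) (simp_all add: mult.commute)

lemma finprod_real: "finite I \<Longrightarrow> finprod (self_algebra real_ring) f I = prod f I"
  by (induction I rule: finite_induct) (simp_all add: KA.finprod_insert)

abbreviation eval_at :: "(nat \<Rightarrow> real) \<Rightarrow> real_mpoly \<Rightarrow> real" where
  "eval_at x \<equiv> mpoly_eval real_ring (self_algebra real_ring) x"

lemma algebra_real: "algebra real_ring (self_algebra real_ring)"
  by (rule algebraI) (auto simp: K.is_cring KA.is_cring algebra_simps)

interpretation at: algebra_family real_ring "self_algebra real_ring" I x for I :: "nat set" and x
  by (intro algebra_family.intro K.is_cring KA.is_cring algebra_real algebra_family_axioms.intro) simp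

text \<open>Brings the evaluation into the shape of \<open>peval\<close>, so that the zero found by
  the Borsuk-Ulam theorem can be used.\<close>

lemma eval_at_sum:
  assumes "finite M" "{m. p m \<noteq> 0} \<subseteq> M"
  shows "eval_at x p = (\<Sum>m\<in>M. p m * prod_mset (image_mset x m))"
proof -
  have "finite {m. p m \<noteq> 0}" using assms finite_subset by blast
  then have "eval_at x p = (\<Sum>m\<in>{m. p m \<noteq> 0}. p m * prod_mset (image_mset x m))"
    by (simp add: mpoly_eval_def finsum_real finprod_real pow_real image_prod_mset_multiplicity)
  also have "\<dots> = (\<Sum>m\<in>M. p m * prod_mset (image_mset x m))"
    using assms by (intro sum.mono_neutral_left) auto
  finally show ?thesis .
qed

context
  fixes r :: nat
  notes [simp del] = One_nat_def
begin

abbreviation (input) "P \<equiv> real_mpolys r"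

interpretation P: cring P by (rule K.cring_mpoly_algebra)

lemma P_simps:
  "carrier P = K.indexed_pset {1..r} UNIV"
  "f \<oplus>\<^bsub>P\<^esub> g = (\<lambda>m. f m + g m)"
  "f \<otimes>\<^bsub>P\<^esub> g = K.mp_mult f g"
  "\<zero>\<^bsub>P\<^esub> = (\<lambda>m. 0)"
  "\<one>\<^bsub>P\<^esub> = K.indexed_const 1"
  using K.mpoly_algebra_simps[of "{1..r}"] by (auto simp: K.indexed_padd_def K.indexed_const_def fun_eq_iff)

lemma a_inv_P: "f \<in> carrier P \<Longrightarrow> \<ominus>\<^bsub>P\<^esub> f = (\<lambda>m. - f m)"
proof (rule P.minus_equality)
  assume f: "f \<in> carrier P"
  have "(\<lambda>m. f m * (- 1)) \<in> carrier P"
    using K.pset_closed_smult[of f "{1..r}" "-1"] f by (simp add: P_simps)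
  then show "(\<lambda>m. - f m) \<in> carrier P" by simp
qed (simp_all add: P_simps)

lemma var_P: "i \<in> {1..r} \<Longrightarrow> mvar i \<in> carrier P"
  unfolding P_simps K.indexed_var_def by (intro K.indexed_pset.intros) auto

lemma const_P: "K.indexed_const k \<in> carrier P"
  unfolding P_simps by (intro K.indexed_pset.intros) auto

lemma support_P: "f \<in> carrier P \<Longrightarrow> finite {m. f m \<noteq> 0}" "f \<in> carrier P \<Longrightarrow> f m \<noteq> 0 \<Longrightarrow> set_mset m \<subseteq> {1..r}"
  using K.indexed_psetD[of f "{1..r}"] by (simp_all add: P_simps)

lemma pmult_P:
  assumes "f \<in> carrier P"
  shows "f \<otimes>\<^bsub>P\<^esub> mvar i = K.indexed_pmult f i"
proof -
  have "f \<otimes>\<^bsub>P\<^esub> mvar i = K.indexed_pmult (K.mp_mult f (K.indexed_const 1)) i"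
    unfolding P_simps K.indexed_var_def using K.mp_mult_pmult[of f "K.indexed_const 1" i] by simp
  also have "K.mp_mult f (K.indexed_const 1) = f" using K.mp_mult_const[of f 1] by simp
  finally show ?thesis .
qed

interpretation neg: algebra_family real_ring P "{1..r}" "\<lambda>i. \<ominus>\<^bsub>P\<^esub> mvar i"
  by (intro algebra_family.intro K.is_cring P.is_cring K.algebra_mpoly_algebra algebra_family_axioms.intro)
    (simp add: var_P)

interpretation neg: ring_hom_cring P P "negate_vars r"
  unfolding negate_vars_def by (rule neg.ring_hom_mpoly_eval)

text \<open>Each multiplication by a variable contributes one sign and one unit of degree. The
  explicit form separates even from odd coefficients and shows that the substitution is an
  involution.\<close>

lemma negate_vars_eq: "p \<in> carrier P \<Longrightarrow> negate_vars r p = (\<lambda>m. (- 1) ^ size m * p m)"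
  unfolding P_simps
proof (induction rule: K.indexed_pset.induct)
  case (indexed_const k)
  have "negate_vars r (K.indexed_const k) = k \<odot>\<^bsub>P\<^esub> \<one>\<^bsub>P\<^esub>"
    unfolding negate_vars_def using neg.ev_const[of k] by simp
  also have "\<dots> = (\<lambda>m. (- 1) ^ size m * K.indexed_const k m)"
    by (auto simp: K.mpoly_algebra_simps K.indexed_const_def)
  finally show ?case .
next
  case (indexed_padd p q)
  then have "negate_vars r (p \<oplus>\<^bsub>P\<^esub> q) = negate_vars r p \<oplus>\<^bsub>P\<^esub> negate_vars r q"
    by (intro neg.hom_add) (auto simp: P_simps)
  then show ?case using indexed_padd by (simp add: P_simps K.indexed_padd_def algebra_simps)
next
  case (indexed_pmult p i)
  then have p: "p \<in> carrier P" by (simp add: P_simps)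
  have "negate_vars r (K.indexed_pmult p i) = negate_vars r p \<otimes>\<^bsub>P\<^esub> (\<ominus>\<^bsub>P\<^esub> mvar i)"
    unfolding negate_vars_def using neg.ev_pmult[of p i] indexed_pmult by simp
  also have "\<dots> = \<ominus>\<^bsub>P\<^esub> (K.indexed_pmult (negate_vars r p) i)"
    using p var_P[OF indexed_pmult(2)] by (simp add: P.r_minus pmult_P)
  also have "\<dots> = (\<lambda>m. - K.indexed_pmult (negate_vars r p) i m)"
    using pmult_P[of "negate_vars r p" i] var_P[OF indexed_pmult(2)] p
    by (intro a_inv_P) (metis P.m_closed neg.hom_closed)
  also have "\<dots> = (\<lambda>m. (- 1) ^ size m * K.indexed_pmult p i m)"
  proof
    fix m
    show "- K.indexed_pmult (negate_vars r p) i m = (- 1) ^ size m * K.indexed_pmult p i m"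
    proof (cases "i \<in># m")
      case True
      then have "size m = Suc (size (m - {#i#}))" by (metis size_Suc_Diff1)
      then show ?thesis using True indexed_pmult(3) by (simp add: K.indexed_pmult_def)
    qed (simp add: K.indexed_pmult_def)
  qed
  finally show ?case .
qed

lemma negate_negate:
  assumes p: "p \<in> carrier P"
  shows "negate_vars r (negate_vars r p) = p"
proof
  fix m
  have "negate_vars r (negate_vars r p) m = (- 1) ^ size m * negate_vars r p m"
    by (simp only: negate_vars_eq[OF neg.hom_closed[OF p]])
  also have "negate_vars r p m = (- 1) ^ size m * p m"
    by (simp only: negate_vars_eq[OF p])
  finally show "negate_vars r (negate_vars r p) m = p m" by (cases "even (size m)") simp_all
qed

lemma eval_at_hom: "ring_hom_cring P (self_algebra real_ring) (eval_at x)"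
  by (rule at.ring_hom_mpoly_eval)

lemma eval_at_negate:
  assumes "p \<in> carrier P"
  shows "eval_at x (negate_vars r p) = eval_at (\<lambda>i. - x i) p"
proof -
  let ?M = "{m. p m \<noteq> 0}"
  have "prod_mset (image_mset (\<lambda>i. - x i) m) = (- 1) ^ size m * prod_mset (image_mset x m)" for m
    by (induction m) auto
  then show ?thesis
    using eval_at_sum[of ?M p "\<lambda>i. - x i"] eval_at_sum[of ?M "negate_vars r p" x] support_P(1)[OF assms]
    by (simp add: negate_vars_eq[OF assms] mult_ac)
qed

section \<open>The ideal of the sphere and its quotient ring\<close>

definition sphere_poly :: real_mpoly where
  "sphere_poly = (\<Oplus>\<^bsub>P\<^esub>i\<in>{1..r}. mvar i [^]\<^bsub>P\<^esub> (2::nat)) \<ominus>\<^bsub>P\<^esub> \<one>\<^bsub>P\<^esub>"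

abbreviation (input) "J \<equiv> sphere_ideal r"

lemma squares_P: "(\<Oplus>\<^bsub>P\<^esub>i\<in>{1..r}. mvar i [^]\<^bsub>P\<^esub> (2::nat)) \<in> carrier P"
  using var_P by (intro P.finsum_closed) auto

lemma sphere_poly_P: "sphere_poly \<in> carrier P"
  unfolding sphere_poly_def using squares_P by simp

text \<open>Describes members as multiples of \<open>sphere_poly\<close>; invariance under negation
  and vanishing on the sphere are both checked on this one polynomial.\<close>

lemma J_eq: "J = PIdl\<^bsub>P\<^esub> sphere_poly"
  unfolding sphere_ideal_def sphere_poly_def[symmetric] using P.cgenideal_eq_genideal[OF sphere_poly_P] by simp

interpretation J: ideal J P
  unfolding J_eq by (rule P.cgenideal_ideal[OF sphere_poly_P])

lemma negate_sphere_poly: "negate_vars r sphere_poly = sphere_poly"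
proof -
  have "negate_vars r (\<Oplus>\<^bsub>P\<^esub>i\<in>{1..r}. mvar i [^]\<^bsub>P\<^esub> (2::nat)) = (\<Oplus>\<^bsub>P\<^esub>i\<in>{1..r}. negate_vars r (mvar i [^]\<^bsub>P\<^esub> (2::nat)))"
    using var_P by (subst neg.hom_finsum) (auto simp: o_def)
  also have "\<dots> = (\<Oplus>\<^bsub>P\<^esub>i\<in>{1..r}. mvar i [^]\<^bsub>P\<^esub> (2::nat))"
  proof (intro P.finsum_cong' refl)
    fix i assume i: "i \<in> {1..r}"
    have "negate_vars r (mvar i) = \<ominus>\<^bsub>P\<^esub> mvar i" unfolding negate_vars_def using neg.ev_var[OF i] .
    then show "negate_vars r (mvar i [^]\<^bsub>P\<^esub> (2::nat)) = mvar i [^]\<^bsub>P\<^esub> (2::nat)"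
      using var_P[OF i] by (simp add: numeral_2_eq_2 P.l_minus P.r_minus)
  qed (use var_P in auto)
  finally show ?thesis
    unfolding sphere_poly_def using squares_P by (simp add: a_minus_def)
qed

lemma negate_J: "p \<in> J \<Longrightarrow> negate_vars r p \<in> J"
  unfolding J_eq cgenideal_def using negate_sphere_poly sphere_poly_P by fastforce

abbreviation (input) "S \<equiv> sphere_ring r"

interpretation S: cring S
  unfolding sphere_ring_def by (rule J.quotient_is_cring[OF P.is_cring])

abbreviation (input) cls :: "real_mpoly \<Rightarrow> real_mpoly set" where "cls p \<equiv> J +>\<^bsub>P\<^esub> p"

interpretation cls: ring_hom_cring P S cls
  using J.rcos_ring_hom_cring[OF P.is_cring] by (simp only: sphere_ring_def)

lemma carrier_S: "carrier S = cls ` carrier P"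
  unfolding sphere_ring_def FactRing_def A_RCOSETS_def' partial_object.simps by blast

lemma cls_eqD:
  assumes "cls p = cls q" "p \<in> carrier P" "q \<in> carrier P"
  shows "p \<ominus>\<^bsub>P\<^esub> q \<in> J"
  using P.quotient_eq_iff_same_a_r_cos[OF J.ideal_axioms assms(2,3)] assms(1) by simp

lemma cls_eqI: "p \<in> carrier P \<Longrightarrow> q \<in> carrier P \<Longrightarrow> p \<ominus>\<^bsub>P\<^esub> q \<in> J \<Longrightarrow> cls p = cls q"
  using P.quotient_eq_iff_same_a_r_cos[OF J.ideal_axioms] by simp

lemma cls_iff: "q \<in> cls p \<longleftrightarrow> (\<exists>j\<in>J. q = j \<oplus>\<^bsub>P\<^esub> p)"
  by (auto simp: a_r_coset_def')

text \<open>The image of a coset is a whole coset and not just a part of one, because the negation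
  is an involution that maps \<open>J\<close> into itself.\<close>

lemma negate_cls:
  assumes p: "p \<in> carrier P"
  shows "negate_vars r ` cls p = cls (negate_vars r p)"
proof
  have JP: "j \<in> carrier P" if "j \<in> J" for j using that J.a_subset by blast
  show "negate_vars r ` cls p \<subseteq> cls (negate_vars r p)"
    using p negate_J JP by (auto simp: cls_iff)
  show "cls (negate_vars r p) \<subseteq> negate_vars r ` cls p"
  proof
    fix q assume "q \<in> cls (negate_vars r p)"
    then obtain j where j: "j \<in> J" "q = j \<oplus>\<^bsub>P\<^esub> negate_vars r p" by (auto simp: cls_iff)
    then have "q = negate_vars r (negate_vars r j \<oplus>\<^bsub>P\<^esub> p)"
      using p JP negate_negate by simp
    moreover have "negate_vars r j \<oplus>\<^bsub>P\<^esub> p \<in> cls p" using negate_J[OF j(1)] by (auto simp: cls_iff)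
    ultimately show "q \<in> negate_vars r ` cls p" by blast
  qed
qed

definition antipode :: "real_mpoly set \<Rightarrow> real_mpoly set" where "antipode = image (negate_vars r)"

lemma antipode_cls: "p \<in> carrier P \<Longrightarrow> antipode (cls p) = cls (negate_vars r p)"
  by (simp add: antipode_def negate_cls)

text \<open>The group consists of 0 and 1. The neutral element imposes no condition, so the
  intersection of the invariants is the fixed set of the antipode.\<close>

lemma sphere_fixed_ring_eq: "sphere_fixed_ring r = S\<lparr>carrier := {x \<in> carrier S. antipode x = x}\<rparr>"
proof -
  have "carrier (integer_mod_group 2) = {0, 1}" by (auto simp: carrier_integer_mod_group)
  moreover have "invariants (carrier S) (antipodal_action r) 0 = carrier S"
    "invariants (carrier S) (antipodal_action r) 1 = {x \<in> carrier S. antipode x = x}"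
    by (auto simp: invariants_def antipodal_action_def antipode_def)
  ultimately have "(\<Inter>g\<in>carrier (integer_mod_group 2). invariants (carrier S) (antipodal_action r) g)
      = carrier S \<inter> {x \<in> carrier S. antipode x = x}"
    by (simp only: INT_insert INT_empty Int_UNIV_right)
  also have "\<dots> = {x \<in> carrier S. antipode x = x}" by blast
  finally show ?thesis by (simp only: sphere_fixed_ring_def)
qed

text \<open>The variables are numbered from 1 and the family \<open>z\<close> of the abstract
  setting from 0, hence the shift by \<open>Suc\<close>. The half of the unit is the class of the
  constant polynomial \<open>1/2\<close>.\<close>

lemma sphere_involution_sphere_ring:
  "sphere_involution S antipode (cls (K.indexed_const (1/2))) r (\<lambda>i. cls (mvar (Suc i)))"
proof (intro sphere_involution.intro sphere_involution_axioms.intro S.is_cring)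
  show "antipode \<in> Ring.ring_hom S S"
  proof (rule ring_hom_memI)
    fix x y assume "x \<in> carrier S" "y \<in> carrier S"
    then obtain p q where pq: "x = cls p" "p \<in> carrier P" "y = cls q" "q \<in> carrier P"
      unfolding carrier_S by blast
    have xy: "x \<otimes>\<^bsub>S\<^esub> y = cls (p \<otimes>\<^bsub>P\<^esub> q)" "x \<oplus>\<^bsub>S\<^esub> y = cls (p \<oplus>\<^bsub>P\<^esub> q)" using pq by simp_all
    have ap: "antipode x = cls (negate_vars r p)" "antipode y = cls (negate_vars r q)"
      using pq antipode_cls by auto
    show "antipode (x \<otimes>\<^bsub>S\<^esub> y) = antipode x \<otimes>\<^bsub>S\<^esub> antipode y"
      unfolding xy(1) ap antipode_cls[OF P.m_closed[OF pq(2,4)]]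
      by (simp only: neg.hom_mult cls.hom_mult neg.hom_closed pq(2,4))
    show "antipode (x \<oplus>\<^bsub>S\<^esub> y) = antipode x \<oplus>\<^bsub>S\<^esub> antipode y"
      unfolding xy(2) ap antipode_cls[OF P.a_closed[OF pq(2,4)]]
      by (simp only: neg.hom_add cls.hom_add neg.hom_closed pq(2,4))
    show "antipode x \<in> carrier S" using pq by (simp add: antipode_cls)
  next
    have "\<one>\<^bsub>S\<^esub> = cls \<one>\<^bsub>P\<^esub>" by simp
    then show "antipode \<one>\<^bsub>S\<^esub> = \<one>\<^bsub>S\<^esub>" by (simp only: antipode_cls[OF P.one_closed] neg.hom_one)
  qed
  show "antipode (antipode x) = x" if "x \<in> carrier S" for x
    using that unfolding carrier_S by (auto simp: antipode_cls negate_negate)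
  let ?h = "K.indexed_const (1/2) :: real_mpoly"
  show "cls ?h \<in> carrier S" using const_P by simp
  have "negate_vars r ?h = ?h" using const_P by (auto simp: negate_vars_eq K.indexed_const_def)
  then show "antipode (cls ?h) = cls ?h" by (simp only: antipode_cls[OF const_P])
  have "?h \<oplus>\<^bsub>P\<^esub> ?h = \<one>\<^bsub>P\<^esub>" by (auto simp: P_simps K.indexed_const_def)
  then show "cls ?h \<oplus>\<^bsub>S\<^esub> cls ?h = \<one>\<^bsub>S\<^esub>" using cls.hom_add[OF const_P const_P] cls.hom_one by metis
  show "cls (mvar (Suc i)) \<in> carrier S" if "i < r" for i using var_P that by simp
  show "antipode (cls (mvar (Suc i))) = \<ominus>\<^bsub>S\<^esub> cls (mvar (Suc i))" if "i < r" for i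
  proof -
    have i: "Suc i \<in> {1..r}" using that by simp
    have "negate_vars r (mvar (Suc i)) = \<ominus>\<^bsub>P\<^esub> mvar (Suc i)"
      unfolding negate_vars_def using neg.ev_var[OF i] .
    then show ?thesis using var_P[OF i] by (simp add: antipode_cls)
  qed
  have zc: "cls (mvar (Suc i)) \<in> carrier S" if "i < r" for i using var_P that by simp
  have "{1..r} = Suc ` {..<r}" by (simp add: lessThan_atLeast0 image_Suc_atLeastLessThan atLeastLessThanSuc_atLeastAtMost)
  then have "(\<Oplus>\<^bsub>S\<^esub>i\<in>{1..r}. cls (mvar i) \<otimes>\<^bsub>S\<^esub> cls (mvar i)) = (\<Oplus>\<^bsub>S\<^esub>i\<in>{..<r}. cls (mvar (Suc i)) \<otimes>\<^bsub>S\<^esub> cls (mvar (Suc i)))"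
    using S.finsum_reindex[of "\<lambda>i. cls (mvar i) \<otimes>\<^bsub>S\<^esub> cls (mvar i)" Suc "{..<r}"] zc by (auto simp: Pi_iff)
  moreover have "(\<Oplus>\<^bsub>S\<^esub>i\<in>{1..r}. cls (mvar i) \<otimes>\<^bsub>S\<^esub> cls (mvar i)) = (\<Oplus>\<^bsub>S\<^esub>i\<in>{1..r}. cls (mvar i [^]\<^bsub>P\<^esub> (2::nat)))"
    using var_P by (intro S.finsum_cong') (auto simp: numeral_2_eq_2)
  moreover have "\<dots> = cls (\<Oplus>\<^bsub>P\<^esub>i\<in>{1..r}. mvar i [^]\<^bsub>P\<^esub> (2::nat))"
    using var_P by (subst cls.hom_finsum) (auto simp: o_def)
  moreover have "\<dots> = cls \<one>\<^bsub>P\<^esub>"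
  proof (rule cls_eqI[OF squares_P P.one_closed])
    show "(\<Oplus>\<^bsub>P\<^esub>i\<in>{1..r}. mvar i [^]\<^bsub>P\<^esub> (2::nat)) \<ominus>\<^bsub>P\<^esub> \<one>\<^bsub>P\<^esub> \<in> J"
      unfolding J_eq sphere_poly_def[symmetric] by (rule P.cgenideal_self[OF sphere_poly_P])
  qed
  ultimately show "(\<Oplus>\<^bsub>S\<^esub>i\<in>{..<r}. cls (mvar (Suc i)) \<otimes>\<^bsub>S\<^esub> cls (mvar (Suc i))) = \<one>\<^bsub>S\<^esub>"
    by (simp only: cls.hom_one)
qed

lemma quadratic_etale_sphere:
  "quadratic_etale_algebra tm tn (sphere_fixed_ring r) (self_algebra S)"
  using sphere_involution.quadratic_etale[OF sphere_involution_sphere_ring]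
  by (simp only: sphere_involution.R_def[OF sphere_involution_sphere_ring] sphere_fixed_ring_eq)

lemma eval_at_J:
  assumes x: "(\<Sum>i\<in>{1..r}. (x i)\<^sup>2) = 1" and p: "p \<in> J"
  shows "eval_at x p = 0"
proof -
  interpret ev: ring_hom_cring P "self_algebra real_ring" "eval_at x" by (rule eval_at_hom)
  have "eval_at x (mvar i) = x i" if "i \<in> {1..r}" for i using at.ev_var that by blast
  then have "eval_at x (mvar i [^]\<^bsub>P\<^esub> (2::nat)) = (x i)\<^sup>2" if "i \<in> {1..r}" for i
    using var_P[OF that] that by (simp add: numeral_2_eq_2)
  then have "eval_at x (\<Oplus>\<^bsub>P\<^esub>i\<in>{1..r}. mvar i [^]\<^bsub>P\<^esub> (2::nat)) = (\<Sum>i\<in>{1..r}. (x i)\<^sup>2)"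
    using var_P by (subst ev.hom_finsum) (auto simp: o_def finsum_real)
  then have "eval_at x sphere_poly = 0"
    unfolding sphere_poly_def a_minus_def
    using squares_P x ev.hom_one by (simp add: a_inv_self_algebra a_inv_real_ring)
  then show ?thesis
    using p sphere_poly_P unfolding J_eq cgenideal_def by auto
qed

text \<open>A point of the sphere gives a well-defined value on classes, since representatives
  differ by an element of \<open>J\<close>.\<close>

lemma eval_at_cls:
  assumes "(\<Sum>i\<in>{1..r}. (x i)\<^sup>2) = 1" "cls p = cls q" "p \<in> carrier P" "q \<in> carrier P"
  shows "eval_at x p = eval_at x q"
proof -
  interpret ev: ring_hom_cring P "self_algebra real_ring" "eval_at x" by (rule eval_at_hom)
  have "eval_at x (p \<ominus>\<^bsub>P\<^esub> q) = 0" using eval_at_J cls_eqD assms by blast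
  then show ?thesis using assms(3,4) by (simp add: a_minus_def a_inv_self_algebra a_inv_real_ring)
qed

text \<open>The invariant is equality of the values at \<open>x\<close> and \<open>-x\<close>, where
  \<open>x\<close> is a common zero of the odd parts of lifts of the generators. It passes to
  everything generated over \<open>R\<close> and fails for a coordinate.\<close>

lemma not_generated:
  assumes r: "r \<ge> 1" and G: "finite G" "card G < r"
  shows "\<not> generates_algebra (sphere_fixed_ring r) (self_algebra S) G"
proof
  assume gen: "generates_algebra (sphere_fixed_ring r) (self_algebra S) G"
  then have GS: "G \<subseteq> carrier S" by (simp add: generates_algebra_def)
  then have "\<forall>g\<in>G. \<exists>p. p \<in> carrier P \<and> g = cls p" unfolding carrier_S by blast
  then obtain lift where lift: "\<And>g. g \<in> G \<Longrightarrow> lift g \<in> carrier P \<and> g = cls (lift g)" by metis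
  obtain b where b: "bij_betw b {0..<card G} G" using ex_bij_betw_nat_finite[OF G(1)] by blast
  define o' where "o' p = (\<lambda>m. if odd (size m) then p m else 0)" for p :: real_mpoly
  \<comment> \<open>The enumeration \<open>b\<close> starts at 0 while the theorem expects indices
    from 1 to \<open>r - 1\<close>; indices beyond the number of generators are filled with the zero
    polynomial.\<close>
  define f :: "nat \<Rightarrow> mpol" where "f j = (if j \<le> card G then Abs_poly_mapping (o' (lift (b (j - 1)))) else 0)" for j
  have look: "Poly_Mapping.lookup (Abs_poly_mapping (o' p)) = o' p" if "p \<in> carrier P" for p
  proof -
    have "finite {m. o' p m \<noteq> 0}"
      by (rule finite_subset[OF _ support_P(1)[OF that]]) (auto simp: o'_def)
    then show ?thesis by simp
  qed
  have bG: "b (j - 1) \<in> G" if "1 \<le> j" "j \<le> card G" for j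
    using bij_betw_apply[OF b, of "j - 1"] that by auto
  have f_odd: "set_mset m \<subseteq> {1..r} \<and> odd (size m)"
    if j: "j \<in> {1..<r}" and m: "m \<in> Poly_Mapping.keys (f j)" for j m
  proof -
    have jG: "j \<le> card G" using m by (auto simp: f_def split: if_splits)
    then have p: "lift (b (j - 1)) \<in> carrier P" using bG lift j by auto
    have "o' (lift (b (j - 1))) m \<noteq> 0" using m jG look[OF p] by (simp add: f_def in_keys_iff)
    then show ?thesis
      using support_P(2)[OF p] by (auto simp: o'_def split: if_splits)
  qed
  obtain x where x: "(\<Sum>i\<in>{1..r}. (x i)\<^sup>2) = 1" and zero: "\<And>j. j \<in> {1..<r} \<Longrightarrow> peval x (f j) = 0"
  proof (rule borsuk_ulam_odd_polynomials[where f = f, OF r f_odd])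
    fix x assume "(\<Sum>i\<in>{1..r}. (x i)\<^sup>2) = 1" "\<And>j. j \<in> {1..<r} \<Longrightarrow> peval x (f j) = 0"
    then show thesis by (rule that)
  qed
  let ?y = "\<lambda>i. - x i"
  have y: "(\<Sum>i\<in>{1..r}. (?y i)\<^sup>2) = 1" using x by simp
  have G_even: "eval_at x (lift g) = eval_at ?y (lift g)" if g: "g \<in> G" for g
  proof -
    let ?p = "lift g"
    have p: "?p \<in> carrier P" using lift[OF g] by blast
    have "g \<in> b ` {0..<card G}" using b g by (simp add: bij_betw_def)
    then obtain k where k: "k < card G" "b k = g" by auto
    then have "f (Suc k) = Abs_poly_mapping (o' ?p)" by (simp add: f_def)
    moreover have "Suc k \<in> {1..<r}" using k G(2) by auto
    ultimately have "peval x (Abs_poly_mapping (o' ?p)) = 0" using zero by metis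
    moreover have "peval x (Abs_poly_mapping (o' ?p)) = (\<Sum>m | ?p m \<noteq> 0. o' ?p m * prod_mset (image_mset x m))"
    proof -
      have "Poly_Mapping.keys (Abs_poly_mapping (o' ?p)) \<subseteq> {m. ?p m \<noteq> 0}"
      proof
        fix m assume "m \<in> Poly_Mapping.keys (Abs_poly_mapping (o' ?p))"
        then have "o' ?p m \<noteq> 0" by (simp add: in_keys_iff look[OF p])
        then show "m \<in> {m. ?p m \<noteq> 0}" by (simp add: o'_def split: if_splits)
      qed
      from peval_superset[OF support_P(1)[OF p] this, of x] show ?thesis by (simp only: look[OF p])
    qed
    \<comment> \<open>Even monomials agree at \<open>x\<close> and \<open>-x\<close> and odd ones
      change sign, so the difference of the two values is twice the value of the odd part.\<close>
    moreover have "2 * (\<Sum>m | ?p m \<noteq> 0. o' ?p m * prod_mset (image_mset x m)) = eval_at x ?p - eval_at ?y ?p"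
    proof -
      have "eval_at ?y ?p = (\<Sum>m | ?p m \<noteq> 0. (- 1) ^ size m * ?p m * prod_mset (image_mset x m))"
        using eval_at_negate[OF p, of x] eval_at_sum[OF support_P(1)[OF p], of "negate_vars r ?p" x]
        by (simp add: negate_vars_eq[OF p])
      then show ?thesis
        using eval_at_sum[OF support_P(1)[OF p] order_refl, of x]
        by (simp add: sum_subtractf[symmetric] sum_distrib_left)
          (intro sum.cong, auto simp: o'_def)
    qed
    ultimately show ?thesis by simp
  qed
  interpret ex: ring_hom_cring P "self_algebra real_ring" "eval_at x" by (rule eval_at_hom)
  interpret ey: ring_hom_cring P "self_algebra real_ring" "eval_at ?y" by (rule eval_at_hom)
  \<comment> \<open>It is enough that one representative has equal values; the classes with this
    property are closed under all ring operations.\<close>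
  define T where "T = {cls p |p. p \<in> carrier P \<and> eval_at x p = eval_at ?y p}"
  let ?gens = "(\<lambda>a. a \<odot>\<^bsub>self_algebra S\<^esub> \<one>\<^bsub>self_algebra S\<^esub>) ` carrier (sphere_fixed_ring r) \<union> G"
  have T: "W \<in> T" if "W \<in> generate_ring (self_algebra S) ?gens" for W
    using that
  proof (induction rule: generate_ring.induct)
    case one
    have "\<one>\<^bsub>self_algebra S\<^esub> = cls \<one>\<^bsub>P\<^esub>" by simp
    moreover have "eval_at x \<one>\<^bsub>P\<^esub> = eval_at ?y \<one>\<^bsub>P\<^esub>" by (simp only: ex.hom_one ey.hom_one)
    ultimately show ?case using P.one_closed unfolding T_def by blast
  next
    case (incl W)
    then consider a where "a \<in> carrier (sphere_fixed_ring r)" "W = a \<odot>\<^bsub>self_algebra S\<^esub> \<one>\<^bsub>self_algebra S\<^esub>" | "W \<in> G"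
      by blast
    then show ?case
    proof cases
      case 1
      then have a: "W \<in> carrier S" "antipode W = W" by (auto simp: sphere_fixed_ring_eq)
      then obtain p where p: "p \<in> carrier P" "W = cls p" unfolding carrier_S by blast
      \<comment> \<open>Invariance holds for the class only: \<open>p\<close> and its negation may
        differ by an element of \<open>J\<close>, which vanishes at \<open>x\<close>.\<close>
      then have "cls (negate_vars r p) = cls p" using a(2) antipode_cls by simp
      then have "eval_at x (negate_vars r p) = eval_at x p"
        by (rule eval_at_cls[OF x _ neg.hom_closed[OF p(1)] p(1)])
      then have "eval_at x p = eval_at ?y p" unfolding eval_at_negate[OF p(1)] by (rule sym)
      then show ?thesis using p unfolding T_def by blast
    next
      case 2
      then show ?thesis using lift[of W] G_even[of W] unfolding T_def by blast
    qed
  next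
    case (a_inv W)
    then obtain p where p: "p \<in> carrier P" "W = cls p" "eval_at x p = eval_at ?y p" by (auto simp: T_def)
    have "\<ominus>\<^bsub>self_algebra S\<^esub> W = cls (\<ominus>\<^bsub>P\<^esub> p)" using p by (simp add: a_inv_self_algebra)
    moreover have "eval_at x (\<ominus>\<^bsub>P\<^esub> p) = eval_at ?y (\<ominus>\<^bsub>P\<^esub> p)"
      using p(3) ex.hom_a_inv[OF p(1)] ey.hom_a_inv[OF p(1)] by simp
    ultimately show ?case using P.a_inv_closed[OF p(1)] unfolding T_def by blast
  next
    case (eng_add W Y)
    then obtain p q where p: "p \<in> carrier P" "W = cls p" "eval_at x p = eval_at ?y p"
      and q: "q \<in> carrier P" "Y = cls q" "eval_at x q = eval_at ?y q" by (auto simp: T_def)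
    have "W \<oplus>\<^bsub>self_algebra S\<^esub> Y = cls (p \<oplus>\<^bsub>P\<^esub> q)" using p q by simp
    moreover have "eval_at x (p \<oplus>\<^bsub>P\<^esub> q) = eval_at ?y (p \<oplus>\<^bsub>P\<^esub> q)"
      using p(3) q(3) ex.hom_add[OF p(1) q(1)] ey.hom_add[OF p(1) q(1)] by simp
    ultimately show ?case using P.a_closed[OF p(1) q(1)] unfolding T_def by blast
  next
    case (eng_mult W Y)
    then obtain p q where p: "p \<in> carrier P" "W = cls p" "eval_at x p = eval_at ?y p"
      and q: "q \<in> carrier P" "Y = cls q" "eval_at x q = eval_at ?y q" by (auto simp: T_def)
    have "W \<otimes>\<^bsub>self_algebra S\<^esub> Y = cls (p \<otimes>\<^bsub>P\<^esub> q)" using p q by simp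
    moreover have "eval_at x (p \<otimes>\<^bsub>P\<^esub> q) = eval_at ?y (p \<otimes>\<^bsub>P\<^esub> q)"
      using p(3) q(3) ex.hom_mult[OF p(1) q(1)] ey.hom_mult[OF p(1) q(1)] by simp
    ultimately show ?case using P.m_closed[OF p(1) q(1)] unfolding T_def by blast
  qed
  have "x i = 0" if i: "i \<in> {1..r}" for i
  proof -
    have "cls (mvar i) \<in> generate_ring (self_algebra S) ?gens"
      using gen var_P[OF i] by (simp add: generates_algebra_def)
    then obtain p where p: "cls (mvar i) = cls p" "p \<in> carrier P" "eval_at x p = eval_at ?y p"
      using T by (auto simp: T_def)
    \<comment> \<open>Both \<open>x\<close> and \<open>-x\<close> lie on the sphere, so at each of
      them the coordinate and the symmetric representative \<open>p\<close> have the same value.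
      This gives \<open>x i = - x i\<close>.\<close>
    have "eval_at x (mvar i) = eval_at ?y (mvar i)"
      using eval_at_cls[OF x p(1) var_P[OF i] p(2)] eval_at_cls[OF y p(1) var_P[OF i] p(2)] p(3) by simp
    then show ?thesis using at.ev_var[OF i] by simp
  qed
  then show False using x by simp
qed

end

theorem proposition7p9:
  fixes r :: nat
  assumes "r \<ge> 1"
  shows "quadratic_etale_algebra TYPE('m) TYPE('n)
           (sphere_fixed_ring r) (self_algebra (sphere_ring r)) \<and>
         \<not> (\<exists>G. finite G \<and> card G < r \<and>
               generates_algebra (sphere_fixed_ring r) (self_algebra (sphere_ring r)) G)"
  using quadratic_etale_sphere not_generated[OF assms] by blast

end
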